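(* (a) There is a bijection between planar maps $M$ with a marked discovery and pairs of planar maps $(M_1,M_2)$ such that $M_1$ has a marked vertex and $M_2$ has a marked leaf. This bijection preserves the total number of edges and the total number of faces (i.e. the number of edges, resp. faces, of $M$ is the sum of those of $M_1$ and $M_2$). Consequently, for all $n\ge 0$ and $f\ge 1$, $$(f-1)Q(n,f)=\sum_{\substack{i+j=n-1\\ i,j\geq 0}}\ \sum_{\substack{f_1+f_2=f\\ f_1,f_2\geq 1}}v_1\,Q(i,f_1)\,(2j+1)\,Q(j,f_2),$$ where $Q(n,f)$ is the number of planar maps with $n$ edges and $f$ faces, and $v_1=2+i-f_1$ is the number of vertices of a planar map with $i$ edges and $f_1$ faces. (b) Likewise, there is a bijection between planar precubic maps with a marked discovery and pairs $(M_1,M_2)$ of planar precubic maps, each with a marked leaf, which preserves the total number of edges and the total number of faces. Consequently, for all $n\ge 0$, $f\ge 1$, $$(f-1)\alpha(n,f)=\sum_{\substack{i+j=n\\ i,j\ge 0}}\ \sum_{\substack{f_1+f_2=f\\ f_1,f_2\ge 1}}\alpha^{(1)}(i,f_1)\,\alpha^{(1)}(j,f_2),$$ where $\alpha(n,f)$ is the number of planar precubic maps with $n$ edges and $f$ faces, and $\alpha^{(1)}(n,f)$ is the number of planar precubic maps with $n$ edges and $f$ faces and a marked leaf.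
   Context: A map is a connected multigraph (loops and multiple edges allowed) embedded in a compact connected oriented surface so that the complement is a disjoint union of open disks (the faces), considered up to (orientation-preserving) homeomorphism; equivalently, a connected multigraph with a rotation system giving the clockwise cyclic order of half-edges around each vertex. A corner is an angular sector between two consecutive half-edges around a vertex. A rooted map is a map with a distinguished corner, in which a small arrow is placed, splitting that corner into two corners (so a rooted map with $n$ edges has $2n+1$ corners; the single-vertex map has $n=0$ and one corner). The arrow does not count in vertex degrees. A planar map is a rooted map of genus $0$. The root vertex is the vertex carrying the arrow; the face containing the arrow is the outer (root) face. A leaf is a vertex of degree $1$ that is not the root vertex. A precubic map is a map all of whose vertices have degree $1$ or $3$, rooted at a vertex of degree $1$. Exploration and discoveries of a planar map: start at the corner that immediately follows the arrow in clockwise order around the root vertex; initially only the outer face is declared discovered. At each step one is in a corner $c$ of a vertex $v$, lying in a face $F$ of the map; let $h$ be the half-edge following $c$ clockwise around $v$, and $e$ its edge. (i) If $e$ has not been opened and its other side lies in a face not yet discovered, then $e$ is called a discovery: open $e$ into two dangling half-edges, a bud at $v$ and a stem at its other end, declare the face on the other side of $e$ discovered, and move to the corner following $h$ clockwise around $v$ (which lies in the new face). (ii) If $h$ is a bud or stem of an already opened edge, move to the corner following $h$ clockwise around $v$. (iii) Otherwise, traverse $e$ to its other half-edge $h'$ at its other end $w$ and move to the corner following $h'$ clockwise around $w$. Stop upon reaching the arrow again. (Thus one walks keeping the edges on the right.) A map with $f$ faces has exactly $f-1$ discoveries. Discoveries are regarded as edges of the original map. *)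

theory Defs
  imports Main "HOL-Combinatorics.Permutations" "HOL-Combinatorics.Orbits"
begin

text \<open>
  Rooted maps are given by rotation systems. The darts are the half-edges together with one
  extra dart, the arrow, which sits in the distinguished corner: \<open>rot\<close> sends a dart to the next
  one clockwise around its vertex, \<open>opp\<close> sends a half-edge to the other half of its edge and
  fixes exactly the arrow. A corner is represented by the dart that follows it clockwise, so a
  rooted map with n edges has 2n+1 darts and as many corners, and the single-vertex map has the
  arrow as its only dart.
\<close>

record 'a rmap =
  darts :: "'a set"
  rot :: "'a \<Rightarrow> 'a"
  opp :: "'a \<Rightarrow> 'a"
  arrow :: 'a

definition rooted_map :: "'a rmap \<Rightarrow> bool" where
  "rooted_map M \<longleftrightarrow>
     finite (darts M) \<and> arrow M \<in> darts M \<and>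
     rot M permutes darts M \<and> opp M permutes darts M \<and>
     (\<forall>h\<in>darts M. opp M (opp M h) = h) \<and>
     (\<forall>h\<in>darts M. opp M h = h \<longleftrightarrow> h = arrow M) \<and>
     (\<forall>x\<in>darts M. \<forall>y\<in>darts M.
        (x, y) \<in> ({(h, rot M h) |h. h \<in> darts M} \<union> {(h, opp M h) |h. h \<in> darts M})\<^sup>*)"

definition vertex_of :: "'a rmap \<Rightarrow> 'a \<Rightarrow> 'a set" where
  "vertex_of M h = orbit (rot M) h"

definition edge_of :: "'a rmap \<Rightarrow> 'a \<Rightarrow> 'a set" where
  "edge_of M h = {h, opp M h}"

text \<open>
  The face containing the corner before the dart h. Following the boundary with the edges on the
  right, one traverses h and arrives in the corner after \<open>opp M h\<close>, which is represented by
  \<open>rot M (opp M h)\<close>. Since \<open>opp\<close> fixes the arrow, the two corners beside it are in one face. The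
  face on the other side of the edge of h is \<open>face_of M (opp M h)\<close>, which contains the corner
  after h, because \<open>rot M (opp M (opp M h)) = rot M h\<close>.
\<close>

definition face_of :: "'a rmap \<Rightarrow> 'a \<Rightarrow> 'a set" where
  "face_of M h = orbit (rot M \<circ> opp M) h"

definition vertices :: "'a rmap \<Rightarrow> 'a set set" where
  "vertices M = vertex_of M ` darts M"

definition edges :: "'a rmap \<Rightarrow> 'a set set" where
  "edges M = edge_of M ` (darts M - {arrow M})"

definition faces :: "'a rmap \<Rightarrow> 'a set set" where
  "faces M = face_of M ` darts M"

definition has_genus :: "'a rmap \<Rightarrow> nat \<Rightarrow> bool" where
  "has_genus M g \<longleftrightarrow>
     int (card (vertices M)) - int (card (edges M)) + int (card (faces M)) = 2 - 2 * int g"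

definition planar_map :: "'a rmap \<Rightarrow> bool" where
  "planar_map M \<longleftrightarrow> rooted_map M \<and> has_genus M 0"

definition root_vertex :: "'a rmap \<Rightarrow> 'a set" where
  "root_vertex M = vertex_of M (arrow M)"

definition degree :: "'a rmap \<Rightarrow> 'a set \<Rightarrow> nat" where
  "degree M v = card (v - {arrow M})"

definition leaves :: "'a rmap \<Rightarrow> 'a set set" where
  "leaves M = {v \<in> vertices M. degree M v = 1 \<and> v \<noteq> root_vertex M}"

definition planar_precubic_map :: "'a rmap \<Rightarrow> bool" where
  "planar_precubic_map M \<longleftrightarrow>
     planar_map M \<and> (\<forall>v\<in>vertices M. degree M v \<in> {1, 3}) \<and> degree M (root_vertex M) = 1"

text \<open>
  \<open>explores M h E F\<close>: at some step the exploration of M is in the corner before the dart h, the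
  set of opened edges being E and the set of discovered faces being F.
\<close>

inductive explores :: "'a rmap \<Rightarrow> 'a \<Rightarrow> 'a set set \<Rightarrow> 'a set set \<Rightarrow> bool" for M where
  start: "explores M (rot M (arrow M)) {} {face_of M (arrow M)}"
| discover: "\<lbrakk>explores M h E F; h \<noteq> arrow M; edge_of M h \<notin> E; face_of M (opp M h) \<notin> F\<rbrakk>
    \<Longrightarrow> explores M (rot M h) (insert (edge_of M h) E) (insert (face_of M (opp M h)) F)"
| skip_opened: "\<lbrakk>explores M h E F; h \<noteq> arrow M; edge_of M h \<in> E\<rbrakk>
    \<Longrightarrow> explores M (rot M h) E F"
| traverse: "\<lbrakk>explores M h E F; h \<noteq> arrow M; edge_of M h \<notin> E; face_of M (opp M h) \<in> F\<rbrakk>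
    \<Longrightarrow> explores M (rot M (opp M h)) E F"

definition discoveries :: "'a rmap \<Rightarrow> 'a set set" where
  "discoveries M = {e. \<exists>h E F. explores M h E F \<and> e \<in> E}"

definition map_iso :: "('a \<Rightarrow> 'b) \<Rightarrow> 'a rmap \<Rightarrow> 'b rmap \<Rightarrow> bool" where
  "map_iso g M N \<longleftrightarrow>
     bij_betw g (darts M) (darts N) \<and> g (arrow M) = arrow N \<and>
     (\<forall>h\<in>darts M. g (rot M h) = rot N (g h) \<and> g (opp M h) = opp N (g h))"

text \<open>
  Maps are considered up to isomorphism. As they are finite, darts can be taken to be natural
  numbers. A map with a marked vertex, edge or leaf is a pair (M, S) where the set of darts S is
  the marked object.
\<close>

definition iso_rel :: "(nat rmap \<times> nat rmap) set" where
  "iso_rel = {(M, N). rooted_map M \<and> rooted_map N \<and> (\<exists>g. map_iso g M N)}"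

definition marked_iso_rel :: "((nat rmap \<times> nat set) \<times> (nat rmap \<times> nat set)) set" where
  "marked_iso_rel = {((M, S), (N, T)).
     rooted_map M \<and> rooted_map N \<and> S \<subseteq> darts M \<and> T \<subseteq> darts N \<and>
     (\<exists>g. map_iso g M N \<and> T = g ` S)}"

definition planar_with_discovery :: "(nat rmap \<times> nat set) set set" where
  "planar_with_discovery = {(M, e). planar_map M \<and> e \<in> discoveries M} // marked_iso_rel"

definition planar_with_vertex :: "(nat rmap \<times> nat set) set set" where
  "planar_with_vertex = {(M, v). planar_map M \<and> v \<in> vertices M} // marked_iso_rel"

definition planar_with_leaf :: "(nat rmap \<times> nat set) set set" where
  "planar_with_leaf = {(M, v). planar_map M \<and> v \<in> leaves M} // marked_iso_rel"

definition precubic_with_discovery :: "(nat rmap \<times> nat set) set set" where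
  "precubic_with_discovery =
     {(M, e). planar_precubic_map M \<and> e \<in> discoveries M} // marked_iso_rel"

definition precubic_with_leaf :: "(nat rmap \<times> nat set) set set" where
  "precubic_with_leaf = {(M, v). planar_precubic_map M \<and> v \<in> leaves M} // marked_iso_rel"

definition preserves_edges_faces ::
  "(nat rmap \<times> nat set) set set \<Rightarrow>
   ((nat rmap \<times> nat set) set \<Rightarrow> (nat rmap \<times> nat set) set \<times> (nat rmap \<times> nat set) set) \<Rightarrow> bool"
where
  "preserves_edges_faces X \<Phi> \<longleftrightarrow>
     (\<forall>x\<in>X. \<forall>(M, S)\<in>x. \<forall>(M1, S1)\<in>fst (\<Phi> x). \<forall>(M2, S2)\<in>snd (\<Phi> x).
        card (edges M) = card (edges M1) + card (edges M2) \<and>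
        card (faces M) = card (faces M1) + card (faces M2))"

definition Q :: "nat \<Rightarrow> nat \<Rightarrow> nat" where
  "Q n f = card ({M. planar_map M \<and> card (edges M) = n \<and> card (faces M) = f} // iso_rel)"

definition precubic_count :: "nat \<Rightarrow> nat \<Rightarrow> nat" where
  "precubic_count n f =
     card ({M. planar_precubic_map M \<and> card (edges M) = n \<and> card (faces M) = f} // iso_rel)"

definition precubic_leaf_count :: "nat \<Rightarrow> nat \<Rightarrow> nat" where
  "precubic_leaf_count n f =
     card ({(M, v). planar_precubic_map M \<and> v \<in> leaves M \<and>
              card (edges M) = n \<and> card (faces M) = f} // marked_iso_rel)"

end

theory Submission
  imports Defs "HOL-Computational_Algebra.Formal_Power_Series"
begin

text \<open>
  Both bijections only have to preserve the numbers of edges and faces, so each of them exists as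
  soon as both sides have equally many classes with given numbers of edges and faces.

  Tutte's removal of the root edge counts planar maps by edges, faces and root degree: if the edge
  is a loop, the map splits at the root vertex into two maps; otherwise the edge is contracted. This
  gives a quadratic equation \<open>P = E(P, M, t, u, y)\<close> for the series \<open>P(y)\<close>, where \<open>M\<close> does not
  depend on the catalytic variable \<open>y\<close>. Marking a discovery (there is one for each face but the
  outer one), a vertex or a leaf amounts to a derivation of this equation. The series \<open>Y(t, u)\<close> that
  cancels the coefficient of the derivative of \<open>P\<close> gives, with \<open>p = P(Y)\<close>, the marked series
  \<open>u Y p\<^sup>2\<close>, \<open>p\<close> and \<open>Y p\<close>, and the first is \<open>u\<close> times the product of the other two. For precubic
  maps one gets in the same way \<open>u Z\<^sup>2 h\<^sup>2\<close> for discoveries and \<open>Z h\<close> for leaves.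
\<close>

text \<open>Since a marking is an additive statistic \<open>w\<close>, the marked series
  \<open>P w\<close> satisfies a linear equation in which its coefficient is always
  \<open>y(1-y) - t - 2tuyP\<close>. One series Y with \<open>Y(1-Y) = t + 2tuY P(Y)\<close>
  therefore cancels it for every marking at once, and what is left determines the marked series free
  of y. For precubic maps the coefficient to cancel is \<open>y - t - ty^2 - 2tuy^3 H\<close>. The
  obstacle is the sum over the degree of the vertex split off by the root edge: in the variable z of
  the root degree it needs a division by \<open>z - 1\<close> and a value at \<open>z = 1\<close>,
  away from the origin. With \<open>y = 1 - 1/z\<close> the division is by y and Y has zero constant
  term, so all takes place in formal power series over the integers. Counting classes is legitimate
  because a rooted map has no automorphism but the identity on its darts; the counts yield
  bijections because only finitely many marked codes share given numbers of edges and faces. What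
  enters of the exploration is that it makes one discovery fewer than there are faces and that it
  commutes with isomorphisms.\<close>

unbundle fps_syntax

section \<open>Trees for the root edge decomposition, their statistics and finite
  enumeration\<close>

section \<open>Codes of planar maps\<close>

text \<open>
  \<open>Loop c1 c2\<close>: the root edge is a loop, and splitting the root vertex there leaves two maps.
  \<open>Edge k c\<close>: contracting the root edge merges a vertex of degree \<open>Suc k\<close> into the root vertex, and
  its other \<open>k\<close> darts become the first \<open>k\<close> after the arrow. Every vertex but the root vertex arises
  from one \<open>Edge\<close>, and every face but the outer one from one \<open>Loop\<close>.
\<close>

datatype code = Point | Loop code code | Edge nat code

text \<open>Undoing the contraction restores the root edge and takes \<open>k\<close> darts away
  from the root vertex, hence \<open>Suc (root_deg c - k)\<close>. On \<open>valid\<close> codes the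
  subtraction does not truncate.\<close>

fun root_deg :: "code \<Rightarrow> nat" where
  "root_deg Point = 0"
| "root_deg (Loop c1 c2) = root_deg c1 + root_deg c2 + 2"
| "root_deg (Edge k c) = Suc (root_deg c - k)"

fun valid :: "code \<Rightarrow> bool" where
  "valid Point \<longleftrightarrow> True"
| "valid (Loop c1 c2) \<longleftrightarrow> valid c1 \<and> valid c2"
| "valid (Edge k c) \<longleftrightarrow> valid c \<and> k \<le> root_deg c"

fun nedges :: "code \<Rightarrow> nat" where
  "nedges Point = 0"
| "nedges (Loop c1 c2) = Suc (nedges c1 + nedges c2)"
| "nedges (Edge k c) = Suc (nedges c)"

fun nloops :: "code \<Rightarrow> nat" where
  "nloops Point = 0"
| "nloops (Loop c1 c2) = Suc (nloops c1 + nloops c2)"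
| "nloops (Edge k c) = nloops c"

text \<open>Only non-root vertices are counted. The predicate selects all of them
  (\<open>True\<close>), the leaves (\<open>k = 1\<close>), or those of a forbidden degree.\<close>

fun nverts :: "(nat \<Rightarrow> bool) \<Rightarrow> code \<Rightarrow> nat" where
  "nverts P Point = 0"
| "nverts P (Loop c1 c2) = nverts P c1 + nverts P c2"
| "nverts P (Edge k c) = (if P (Suc k) then 1 else 0) + nverts P c"

text \<open>The root vertex is unconstrained, since its degree varies under the recursion; precubic
  codes fix it separately to 1.\<close>

fun degs_in :: "nat set \<Rightarrow> code \<Rightarrow> bool" where
  "degs_in D Point \<longleftrightarrow> True"
| "degs_in D (Loop c1 c2) \<longleftrightarrow> degs_in D c1 \<and> degs_in D c2"
| "degs_in D (Edge k c) \<longleftrightarrow> Suc k \<in> D \<and> degs_in D c"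

definition codes :: "nat set \<Rightarrow> nat \<Rightarrow> code set" where
  "codes D n = {c. valid c \<and> degs_in D c \<and> nedges c = n}"

lemma degs_in_iff_nverts: "degs_in D c \<longleftrightarrow> nverts (\<lambda>k. k \<notin> D) c = 0"
  by (induction c) auto

text \<open>This is Euler's relation: each node creates one edge and either one non-root vertex or
  one face other than the outer one.\<close>

lemma nedges_eq: "nedges c = nverts (\<lambda>_. True) c + nloops c"
  by (induction c) auto

lemma codes_0: "codes D 0 = {Point}"
proof -
  have "nedges c = 0 \<longleftrightarrow> c = Point" for c by (cases c) auto
  then have "codes D 0 = {c. valid c \<and> degs_in D c \<and> c = Point}" by (simp only: codes_def)
  then show ?thesis by fastforce
qed

lemma codes_Suc:
  "codes D (Suc n) =
     (\<lambda>(i, c1, c2). Loop c1 c2) ` (SIGMA i:{..n}. codes D i \<times> codes D (n - i)) \<union>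
     (\<lambda>(c, k). Edge k c) ` (SIGMA c:codes D n. {k. k \<le> root_deg c \<and> Suc k \<in> D})"
  (is "_ = ?L \<union> ?E")
proof
  show "codes D (Suc n) \<subseteq> ?L \<union> ?E"
  proof
    fix c assume c: "c \<in> codes D (Suc n)"
    show "c \<in> ?L \<union> ?E"
    proof (cases c)
      case (Loop c1 c2)
      then have "(nedges c1, c1, c2) \<in> (SIGMA i:{..n}. codes D i \<times> codes D (n - i))"
        using c by (auto simp: codes_def)
      from imageI[OF this, of "\<lambda>(i, c1, c2). Loop c1 c2"] show ?thesis using Loop by simp
    next
      case (Edge k c')
      then have "(c', k) \<in> (SIGMA c:codes D n. {k. k \<le> root_deg c \<and> Suc k \<in> D})"
        using c by (auto simp: codes_def)
      from imageI[OF this, of "\<lambda>(c, k). Edge k c"] show ?thesis using Edge by simp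
    qed (use c in \<open>auto simp: codes_def\<close>)
  qed
  show "?L \<union> ?E \<subseteq> codes D (Suc n)" by (auto simp: codes_def)
qed

lemma finite_codes [simp]: "finite (codes D n)"
proof (induction n rule: less_induct)
  case (less n)
  show ?case
  proof (cases n)
    case (Suc m)
    have "finite (SIGMA i:{..m}. codes D i \<times> codes D (m - i))"
      using less Suc by (intro finite_SigmaI) auto
    moreover have "finite (SIGMA c:codes D m. {k. k \<le> root_deg c \<and> Suc k \<in> D})"
      using less Suc by (intro finite_SigmaI) auto
    ultimately show ?thesis by (simp add: Suc codes_Suc)
  qed (simp add: codes_0)
qed

lemma sum_codes_Suc:
  fixes \<phi> :: "code \<Rightarrow> 'a::comm_monoid_add"
  shows "sum \<phi> (codes D (Suc n)) =
     (\<Sum>i\<le>n. \<Sum>c1\<in>codes D i. \<Sum>c2\<in>codes D (n - i). \<phi> (Loop c1 c2)) +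
     (\<Sum>c\<in>codes D n. \<Sum>k | k \<le> root_deg c \<and> Suc k \<in> D. \<phi> (Edge k c))"
proof -
  let ?A = "SIGMA i:{..n}. codes D i \<times> codes D (n - i)"
  let ?B = "SIGMA c:codes D n. {k. k \<le> root_deg c \<and> Suc k \<in> D}"
  have fin: "finite ?A" "finite ?B" by (intro finite_SigmaI; simp)+
  have "inj_on (\<lambda>(i, c1, c2). Loop c1 c2) ?A"
    by (auto simp: inj_on_def codes_def)
  moreover have "inj_on (\<lambda>(c, k). Edge k c) ?B"
    by (auto simp: inj_on_def)
  ultimately have "sum \<phi> (codes D (Suc n)) =
      (\<Sum>(i, c1, c2)\<in>?A. \<phi> (Loop c1 c2)) + (\<Sum>(c, k)\<in>?B. \<phi> (Edge k c))"
    unfolding codes_Suc using fin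
    by (subst sum.union_disjoint)
       (auto simp: sum.reindex intro!: sum.cong finite_imageI arg_cong2[of _ _ _ _ "(+)"])
  also have "(\<Sum>(i, c1, c2)\<in>?A. \<phi> (Loop c1 c2)) =
      (\<Sum>i\<le>n. \<Sum>c1\<in>codes D i. \<Sum>c2\<in>codes D (n - i). \<phi> (Loop c1 c2))"
    by (subst sum.Sigma[symmetric]) (auto simp: sum.cartesian_product)
  also have "(\<Sum>(c, k)\<in>?B. \<phi> (Edge k c)) =
      (\<Sum>c\<in>codes D n. \<Sum>k | k \<le> root_deg c \<and> Suc k \<in> D. \<phi> (Edge k c))"
    by (subst sum.Sigma[symmetric]) auto
  finally show ?thesis .
qed

section \<open>Substituting a series in t for the catalytic variable\<close>

text \<open>
  The substitution of a series \<open>Z(t)\<close> with zero constant term for \<open>y\<close> in a series in \<open>t\<close> whose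
  coefficients are series in \<open>y\<close>.
\<close>

definition fps_subst :: "'a::comm_ring_1 fps \<Rightarrow> 'a fps fps \<Rightarrow> 'a fps" where
  "fps_subst Z a = Abs_fps (\<lambda>m. \<Sum>n\<le>m. fps_compose (fps_nth a n) Z $ (m - n))"

text \<open>The n-th term carries \<open>t^n\<close>, so the coefficient of \<open>t^m\<close> sees
  only the terms with \<open>n \<le> m\<close>, and one finite truncation can stand for the infinite
  sum.\<close>

lemma fps_subst_cutoff:
  assumes "m \<le> N"
  shows "fps_subst Z a $ m = (\<Sum>n\<le>N. fps_X ^ n * fps_compose (fps_nth a n) Z) $ m"
proof -
  have "(\<Sum>n\<le>N. fps_X ^ n * fps_compose (fps_nth a n) Z) $ m =
        (\<Sum>n\<le>N. if n \<le> m then fps_compose (fps_nth a n) Z $ (m - n) else 0)"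
    unfolding fps_sum_nth by (intro sum.cong) (auto simp: fps_X_power_mult_nth)
  also have "\<dots> = (\<Sum>n\<le>m. fps_compose (fps_nth a n) Z $ (m - n))"
    using assms by (intro sum.mono_neutral_cong_right) auto
  finally show ?thesis by (simp add: fps_subst_def)
qed

lemma fps_subst_add [simp]: "fps_subst Z (a + b) = fps_subst Z a + fps_subst Z b"
  by (rule fps_ext) (simp add: fps_subst_def fps_compose_add_distrib sum.distrib)

text \<open>Both factors are truncated at m and the double sum is regrouped by total degree in t.
  The hypothesis on Z makes composition multiplicative in each coefficient.\<close>

lemma fps_subst_mult [simp]:
  fixes a b :: "'a::idom fps fps"
  assumes "Z $ 0 = 0"
  shows "fps_subst Z (a * b) = fps_subst Z a * fps_subst Z b"
proof (rule fps_ext)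
  fix m
  define a' b' where "a' = (\<lambda>n. fps_compose (fps_nth a n) Z)" and "b' = (\<lambda>n. fps_compose (fps_nth b n) Z)"
  let ?A = "\<Sum>n\<le>m. fps_X ^ n * a' n" and ?B = "\<Sum>n\<le>m. fps_X ^ n * b' n"
  have "(fps_subst Z a * fps_subst Z b) $ m = (?A * ?B) $ m"
    unfolding fps_mult_nth a'_def b'_def
    by (intro sum.cong refl arg_cong2[of _ _ _ _ "(*)"] fps_subst_cutoff) auto
  also have "?A * ?B = (\<Sum>i\<le>m. \<Sum>j\<le>m. fps_X ^ (i + j) * (a' i * b' j))"
    by (simp add: sum_product power_add mult_ac)
  also have "\<dots> $ m = (\<Sum>i\<le>m. \<Sum>j\<le>m. if i + j \<le> m then (a' i * b' j) $ (m - (i + j)) else 0)"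
    by (simp only: fps_sum_nth fps_X_power_mult_nth) (intro sum.cong, auto)
  also have "\<dots> = (\<Sum>i\<le>m. \<Sum>j | j \<le> m - i. (a' i * b' j) $ (m - (i + j)))"
    by (intro sum.cong refl sum.mono_neutral_cong_right) auto
  also have "\<dots> = (\<Sum>(i, j)\<in>(SIGMA i:{..m}. {j. j \<le> m - i}). (a' i * b' j) $ (m - (i + j)))"
    by (subst sum.Sigma) auto
  also have "\<dots> = (\<Sum>(n, i)\<in>(SIGMA n:{..m}. {..n}). (a' i * b' (n - i)) $ (m - n))"
    by (rule sum.reindex_bij_witness[of _ "\<lambda>(n, i). (i, n - i)" "\<lambda>(i, j). (i + j, i)"]) auto
  also have "\<dots> = (\<Sum>n\<le>m. \<Sum>i\<le>n. (a' i * b' (n - i)) $ (m - n))"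
    by (subst sum.Sigma) auto
  also have "\<dots> = fps_subst Z (a * b) $ m"
    by (simp add: fps_subst_def fps_mult_nth[of a b] fps_compose_sum_distrib a'_def b'_def
        fps_compose_mult_distrib[OF assms] fps_sum_nth atLeast0AtMost)
  finally show "fps_subst Z (a * b) $ m = (fps_subst Z a * fps_subst Z b) $ m" by simp
qed

lemma fps_subst_const [simp]:
  "fps_subst Z (fps_const a) = fps_compose a Z"
proof (rule fps_ext)
  fix m
  have "fps_subst Z (fps_const a) $ m = (\<Sum>n\<le>m. if n = 0 then fps_compose a Z $ m else 0)"
    unfolding fps_subst_def fps_nth_Abs_fps by (intro sum.cong) auto
  then show "fps_subst Z (fps_const a) $ m = fps_compose a Z $ m" by (simp add: sum.delta)
qed

lemma fps_subst_diff [simp]: "fps_subst Z (a - b) = fps_subst Z a - fps_subst Z b"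
  by (metis add_diff_cancel fps_subst_add diff_add_cancel)

lemma fps_subst_1 [simp]: "fps_subst Z 1 = 1"
  using fps_subst_const[of Z 1] by simp

lemma fps_subst_numeral [simp]: "fps_subst Z (numeral n) = numeral n"
  using fps_subst_const[of Z "numeral n"] by (simp add: numeral_fps_const)

lemma fps_subst_power [simp]:
  fixes a :: "'a::idom fps fps"
  assumes "Z $ 0 = 0"
  shows "fps_subst Z (a ^ n) = fps_subst Z a ^ n"
  by (induction n) (simp_all add: assms)

lemma fps_subst_X [simp]: "fps_subst Z fps_X = fps_X"
proof (rule fps_ext)
  fix m
  have "fps_subst Z fps_X $ m = (\<Sum>n\<le>m. if n = 1 then (1::'a fps) $ (m - n) else 0)"
    unfolding fps_subst_def fps_nth_Abs_fps by (intro sum.cong) auto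
  then show "fps_subst Z fps_X $ m = fps_X $ m"
    by (cases "m = 0") (auto simp: sum.delta)
qed

text \<open>A series in t regarded as constant in y. This differs from \<open>fps_const\<close>,
  which is constant in t.\<close>

definition fps_lift :: "'a::comm_ring_1 fps \<Rightarrow> 'a fps fps" where
  "fps_lift a = Abs_fps (\<lambda>n. fps_const (a $ n))"

lemma fps_subst_lift [simp]: "fps_subst Z (fps_lift a) = a"
proof (rule fps_ext)
  fix m
  have "fps_subst Z (fps_lift a) $ m = (\<Sum>n\<le>m. if n = m then a $ n else 0)"
    unfolding fps_subst_def fps_nth_Abs_fps fps_lift_def by (intro sum.cong) auto
  then show "fps_subst Z (fps_lift a) $ m = a $ m" by (simp add: sum.delta)
qed

section \<open>Fixed points of t-adic contractions\<close>

definition fps_agree :: "nat \<Rightarrow> 'a::comm_ring_1 fps \<Rightarrow> 'a fps \<Rightarrow> bool" where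
  "fps_agree n a b \<longleftrightarrow> (\<forall>i<n. a $ i = b $ i)"

lemma fps_agree_refl [simp]: "fps_agree n a a" 
  by (simp add: fps_agree_def)

lemma fps_agree_add: "fps_agree n a b \<Longrightarrow> fps_agree n c d \<Longrightarrow> fps_agree n (a + c) (b + d)"
  by (simp add: fps_agree_def)

lemma fps_agree_mult: "fps_agree n a b \<Longrightarrow> fps_agree n c d \<Longrightarrow> fps_agree n (a * c) (b * d)"
  by (simp add: fps_agree_def fps_mult_nth)

lemma fps_agree_power: "fps_agree n a b \<Longrightarrow> fps_agree n (a ^ k) (b ^ k)"
  by (induction k) (simp_all add: fps_agree_mult)

text \<open>The coefficient of \<open>t^i\<close> after substitution involves only coefficients up
  to i of powers of Z.\<close>

lemma fps_agree_subst:
  assumes "fps_agree n Z W"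
  shows "fps_agree n (fps_subst Z a) (fps_subst W a)"
proof -
  have "(Z ^ k) $ i = (W ^ k) $ i" if "i < n" for i k
    using fps_agree_power[OF assms] that by (simp add: fps_agree_def)
  then show ?thesis by (auto simp: fps_agree_def fps_subst_def fps_compose_nth)
qed

text \<open>The outer factor t makes each iteration gain one correct coefficient, a contraction in
  the t-adic metric.\<close>

lemma fps_fixpoint:
  assumes "\<And>n a b. fps_agree n a b \<Longrightarrow> fps_agree n (T a) (T b)"
  obtains W :: "'a::comm_ring_1 fps" where "W = 1 + fps_X * T W"
proof -
  define G where "G = (\<lambda>a. 1 + fps_X * T a)"
  have step: "fps_agree (Suc n) (G a) (G b)" if "fps_agree n a b" for n a b
    using assms[OF that] by (auto simp: G_def fps_agree_def)
  define I where "I = (\<lambda>k. (G ^^ k) 0)"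
  have I_Suc: "I (Suc k) = G (I k)" for k by (simp add: I_def)
  have agree: "fps_agree k (I k) (I (Suc k))" for k
  proof (induction k)
    case (Suc k)
    then show ?case using step[of k "I k" "I (Suc k)"] by (simp add: I_Suc)
  qed (simp add: fps_agree_def)
  have stable: "I (k + d) $ i = I k $ i" if "i < k" for k d i
  proof (induction d)
    case (Suc d)
    have "I (Suc (k + d)) $ i = I (k + d) $ i"
      using agree[of "k + d"] that unfolding fps_agree_def by (metis trans_less_add1)
    then show ?case using Suc by simp
  qed simp
  \<comment> \<open>The coefficient of \<open>t^n\<close> is final after \<open>Suc n\<close>
    iterations, so the limit is read off on the diagonal.\<close>
  define W where "W = Abs_fps (\<lambda>n. I (Suc n) $ n)"
  have W: "fps_agree k W (I k)" for k
  proof -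
    have "I (Suc i) $ i = I k $ i" if "i < k" for i
      using stable[of i "Suc i" "k - Suc i"] that by simp
    then show ?thesis by (simp add: fps_agree_def W_def)
  qed
  have "W $ i = G W $ i" for i
  proof -
    have "G W $ i = G (I i) $ i" using step[OF W[of i]] by (simp add: fps_agree_def)
    also have "\<dots> = W $ i" by (simp add: W_def I_Suc)
    finally show ?thesis by simp
  qed
  then have "W = G W" by (simp add: fps_eq_iff)
  then show ?thesis using that by (simp add: G_def)
qed

section \<open>Functional equations of weighted codes, in a common form for both families\<close>

section \<open>Generating functions of codes\<close>

context
  fixes D :: "nat set" and g :: "int fps fps"
begin

text \<open>The weight g of one unit of root degree stays abstract: it is \<open>1/(1-y)\<close> for
  general maps and \<open>y\<close> for precubic ones. The types nest as series in t over series in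
  y over series in u.\<close>

definition code_series :: "(code \<Rightarrow> int fps) \<Rightarrow> int fps fps fps" where
  "code_series a = Abs_fps (\<lambda>n. \<Sum>c\<in>codes D n. fps_const (a c) * g ^ root_deg c)"

definition loop_series :: "(code \<Rightarrow> code \<Rightarrow> int fps) \<Rightarrow> int fps fps fps" where
  "loop_series l = Abs_fps (\<lambda>n. \<Sum>i\<le>n. \<Sum>c1\<in>codes D i. \<Sum>c2\<in>codes D (n - i).
     fps_const (l c1 c2) * g ^ (root_deg c1 + root_deg c2))"

definition edge_series :: "(nat \<Rightarrow> code \<Rightarrow> int fps) \<Rightarrow> int fps fps fps" where
  "edge_series e = Abs_fps (\<lambda>n. \<Sum>c\<in>codes D n. \<Sum>k | k \<le> root_deg c \<and> Suc k \<in> D.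
     fps_const (e k c) * g ^ Suc (root_deg c - k))"

text \<open>The root edge supplies the factor t. A loop has both half-edges at the root vertex,
  hence \<open>g ^ 2\<close>; the single one of an \<open>Edge\<close> node is already inside
  \<open>edge_series\<close>.\<close>

lemma code_series_rec:
  "code_series a = fps_const (fps_const (a Point)) +
     fps_X * (fps_const (g ^ 2) * loop_series (\<lambda>c1 c2. a (Loop c1 c2)) +
              edge_series (\<lambda>k c. a (Edge k c)))"
proof (rule fps_ext)
  fix n
  show "code_series a $ n = (fps_const (fps_const (a Point)) +
     fps_X * (fps_const (g ^ 2) * loop_series (\<lambda>c1 c2. a (Loop c1 c2)) +
              edge_series (\<lambda>k c. a (Edge k c)))) $ n"
  proof (cases n)
    case 0
    then show ?thesis by (simp add: code_series_def codes_0)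
  next
    case (Suc m)
    have "code_series a $ Suc m =
        (\<Sum>i\<le>m. \<Sum>c1\<in>codes D i. \<Sum>c2\<in>codes D (m - i).
           g ^ 2 * (fps_const (a (Loop c1 c2)) * g ^ (root_deg c1 + root_deg c2))) +
        edge_series (\<lambda>k c. a (Edge k c)) $ m"
      by (simp add: code_series_def sum_codes_Suc edge_series_def power_add power2_eq_square mult_ac)
    also have "\<dots> = g ^ 2 * loop_series (\<lambda>c1 c2. a (Loop c1 c2)) $ m +
        edge_series (\<lambda>k c. a (Edge k c)) $ m"
      by (simp add: loop_series_def sum_distrib_left)
    finally show ?thesis using Suc by simp
  qed
qed

lemma loop_series_add:
  "loop_series (\<lambda>c1 c2. l c1 c2 + l' c1 c2) = loop_series l + loop_series l'"
  by (rule fps_ext) (simp add: loop_series_def sum.distrib distrib_right flip: fps_const_add)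

lemma edge_series_add:
  "edge_series (\<lambda>k c. e k c + e' k c) = edge_series e + edge_series e'"
  by (rule fps_ext) (simp add: edge_series_def sum.distrib distrib_right flip: fps_const_add)

text \<open>The two maps at a loop are independent, so a product weight gives a Cauchy product in
  t.\<close>

lemma loop_series_mult:
  "loop_series (\<lambda>c1 c2. f * (a c1 * b c2)) =
     fps_const (fps_const f) * code_series a * code_series b"
proof (rule fps_ext)
  fix n
  have "loop_series (\<lambda>c1 c2. f * (a c1 * b c2)) $ n =
    (\<Sum>i\<le>n. \<Sum>c1\<in>codes D i. \<Sum>c2\<in>codes D (n - i).
       fps_const f * ((fps_const (a c1) * g ^ root_deg c1) * (fps_const (b c2) * g ^ root_deg c2)))"
    by (simp add: loop_series_def power_add mult_ac flip: fps_const_mult)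
  also have "\<dots> = (\<Sum>i\<le>n. fps_const f * (code_series a $ i * code_series b $ (n - i)))"
    by (simp only: code_series_def fps_nth_Abs_fps sum_product) (simp only: sum_distrib_left)
  also have "\<dots> = (fps_const (fps_const f) * (code_series a * code_series b)) $ n"
    by (simp add: fps_mult_nth[of "code_series a"] sum_distrib_left atLeast0AtMost)
  finally show "loop_series (\<lambda>c1 c2. f * (a c1 * b c2)) $ n =
      (fps_const (fps_const f) * code_series a * code_series b) $ n"
    by (simp add: mult.assoc)
qed

end

text \<open>The series of a statistic \<open>w\<close>: \<open>t\<close> marks edges and \<open>u\<close> marks \<open>Loop\<close> nodes, i.e. faces but one.\<close>

definition code_wt :: "(code \<Rightarrow> int) \<Rightarrow> code \<Rightarrow> int fps" where
  "code_wt w c = fps_const (w c) * fps_X ^ nloops c"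

text \<open>Additive statistics: \<open>l\<close> is the contribution of a \<open>Loop\<close> node
  and \<open>e k\<close> that of an \<open>Edge k\<close> node. Additivity turns the recursion into
  a Leibniz rule.\<close>

definition marking :: "(code \<Rightarrow> int) \<Rightarrow> int \<Rightarrow> (nat \<Rightarrow> int) \<Rightarrow> bool" where
  "marking w l e \<longleftrightarrow> w Point = 0 \<and>
     (\<forall>c1 c2. w (Loop c1 c2) = l + w c1 + w c2) \<and> (\<forall>k c. w (Edge k c) = e k + w c)"

lemma fps_const_int: "fps_const k = (of_int k :: int fps)" for k :: int
  using fps_of_int[where 'a=int and c=k] by simp

lemma loop_series_one:
  "loop_series D g (\<lambda>c1 c2. code_wt (\<lambda>_. 1) (Loop c1 c2)) =
     fps_const (fps_const fps_X) * code_series D g (code_wt (\<lambda>_. 1)) ^ 2"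
proof -
  have "(\<lambda>c1 c2. code_wt (\<lambda>_. 1) (Loop c1 c2)) =
      (\<lambda>c1 c2. fps_X * (code_wt (\<lambda>_. 1) c1 * code_wt (\<lambda>_. 1) c2))"
    by (simp add: code_wt_def fun_eq_iff power_add mult_ac)
  then show ?thesis by (simp add: loop_series_mult power2_eq_square mult_ac)
qed

text \<open>Leibniz rule for the square: the mark is on the new loop node, which contributes
  \<open>l\<close>, or in one of the two submaps.\<close>

lemma loop_series_marking:
  assumes "marking w l e"
  shows "loop_series D g (\<lambda>c1 c2. code_wt w (Loop c1 c2)) = fps_const (fps_const fps_X) *
     (of_int l * code_series D g (code_wt (\<lambda>_. 1)) ^ 2 +
      2 * code_series D g (code_wt (\<lambda>_. 1)) * code_series D g (code_wt w))"
proof -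
  let ?o = "code_wt (\<lambda>_. 1)"
  have "(\<lambda>c1 c2. code_wt w (Loop c1 c2)) =
      (\<lambda>c1 c2. fps_X * fps_const l * (?o c1 * ?o c2) + fps_X * (code_wt w c1 * ?o c2) +
               fps_X * (?o c1 * code_wt w c2))"
    using assms by (simp add: marking_def code_wt_def fun_eq_iff power_add algebra_simps
        flip: fps_const_add)
  then show ?thesis
    by (simp only: loop_series_add loop_series_mult)
       (simp add: power2_eq_square algebra_simps fps_of_int fps_const_int flip: fps_const_mult)
qed

lemma edge_series_one:
  "edge_series D g (\<lambda>k c. code_wt (\<lambda>_. 1) (Edge k c)) = edge_series D g (\<lambda>k. code_wt (\<lambda>_. 1))"
  by (simp add: code_wt_def[abs_def])

lemma edge_series_marking:
  assumes "marking w l e"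
  shows "edge_series D g (\<lambda>k c. code_wt w (Edge k c)) =
     edge_series D g (\<lambda>k c. fps_const (e k) * code_wt (\<lambda>_. 1) c) + edge_series D g (\<lambda>k. code_wt w)"
proof -
  have "(\<lambda>k c. code_wt w (Edge k c)) = (\<lambda>k c. fps_const (e k) * code_wt (\<lambda>_. 1) c + code_wt w c)"
    using assms by (simp add: marking_def code_wt_def fun_eq_iff algebra_simps flip: fps_const_add)
  then show ?thesis by (simp add: edge_series_add)
qed

text \<open>
  General planar maps: \<open>y\<close> is related to the variable \<open>z\<close> marking the root degree by
  \<open>z = 1/(1-y)\<close>, and setting \<open>z = 1\<close> means setting \<open>y = 0\<close>.
\<close>

definition geo :: "int fps fps" where "geo = Abs_fps (\<lambda>_. 1)"

lemma geo: "(1 - fps_X) * geo = 1"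
  by (rule fps_ext) (auto simp: geo_def algebra_simps)

definition total_series :: "nat set \<Rightarrow> (code \<Rightarrow> int fps) \<Rightarrow> int fps fps" where
  "total_series D a = Abs_fps (\<lambda>n. \<Sum>c\<in>codes D n. a c)"

text \<open>With \<open>z = 1/(1-y)\<close> one has \<open>y z = z - 1\<close>, so multiplication by
  y telescopes the geometric sum. This is the reason for the variable y.\<close>

lemma geo_sum: "fps_X * (\<Sum>k\<le>d. geo ^ Suc (d - k)) = geo ^ Suc d - 1"
proof -
  have X: "fps_X * geo = geo - 1" using geo by (simp add: algebra_simps)
  have "(\<Sum>k\<le>d. geo ^ Suc (d - k)) = (\<Sum>k\<le>d. geo ^ Suc k)"
    by (rule sum.reindex_bij_witness[of _ "\<lambda>k. d - k" "\<lambda>k. d - k"]) auto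
  also have "fps_X * \<dots> = (\<Sum>k\<le>d. (geo - 1) * geo ^ k)"
    by (simp add: sum_distrib_left X flip: mult.assoc)
  also have "\<dots> = geo ^ Suc d - 1"
    by (induction d) (simp_all add: algebra_simps)
  finally show ?thesis .
qed

text \<open>Tutte's divided difference: for root degree d the sum over the degree split off is
  \<open>(z^(d+1) - 1)/y\<close>, and the subtracted terms add up to the value at
  \<open>z = 1\<close>, free of y.\<close>

lemma edge_series_all:
  "fps_const fps_X * edge_series UNIV geo (\<lambda>k. a) =
     fps_const geo * code_series UNIV geo a - fps_lift (total_series UNIV a)"
proof (rule fps_ext)
  fix n
  have "(fps_const fps_X * edge_series UNIV geo (\<lambda>k. a)) $ n =
      (\<Sum>c\<in>codes UNIV n. fps_const (a c) * (fps_X * (\<Sum>k\<le>root_deg c. geo ^ Suc (root_deg c - k))))"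
    by (simp add: edge_series_def sum_distrib_left atMost_def mult_ac)
  also have "\<dots> = (\<Sum>c\<in>codes UNIV n. geo * (fps_const (a c) * geo ^ root_deg c)) -
      (\<Sum>c\<in>codes UNIV n. fps_const (a c))"
    unfolding geo_sum by (simp add: algebra_simps sum_subtractf)
  also have "(\<Sum>c\<in>codes UNIV n. fps_const (a c)) = fps_const (\<Sum>c\<in>codes UNIV n. a c)"
    by (induction rule: infinite_finite_induct) (simp_all flip: fps_const_add)
  also have "(\<Sum>c\<in>codes UNIV n. geo * (fps_const (a c) * geo ^ root_deg c)) -
      fps_const (\<Sum>c\<in>codes UNIV n. a c) =
      (fps_const geo * code_series UNIV geo a - fps_lift (total_series UNIV a)) $ n"
    by (simp add: code_series_def total_series_def fps_lift_def sum_distrib_left)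
  finally show "(fps_const fps_X * edge_series UNIV geo (\<lambda>k. a)) $ n =
      (fps_const geo * code_series UNIV geo a - fps_lift (total_series UNIV a)) $ n" .
qed

text \<open>An \<open>Edge\<close> node makes a leaf exactly for \<open>k = 0\<close>, so the inner
  sum keeps one term and no divided difference arises.\<close>

lemma edge_series_leaf:
  assumes "1 \<in> D"
  shows "edge_series D g (\<lambda>k c. if k = 0 then a c else 0) = fps_const g * code_series D g a"
proof (rule fps_ext)
  fix n
  have "(\<Sum>k | k \<le> root_deg c \<and> Suc k \<in> D.
      fps_const (if k = 0 then a c else 0) * g ^ Suc (root_deg c - k)) =
      g * (fps_const (a c) * g ^ root_deg c)" for c
  proof -
    have "(\<Sum>k | k \<le> root_deg c \<and> Suc k \<in> D.
      fps_const (if k = 0 then a c else 0) * g ^ Suc (root_deg c - k)) =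
      (\<Sum>k\<in>{0}. fps_const (if k = 0 then a c else 0) * g ^ Suc (root_deg c - k))"
      using assms by (intro sum.mono_neutral_right) auto
    then show ?thesis by (simp add: mult_ac)
  qed
  then show "edge_series D g (\<lambda>k c. if k = 0 then a c else 0) $ n =
      (fps_const g * code_series D g a) $ n"
    by (simp add: edge_series_def code_series_def sum_distrib_left del: power_Suc)
qed

text \<open>Precubic maps: \<open>y\<close> marks the root degree.\<close>

definition root1_series :: "(code \<Rightarrow> int fps) \<Rightarrow> int fps fps" where
  "root1_series a = Abs_fps (\<lambda>n. \<Sum>c | c \<in> codes {1, 3} n \<and> root_deg c = 1. a c)"

lemma root_deg_eq_0: "root_deg c = 0 \<longleftrightarrow> c = Point"
  by (cases c) auto

lemma edge_series_precubic:
  "fps_const fps_X * edge_series {1, 3} fps_X (\<lambda>k. a) =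
     fps_const fps_X ^ 2 * code_series {1, 3} fps_X a + code_series {1, 3} fps_X a -
     fps_const (fps_const (a Point)) - fps_const fps_X * fps_lift (root1_series a)"
proof (rule fps_ext)
  fix n
  \<comment> \<open>Splitting off degree 1 gives \<open>y^(d+1)\<close>, and degree 3 gives
    \<open>y^(d-1)\<close> when \<open>d \<ge> 2\<close>. Times y this is
    \<open>y^(d+2) + y^d\<close>, corrected for the root degrees 0 and 1, which do not admit degree
    3.\<close>
  have inner: "fps_X * (\<Sum>k | k \<le> root_deg c \<and> Suc k \<in> {1, 3}. fps_const (a c) * fps_X ^ Suc (root_deg c - k)) =
      fps_X ^ 2 * (fps_const (a c) * fps_X ^ root_deg c) + fps_const (a c) * fps_X ^ root_deg c -
      (if c = Point then fps_const (a Point) else 0) -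
      (if root_deg c = 1 then fps_X * fps_const (a c) else 0)" for c
  proof -
    consider "root_deg c = 0" | "root_deg c = 1" | d where "root_deg c = Suc (Suc d)"
      by (metis One_nat_def not0_implies_Suc)
    then show ?thesis
    proof cases
      case 1
      then have c: "c = Point" by (simp add: root_deg_eq_0)
      have "{k. k \<le> root_deg c \<and> Suc k \<in> {1, 3}} = {0}" using 1 by auto
      then show ?thesis using c by (simp add: power2_eq_square mult_ac)
    next
      case 2
      then have c: "c \<noteq> Point" by auto
      have "{k. k \<le> root_deg c \<and> Suc k \<in> {1, 3}} = {0}" using 2 by auto
      then show ?thesis using c 2 by (simp add: power2_eq_square mult_ac)
    next
      case 3
      then have c: "c \<noteq> Point" by auto
      have "{k. k \<le> root_deg c \<and> Suc k \<in> {1, 3}} = {0, 2}" using 3 by auto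
      then show ?thesis using c 3 by (simp add: power2_eq_square algebra_simps)
    qed
  qed
  have "(fps_const fps_X * edge_series {1, 3} fps_X (\<lambda>k. a)) $ n =
      (\<Sum>c\<in>codes {1, 3} n. fps_X *
         (\<Sum>k | k \<le> root_deg c \<and> Suc k \<in> {1, 3}. fps_const (a c) * fps_X ^ Suc (root_deg c - k)))"
    by (simp add: edge_series_def sum_distrib_left)
  also have "\<dots> = (fps_const fps_X ^ 2 * code_series {1, 3} fps_X a + code_series {1, 3} fps_X a) $ n -
      (\<Sum>c\<in>codes {1, 3} n. if c = Point then fps_const (a Point) else 0) -
      (\<Sum>c\<in>codes {1, 3} n. if root_deg c = 1 then fps_X * fps_const (a c) else 0)"
    unfolding inner by (simp add: sum_subtractf sum.distrib code_series_def sum_distrib_left fps_const_power)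
  also have "(\<Sum>c\<in>codes {1, 3} n. if c = Point then fps_const (a Point) else 0) =
      fps_const (fps_const (a Point)) $ n"
  proof -
    have "Point \<in> codes {1, 3} n \<longleftrightarrow> n = 0" by (auto simp: codes_def)
    then show ?thesis by (simp add: sum.delta)
  qed
  also have "(\<Sum>c\<in>codes {1, 3} n. if root_deg c = 1 then fps_X * fps_const (a c) else 0) =
      fps_X * (\<Sum>c | c \<in> codes {1, 3} n \<and> root_deg c = 1. fps_const (a c))"
    by (auto simp: sum.inter_filter sum_distrib_left intro!: sum.cong)
  also have "(\<Sum>c | c \<in> codes {1, 3} n \<and> root_deg c = 1. fps_const (a c)) =
      fps_lift (root1_series a) $ n"
  proof -
    have "(\<Sum>c\<in>S. fps_const (a c)) = fps_const (\<Sum>c\<in>S. a c)" for S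
      by (induction S rule: infinite_finite_induct) (simp_all flip: fps_const_add)
    then show ?thesis by (simp add: root1_series_def fps_lift_def)
  qed
  finally show "(fps_const fps_X * edge_series {1, 3} fps_X (\<lambda>k. a)) $ n =
      (fps_const fps_X ^ 2 * code_series {1, 3} fps_X a + code_series {1, 3} fps_X a -
     fps_const (fps_const (a Point)) - fps_const fps_X * fps_lift (root1_series a)) $ n"
    by (simp del: fps_const_power)
qed

section \<open>The kernel method for both families\<close>

section \<open>Solving the equations\<close>

lemma total_series_add: "total_series D (\<lambda>c. a c + b c) = total_series D a + total_series D b"
  by (rule fps_ext) (simp add: total_series_def sum.distrib)

lemma code_wt_Point_marking: "marking w l e \<Longrightarrow> code_wt w Point = 0"
  by (simp add: marking_def code_wt_def)

lemma marking_nloops: "marking (\<lambda>c. int (nloops c)) 1 (\<lambda>_. 0)"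
  by (simp add: marking_def)

lemma marking_nverts: "marking (\<lambda>c. int (nverts P c)) 0 (\<lambda>k. if P (Suc k) then 1 else 0)"
  by (simp add: marking_def)

lemma marking_nedges: "marking (\<lambda>c. int (nedges c)) 1 (\<lambda>_. 1)"
  by (simp add: marking_def)

text \<open>The kernel method: the substituted series annihilates the coefficient of every derivative.\<close>

lemma exists_kernel_general:
  fixes P :: "int fps fps fps"
  obtains Y where "Y $ 0 = 0"
    and "Y * (1 - Y) = fps_X + 2 * fps_X * fps_const fps_X * Y * fps_subst Y P"
proof -
  \<comment> \<open>Writing \<open>Y = t W\<close> and dividing the equation by t leaves a
    fixed-point equation for W, with a factor t still in front of \<open>T W\<close>.\<close>
  define T where "T = (\<lambda>W. W * W + 2 * fps_const fps_X * W * fps_subst (fps_X * W) P)"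
  have "fps_agree n (T a) (T b)" if "fps_agree n a b" for n a b
    unfolding T_def using that
    by (intro fps_agree_add fps_agree_mult fps_agree_subst fps_agree_refl)
  then obtain W where W: "W = 1 + fps_X * T W" using fps_fixpoint[of T] by blast
  have "fps_X * W = fps_X * (1 + fps_X * T W)" using W by (rule arg_cong)
  then have "fps_X * W * (1 - fps_X * W) =
      fps_X + 2 * fps_X * fps_const fps_X * (fps_X * W) * fps_subst (fps_X * W) P"
    unfolding T_def by (simp add: algebra_simps)
  then show ?thesis using that[of "fps_X * W"] by simp
qed

text \<open>The equation says that the coefficient \<open>y - t - t y^2 - 2 t u y^3 H\<close> of the
  marked series vanishes at Z. That Z is nonzero is recorded because a factor Z is cancelled
  later.\<close>

lemma exists_kernel_precubic:
  fixes H :: "int fps fps fps"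
  obtains Z where "Z $ 0 = 0" "Z \<noteq> 0"
    and "Z = fps_X + fps_X * Z ^ 2 + 2 * fps_X * fps_const fps_X * Z ^ 3 * fps_subst Z H"
proof -
  define T where "T = (\<lambda>W. fps_X * (W * W) +
    2 * fps_X * fps_X * fps_const fps_X * (W ^ 3) * fps_subst (fps_X * W) H)"
  have "fps_agree n (T a) (T b)" if "fps_agree n a b" for n a b
    unfolding T_def using that
    by (intro fps_agree_add fps_agree_mult fps_agree_subst fps_agree_power fps_agree_refl)
  then obtain W where W: "W = 1 + fps_X * T W" using fps_fixpoint[of T] by blast
  have "W $ 0 = 1" by (subst W) simp
  then have nz: "fps_X * W \<noteq> 0" by auto
  have "fps_X * W = fps_X * (1 + fps_X * T W)" using W by (rule arg_cong)
  then have "fps_X * W = fps_X + fps_X * (fps_X * W) ^ 2 +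
      2 * fps_X * fps_const fps_X * (fps_X * W) ^ 3 * fps_subst (fps_X * W) H"
    unfolding T_def by (simp add: algebra_simps power2_eq_square power3_eq_cube)
  then show ?thesis using that[of "fps_X * W"] nz by simp
qed

lemma fps_subst_0 [simp]: "fps_subst Z 0 = 0"
  using fps_subst_const[of Z 0] by simp

text \<open>Multiplying Tutte's equation by y clears the denominator of the edge series. Over an
  arbitrary commutative ring the series are opaque atoms.\<close>

lemma scale_precubic:
  fixes h :: "'a::comm_ring_1"
  assumes "h = t * (y ^ 2 * (u * a) + (b + c))"
  shows "y * h = t * (y ^ 3 * u * a + y * b + y * c)"
  unfolding assms by (simp add: algebra_simps power2_eq_square power3_eq_cube)

lemma scale_marked:
  fixes h :: "'a::comm_ring_1"
  assumes "h = t * (a + (b + c))"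
  shows "y * h = t * (y * a + y * b + y * c)"
  unfolding assms by (simp add: algebra_simps)

lemma scale_base:
  fixes h :: "'a::comm_ring_1"
  assumes "h = 1 + t * (a + c)"
  shows "y * h = y + t * (y * a + y * c)"
  unfolding assms by (simp add: algebra_simps)

abbreviation "wt1 \<equiv> code_wt (\<lambda>_. 1)"

text \<open>At Z the marked catalytic series drops out, and \<open>Z F\<close> equals
  \<open>l u Z^3 h^2\<close> plus the contribution of marked \<open>Edge\<close> nodes. Discoveries
  have \<open>l = 1\<close> and no such contribution; leaves have \<open>l = 0\<close> and the
  contribution \<open>Z^2 h\<close>.\<close>

theorem series_precubic:
  defines "F \<equiv> \<lambda>w. root1_series (code_wt w)"
  shows "F (\<lambda>c. int (nloops c)) =
    fps_const fps_X * F (\<lambda>c. int (nverts (\<lambda>k. k = 1) c)) ^ 2"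
proof -
  let ?D = "{1, 3} :: nat set"
  define H where "H = (\<lambda>w. code_series ?D fps_X (code_wt w))"
  let ?H = "H (\<lambda>_. 1)"
  let ?y = "fps_const fps_X :: int fps fps fps"
  let ?U = "fps_const (fps_const fps_X) :: int fps fps fps"
  let ?t = "fps_X :: int fps fps fps"
  obtain Z where Z0: "Z $ 0 = 0" "Z \<noteq> 0"
    and Z: "Z = fps_X + fps_X * Z ^ 2 + 2 * fps_X * fps_const fps_X * Z ^ 3 * fps_subst Z ?H"
    using exists_kernel_precubic .
  let ?h = "fps_subst Z ?H"
  have marked: "?y * H w = ?t * (?y ^ 3 * ?U * (of_int l * ?H ^ 2 + 2 * ?H * H w) +
      ?y * edge_series ?D fps_X (\<lambda>k c. fps_const (e k) * wt1 c) +
      ?y ^ 2 * H w + H w - ?y * fps_lift (F w))"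
    if w: "marking w l e" for w l e
  proof -
    have "H w = ?t * (?y ^ 2 * (?U * (of_int l * ?H ^ 2 + 2 * ?H * H w)) +
        (edge_series ?D fps_X (\<lambda>k c. fps_const (e k) * wt1 c) +
         edge_series ?D fps_X (\<lambda>k. code_wt w)))"
      unfolding H_def
      by (subst code_series_rec)
         (simp only: loop_series_marking[OF w] edge_series_marking[OF w] code_wt_Point_marking[OF w]
          fps_const_0_eq_0 add_0 flip: fps_const_power)
    then have "?y * H w = ?t * (?y ^ 3 * ?U * (of_int l * ?H ^ 2 + 2 * ?H * H w) +
        ?y * edge_series ?D fps_X (\<lambda>k c. fps_const (e k) * wt1 c) +
        ?y * edge_series ?D fps_X (\<lambda>k. code_wt w))"
      by (rule scale_precubic)
    then show ?thesis
      unfolding edge_series_precubic code_wt_Point_marking[OF w] F_def H_def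
      by (simp add: add_diff_eq add.assoc del: fps_const_power)
  qed
  have subst: "fps_X * fps_subst Z (?y * edge_series ?D fps_X (\<lambda>k c. fps_const (e k) * wt1 c)) =
      fps_X * Z * F w - of_int l * fps_X * fps_const fps_X * Z ^ 3 * ?h ^ 2"
    if w: "marking w l e" for w l e
  proof -
    have li: "fps_subst Z (of_int l) = of_int l"
      by (metis fps_of_int fps_const_compose fps_subst_const)
    have "fps_subst Z (?y * H w) = fps_subst Z (?t * (?y ^ 3 * ?U * (of_int l * ?H ^ 2 + 2 * ?H * H w) +
      ?y * edge_series ?D fps_X (\<lambda>k c. fps_const (e k) * wt1 c) +
      ?y ^ 2 * H w + H w - ?y * fps_lift (F w)))"
      by (rule arg_cong[OF marked[OF w]])
    then have "Z * fps_subst Z (H w) = fps_X * (Z ^ 3 * fps_const fps_X *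
          (of_int l * ?h ^ 2 + 2 * ?h * fps_subst Z (H w)) +
        fps_subst Z (?y * edge_series ?D fps_X (\<lambda>k c. fps_const (e k) * wt1 c)) +
        Z ^ 2 * fps_subst Z (H w) + fps_subst Z (H w) - Z * F w)"
      by (simp add: Z0 li del: fps_const_power)
    \<comment> \<open>The terms in the marked series are collected in front of the kernel, which
      vanishes by the choice of Z.\<close>
    then have "fps_X * fps_subst Z (?y * edge_series ?D fps_X (\<lambda>k c. fps_const (e k) * wt1 c)) =
      fps_X * Z * F w - of_int l * fps_X * fps_const fps_X * Z ^ 3 * ?h ^ 2 +
      fps_subst Z (H w) * (Z - (fps_X + fps_X * Z ^ 2 + 2 * fps_X * fps_const fps_X * Z ^ 3 * ?h))"
      by (simp add: algebra_simps)
    also have "Z - (fps_X + fps_X * Z ^ 2 + 2 * fps_X * fps_const fps_X * Z ^ 3 * ?h) = 0"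
      using Z by simp
    finally show ?thesis by simp
  qed
  have X0: "fps_X \<noteq> (0 :: int fps fps)" by simp
  have "F (\<lambda>c. int (nloops c)) = fps_const fps_X * Z ^ 2 * ?h ^ 2"
  proof -
    have "edge_series ?D fps_X (\<lambda>k c. fps_const 0 * wt1 c) = 0"
      by (rule fps_ext) (simp add: edge_series_def)
    then have "fps_X * Z * F (\<lambda>c. int (nloops c)) = fps_X * Z * (fps_const fps_X * Z ^ 2 * ?h ^ 2)"
      using subst[OF marking_nloops] by (auto simp: algebra_simps power2_eq_square power3_eq_cube)
    then show ?thesis using X0 Z0 by simp
  qed
  moreover have "F (\<lambda>c. int (nverts (\<lambda>k. k = 1) c)) = Z * ?h"
  proof -
    have "(\<lambda>k c. fps_const (if Suc k = 1 then 1 else 0) * wt1 c) = (\<lambda>k c. if k = 0 then wt1 c else 0)"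
      by (auto simp: fun_eq_iff)
    then have "edge_series ?D fps_X (\<lambda>k c. fps_const (if Suc k = 1 then 1 else 0) * wt1 c) = ?y * ?H"
      by (simp only: edge_series_leaf[of ?D] H_def insert_iff simp_thms)
    then have "fps_X * Z * F (\<lambda>c. int (nverts (\<lambda>k. k = 1) c)) = fps_X * Z * (Z * ?h)"
      using subst[OF marking_nverts[of "\<lambda>k. k = 1"]]
      by (auto simp: Z0 algebra_simps)
    then show ?thesis using X0 Z0 by simp
  qed
  ultimately show ?thesis by (simp add: power_mult_distrib mult.assoc)
qed

text \<open>The first identity is immediate once the three marked series are known. The second
  expresses that deleting a marked leaf with its edge leaves a marked corner, of which there are
  \<open>2n+1\<close>; it is derived here algebraically.\<close>

theorem series_general:
  defines "M \<equiv> \<lambda>w. total_series UNIV (code_wt w)"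
  shows "M (\<lambda>c. int (nloops c)) = fps_const fps_X * M (\<lambda>c. 1 + int (nverts (\<lambda>_. True) c)) *
           M (\<lambda>c. int (nverts (\<lambda>k. k = 1) c))"
    and "M (\<lambda>c. int (nverts (\<lambda>k. k = 1) c)) = fps_X * M (\<lambda>c. 2 * int (nedges c) + 1)"
proof -
  let ?D = "UNIV :: nat set"
  define H where "H = (\<lambda>w. code_series ?D geo (code_wt w))"
  \<comment> \<open>One more factor z makes P the series in the numerator of the divided difference,
    and its equation is polynomial in y.\<close>
  define P where "P = (\<lambda>w. fps_const geo * H w)"
  let ?P = "P (\<lambda>_. 1)"
  let ?M = "M (\<lambda>_. 1)"
  let ?y = "fps_const fps_X :: int fps fps fps"
  let ?U = "fps_const (fps_const fps_X) :: int fps fps fps"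
  let ?t = "fps_X :: int fps fps fps"
  obtain Y where Y0: "Y $ 0 = 0"
    and Y: "Y * (1 - Y) = fps_X + 2 * fps_X * fps_const fps_X * Y * fps_subst Y ?P"
    using exists_kernel_general .
  let ?p = "fps_subst Y ?P"
  have HP: "H w = (1 - ?y) * P w" for w
  proof -
    have "(1 - ?y) * fps_const geo = 1"
      using arg_cong[OF geo, of fps_const] by (simp flip: fps_const_mult fps_const_sub)
    then show ?thesis by (simp add: P_def flip: mult.assoc)
  qed
  have gP: "fps_const (geo ^ 2) * (?U * H v * H w) = ?U * P v * P w" for v w
    by (simp add: P_def power2_eq_square mult_ac flip: fps_const_mult)
  \<comment> \<open>The unmarked equation serves the second claim, through its y-derivative and
    through its value at Y.\<close>
  have base: "?y * (1 - ?y) * ?P = ?y + ?t * (?y * ?U * ?P ^ 2 + ?P - fps_lift ?M)"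
  proof -
    have "H (\<lambda>_. 1) = 1 + ?t * (fps_const (geo ^ 2) * (?U * H (\<lambda>_. 1) * H (\<lambda>_. 1)) + edge_series ?D geo
        (\<lambda>k. wt1))"
      unfolding H_def
      by (subst code_series_rec) (simp add: loop_series_one edge_series_one code_wt_def[of _ Point]
          power2_eq_square mult.assoc)
    then have "?y * H (\<lambda>_. 1) = ?y + ?t * (?y * (?U * ?P * ?P) + ?y * edge_series ?D geo (\<lambda>k. wt1))"
      unfolding gP by (rule scale_base)
    then show ?thesis
      unfolding HP edge_series_all
      by (simp add: P_def H_def M_def power2_eq_square add_diff_eq mult.assoc)
  qed
  have marked: "?y * (1 - ?y) * P w = ?t * (?y * ?U * (of_int l * ?P ^ 2 + 2 * ?P * P w) +
      ?y * edge_series ?D geo (\<lambda>k c. fps_const (e k) * wt1 c) + P w - fps_lift (M w))"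
    if w: "marking w l e" for w l e
  proof -
    have "H w = ?t * (fps_const (geo ^ 2) * (?U * (of_int l * H (\<lambda>_. 1) ^ 2 + 2 * H (\<lambda>_. 1) * H w)) +
        (edge_series ?D geo (\<lambda>k c. fps_const (e k) * wt1 c) + edge_series ?D geo (\<lambda>k. code_wt w)))"
      unfolding H_def
      by (subst code_series_rec)
         (simp only: loop_series_marking[OF w] edge_series_marking[OF w] code_wt_Point_marking[OF w]
          fps_const_0_eq_0 add_0)
    also have "fps_const (geo ^ 2) * (?U * (of_int l * H (\<lambda>_. 1) ^ 2 + 2 * H (\<lambda>_. 1) * H w)) =
        of_int l * (fps_const (geo ^ 2) * (?U * H (\<lambda>_. 1) * H (\<lambda>_. 1))) +
        2 * (fps_const (geo ^ 2) * (?U * H (\<lambda>_. 1) * H w))"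
      by (simp add: power2_eq_square algebra_simps)
    also have "\<dots> = ?U * (of_int l * ?P ^ 2 + 2 * ?P * P w)"
      unfolding gP by (simp add: power2_eq_square algebra_simps)
    finally have "?y * H w = ?t * (?y * (?U * (of_int l * ?P ^ 2 + 2 * ?P * P w)) +
        ?y * edge_series ?D geo (\<lambda>k c. fps_const (e k) * wt1 c) +
        ?y * edge_series ?D geo (\<lambda>k. code_wt w))"
      by (rule scale_marked)
    then show ?thesis
      unfolding HP edge_series_all
      by (simp add: P_def H_def M_def add_diff_eq mult.assoc)
  qed
  have X0: "fps_X \<noteq> (0 :: int fps fps)" by simp
  \<comment> \<open>The coefficient of \<open>P w\<close> is again the kernel, so the unknown
    \<open>P w\<close> disappears after substitution.\<close>
  have M_eq: "M w = of_int l * fps_const fps_X * Y * ?p ^ 2 +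
      fps_subst Y (?y * edge_series ?D geo (\<lambda>k c. fps_const (e k) * wt1 c))"
    if w: "marking w l e" for w l e
  proof -
    have li: "fps_subst Y (of_int l) = of_int l"
      by (metis fps_of_int fps_const_compose fps_subst_const)
    let ?e = "fps_subst Y (?y * edge_series ?D geo (\<lambda>k c. fps_const (e k) * wt1 c))"
    have "fps_subst Y (?y * (1 - ?y) * P w) = fps_subst Y (?t * (?y * ?U * (of_int l * ?P ^ 2 + 2 * ?P * P w) +
      ?y * edge_series ?D geo (\<lambda>k c. fps_const (e k) * wt1 c) + P w - fps_lift (M w)))"
      by (rule arg_cong[OF marked[OF w]])
    then have "Y * (1 - Y) * fps_subst Y (P w) = fps_X * (Y * fps_const fps_X *
          (of_int l * ?p ^ 2 + 2 * ?p * fps_subst Y (P w)) + ?e + fps_subst Y (P w) - M w)"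
      by (simp add: Y0 li del: fps_const_mult fps_const_power)
    then have "fps_X * M w = fps_X * (of_int l * fps_const fps_X * Y * ?p ^ 2 + ?e)"
      unfolding Y by (simp add: algebra_simps)
    then show ?thesis using X0 by (metis mult_left_cancel)
  qed
  have E0: "edge_series ?D geo (\<lambda>k c. fps_const 0 * wt1 c) = 0"
    by (rule fps_ext) (simp add: edge_series_def)
  \<comment> \<open>When every \<open>Edge\<close> node counts once, the divided difference is that
    of the unmarked series.\<close>
  have E1: "fps_subst Y (?y * edge_series ?D geo (\<lambda>k c. fps_const 1 * wt1 c)) = ?p - ?M"
    by (simp only: fps_const_1_eq_1 mult_1 edge_series_all) (simp add: P_def H_def M_def)
  have Md: "M (\<lambda>c. int (nloops c)) = fps_const fps_X * Y * ?p ^ 2"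
    using M_eq[OF marking_nloops] E0 by simp
  have Mv: "M (\<lambda>c. int (nverts (\<lambda>_. True) c)) = ?p - ?M"
    using M_eq[OF marking_nverts[of "\<lambda>_. True"]] E1 by simp
  have Me: "M (\<lambda>c. int (nedges c)) = fps_const fps_X * Y * ?p ^ 2 + ?p - ?M"
    using M_eq[OF marking_nedges] E1 by simp
  have Ml: "M (\<lambda>c. int (nverts (\<lambda>k. k = 1) c)) = Y * ?p"
  proof -
    have "(\<lambda>k c. fps_const (if Suc k = 1 then 1 else 0) * wt1 c) = (\<lambda>k c. if k = 0 then wt1 c else 0)"
      by (auto simp: fun_eq_iff)
    then have "edge_series ?D geo (\<lambda>k c. fps_const (if Suc k = 1 then 1 else 0) * wt1 c) = ?P"
      by (simp only: edge_series_leaf[of ?D] P_def H_def UNIV_I)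
    then show ?thesis
      using M_eq[OF marking_nverts[of "\<lambda>k. k = 1"]] by (simp add: Y0 del: fps_const_mult fps_const_power)
  qed
  have M_add: "M (\<lambda>c. v c + w c) = M v + M w" for v w
    unfolding M_def by (simp add: code_wt_def[abs_def] distrib_right flip: total_series_add fps_const_add)
  \<comment> \<open>The 1 stands for the root vertex, which no \<open>Edge\<close> node
    creates.\<close>
  have "M (\<lambda>c. 1 + int (nverts (\<lambda>_. True) c)) = ?p"
    unfolding M_add Mv by simp
  then show "M (\<lambda>c. int (nloops c)) = fps_const fps_X * M (\<lambda>c. 1 + int (nverts (\<lambda>_. True) c)) *
           M (\<lambda>c. int (nverts (\<lambda>k. k = 1) c))"
    unfolding Md Ml by (simp add: power2_eq_square mult_ac)
  \<comment> \<open>The derivative in \<open>y\<close> is what expresses \<open>Y * p\<close> by the number of corners.\<close>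
  have deriv: "(1 - 2 * Y) * ?p = 1 + fps_X * fps_const fps_X * ?p ^ 2"
  proof -
    \<comment> \<open>The y-derivative, taken coefficientwise in t. The derivative of P drops out at
      Y because its coefficient is the kernel.\<close>
    define d where "d = (\<lambda>a :: int fps fps fps. Abs_fps (\<lambda>n. fps_deriv (a $ n)))"
    have d_add: "d (a + b) = d a + d b" for a b by (rule fps_ext) (simp add: d_def)
    have d_diff: "d (a - b) = d a - d b" for a b by (rule fps_ext) (simp add: d_def)
    have d_sum: "fps_deriv (sum f A) = (\<Sum>x\<in>A. fps_deriv (f x))" for f :: "nat \<Rightarrow> int fps fps" and A
      by (induction A rule: infinite_finite_induct) simp_all
    have d_mult: "d (a * b) = a * d b + d a * b" for a b
      by (rule fps_ext) (simp add: d_def fps_mult_nth d_sum sum.distrib)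
    have d_const: "d (fps_const a) = fps_const (fps_deriv a)" for a
      by (rule fps_ext) (simp add: d_def)
    have d_X: "d ?t = 0" by (rule fps_ext) (simp add: d_def)
    have d_lift: "d (fps_lift a) = 0" for a by (rule fps_ext) (simp add: d_def fps_lift_def)
    have d_1: "d 1 = 0" using d_const[of 1] by simp
    have "d (?y * (1 - ?y) * ?P) = d (?y + ?t * (?y * ?U * ?P ^ 2 + ?P - fps_lift ?M))"
      using base by (rule arg_cong)
    then have "(1 - 2 * ?y) * ?P + ?y * (1 - ?y) * d ?P =
        1 + ?t * (?U * ?P ^ 2 + ?y * ?U * (2 * ?P * d ?P) + d ?P)"
      by (simp add: d_add d_diff d_mult d_const d_X d_lift d_1 power2_eq_square algebra_simps
          del: fps_const_mult fps_const_power)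
    then have "fps_subst Y ((1 - 2 * ?y) * ?P + ?y * (1 - ?y) * d ?P) =
        fps_subst Y (1 + ?t * (?U * ?P ^ 2 + ?y * ?U * (2 * ?P * d ?P) + d ?P))"
      by (rule arg_cong)
    then have "(1 - 2 * Y) * ?p + Y * (1 - Y) * fps_subst Y (d ?P) =
        1 + fps_X * (fps_const fps_X * ?p ^ 2 + Y * fps_const fps_X * (2 * ?p * fps_subst Y (d ?P)) +
            fps_subst Y (d ?P))"
      by (simp add: Y0 del: fps_const_mult fps_const_power)
    then show ?thesis unfolding Y by (simp add: algebra_simps)
  qed
  have "fps_subst Y (?y * (1 - ?y) * ?P) = fps_subst Y (?y + ?t * (?y * ?U * ?P ^ 2 + ?P - fps_lift ?M))"
    using base by (rule arg_cong)
  then have base': "Y * (1 - Y) * ?p = Y + fps_X * (Y * fps_const fps_X * ?p ^ 2 + ?p - ?M)"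
    by (simp add: Y0 del: fps_const_mult fps_const_power)
  have "Y * ((1 - 2 * Y) * ?p) = Y * (1 + fps_X * fps_const fps_X * ?p ^ 2)"
    using deriv by (rule arg_cong)
  moreover have "Y ^ 2 * ?p = Y * (1 - Y) * ?p - Y * ((1 - 2 * Y) * ?p)"
    by (simp add: algebra_simps power2_eq_square)
  ultimately have "Y ^ 2 * ?p = Y + fps_X * (Y * fps_const fps_X * ?p ^ 2 + ?p - ?M) -
      Y * (1 + fps_X * fps_const fps_X * ?p ^ 2)"
    using base' by simp
  \<comment> \<open>Subtracting Y times \<open>deriv\<close> from the equation at Y leaves only this
    relation between p and M.\<close>
  then have E: "Y ^ 2 * ?p = fps_X * (?p - ?M)"
    by (simp add: algebra_simps)
  have "Y * ?p = Y * (1 - Y) * ?p + Y ^ 2 * ?p"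
    by (simp add: algebra_simps power2_eq_square)
  \<comment> \<open>The kernel equation and \<open>E\<close> exhibit \<open>Y p\<close> as a
    multiple of t, whose cofactor is twice the edge series plus the series of maps, i.e. the number
    of corners.\<close>
  then have "Y * ?p = (fps_X + 2 * fps_X * fps_const fps_X * Y * ?p) * ?p + fps_X * (?p - ?M)"
    unfolding E Y .
  then have "Y * ?p = fps_X * (2 * (fps_const fps_X * Y * ?p ^ 2 + ?p - ?M) + ?M)"
    by (simp add: algebra_simps power2_eq_square)
  also have "2 * (fps_const fps_X * Y * ?p ^ 2 + ?p - ?M) + ?M =
      M (\<lambda>c. int (nedges c)) + M (\<lambda>c. int (nedges c)) + ?M"
    using Me by simp
  also have "\<dots> = M (\<lambda>c. 2 * int (nedges c) + 1)"
    by (simp add: flip: M_add)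
  finally show "M (\<lambda>c. int (nverts (\<lambda>k. k = 1) c)) = fps_X * M (\<lambda>c. 2 * int (nedges c) + 1)"
    unfolding Ml .
qed

section \<open>Cycles of a permutation composed with a transposition\<close>

section \<open>Orbits of permutations\<close>

lemma orbit_self:
  assumes "f permutes A" "finite A"
  shows "x \<in> orbit f x"
  using assms by (intro permutation_self_in_orbit) (auto simp: permutation_permutes)

lemma orbit_subset_closed:
  assumes "x \<in> S" "\<And>y. y \<in> S \<Longrightarrow> f y \<in> S"
  shows "orbit f x \<subseteq> S"
proof
  fix y assume "y \<in> orbit f x"
  then show "y \<in> S" by induction (use assms in auto)
qed

lemma orbit_sub:
  assumes "y \<in> orbit f x"
  shows "orbit f y \<subseteq> orbit f x"
  using assms orbit_trans by fast

lemma orbit_eq: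
  assumes "f permutes A" "finite A" "y \<in> orbit f x"
  shows "orbit f y = orbit f x"
  by (meson assms orbit_self orbit_sub orbit_swap subset_antisym)

lemma orbit_disjoint:
  assumes "f permutes A" "finite A" "orbit f x \<noteq> orbit f y"
  shows "orbit f x \<inter> orbit f y = {}"
  using assms orbit_eq[OF assms(1,2)] by blast

lemma orbit_in:
  assumes "f permutes A" "x \<in> A"
  shows "orbit f x \<subseteq> A"
  using assms by (rule permutes_orbit_subset)

lemma permutes_comp_transpose:
  assumes "f permutes A" "a \<in> A" "b \<in> A"
  shows "(f \<circ> transpose a b) permutes A"
  using assms by (intro permutes_compose permutes_swap_id)

text \<open>The transposition exchanges the successors of a and b, which splices two different
  cycles into one.\<close>

lemma orbit_comp_transpose_merge:
  assumes f: "f permutes A" "finite A" and a: "a \<in> A" and b: "b \<in> A"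
    and ab: "b \<notin> orbit f a"
  defines "g \<equiv> f \<circ> transpose a b"
  shows "orbit g a = orbit f a \<union> orbit f b" "orbit g b = orbit f a \<union> orbit f b"
    and "\<And>x. x \<notin> orbit f a \<Longrightarrow> x \<notin> orbit f b \<Longrightarrow> orbit g x = orbit f x"
proof -
  have g: "g permutes A" unfolding g_def using f(1) a b by (rule permutes_comp_transpose)
  have ba: "a \<notin> orbit f b" using ab orbit_eq[OF f] orbit_self[OF f] by blast
  have "a \<noteq> b" using ab orbit_self[OF f] by blast
  have gv: "g a = f b" "g b = f a" "\<And>x. x \<noteq> a \<Longrightarrow> x \<noteq> b \<Longrightarrow> g x = f x"
    by (auto simp: g_def)
  \<comment> \<open>The cycle of b is followed from \<open>g a = f b\<close>. It avoids a, so f and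
    g differ on it only at b, whose f-successor is the starting point.\<close>
  have 1: "orbit f b \<subseteq> orbit g a"
  proof
    fix y assume "y \<in> orbit f b"
    then show "y \<in> orbit g a"
    proof induction
      case base then show ?case using orbit.base[of g a] gv by simp
    next
      case (step y)
      then have "y \<noteq> a" using ba by blast
      then show ?case using orbit.step[OF step.IH] orbit.base[of g a] gv by (cases "y = b") simp_all
    qed
  qed
  have 2: "orbit f a \<subseteq> orbit g b"
  proof
    fix y assume "y \<in> orbit f a"
    then show "y \<in> orbit g b"
    proof induction
      case base then show ?case using orbit.base[of g b] gv by simp
    next
      case (step y)
      then have "y \<noteq> b" using ab by blast
      then show ?case using orbit.step[OF step.IH] orbit.base[of g b] gv by (cases "y = a") simp_all
    qed
  qed
  have "b \<in> orbit g a" using 1 orbit_self[OF f] by blast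
  then have 3: "orbit g b = orbit g a" by (rule orbit_eq[OF g f(2)])
  have "orbit g a \<subseteq> orbit f a \<union> orbit f b"
  proof (rule orbit_subset_closed)
    show "a \<in> orbit f a \<union> orbit f b" using orbit_self[OF f] by blast
    show "g y \<in> orbit f a \<union> orbit f b" if "y \<in> orbit f a \<union> orbit f b" for y
      using that orbit.base[of f a] orbit.base[of f b] gv
      by (cases "y = a"; cases "y = b") (auto intro: orbit.step)
  qed
  then show "orbit g a = orbit f a \<union> orbit f b" "orbit g b = orbit f a \<union> orbit f b"
    using 1 2 3 by auto
  show "orbit g x = orbit f x" if x: "x \<notin> orbit f a" "x \<notin> orbit f b" for x
  proof -
    have "a \<notin> orbit f x" "b \<notin> orbit f x"
      using x orbit_eq[OF f] orbit_self[OF f] by blast+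
    then have "\<forall>y\<in>orbit f x. f y = g y" using gv by metis
    then show ?thesis
      using orbit_cong0[of x "orbit f x" f g] orbit_self[OF f, of x] orbit.step[of _ f x]
      by (auto simp: Pi_iff)
  qed
qed

text \<open>Following f from b until the first visit to a yields an arc invariant under g. The rest
  is the merging case for g, the transposition being an involution.\<close>

lemma orbit_comp_transpose_split:
  assumes f: "f permutes A" "finite A" and a: "a \<in> A" and b: "b \<in> A"
    and ab: "b \<in> orbit f a" "a \<noteq> b"
  defines "g \<equiv> f \<circ> transpose a b"
  shows "b \<notin> orbit g a" "orbit f a = orbit g a \<union> orbit g b"
    and "\<And>x. x \<notin> orbit f a \<Longrightarrow> orbit g x = orbit f x"
proof -
  have g: "g permutes A" unfolding g_def using f(1) a b by (rule permutes_comp_transpose)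
  have gv: "g a = f b" "g b = f a" "\<And>x. x \<noteq> a \<Longrightarrow> x \<noteq> b \<Longrightarrow> g x = f x"
    by (auto simp: g_def)
  have "a \<in> orbit f b" using ab orbit_eq[OF f] orbit_self[OF f] by blast
  then have ex: "\<exists>m. 0 < m \<and> (f ^^ m) b = a" by (auto simp: orbit_altdef)
  define m where "m = (LEAST m. 0 < m \<and> (f ^^ m) b = a)"
  have m: "0 < m" "(f ^^ m) b = a" using LeastI_ex[OF ex] by (simp_all add: m_def)
  have least: "m \<le> i" if "0 < i" "(f ^^ i) b = a" for i
    unfolding m_def using that by (intro Least_le) auto
  \<comment> \<open>The arc starts one step after b; minimality of m keeps it from returning to
    b.\<close>
  define S where "S = (\<lambda>i. (f ^^ i) b) ` {1..m}"
  have bS: "b \<notin> S"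
  proof
    assume "b \<in> S"
    then obtain i where i: "1 \<le> i" "i \<le> m" "(f ^^ i) b = b" by (auto simp: S_def)
    with m ab have "i < m" by (metis le_neq_implies_less)
    have "(f ^^ m) b = (f ^^ (m - i)) ((f ^^ i) b)"
      using i funpow_add[of "m - i" i f] by simp
    then have "(f ^^ (m - i)) b = a" using i m by simp
    with least[of "m - i"] \<open>i < m\<close> i show False by simp
  qed
  have "orbit g a \<subseteq> S"
  proof (rule orbit_subset_closed)
    show "a \<in> S" unfolding S_def using m by (intro image_eqI[of _ _ m]) auto
    show "g y \<in> S" if "y \<in> S" for y
    proof (cases "y = a")
      case True
      then show ?thesis unfolding S_def gv using m by (intro image_eqI[of _ _ 1]) (auto simp: gv)
    next
      case False
      from that obtain i where i: "1 \<le> i" "i \<le> m" "(f ^^ i) b = y" by (auto simp: S_def)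
      then have "i < m" using False m by (metis le_neq_implies_less)
      moreover have "y \<noteq> b" using that bS by blast
      ultimately show ?thesis using i False gv
        by (auto simp: S_def intro!: image_eqI[of _ _ "Suc i"])
    qed
  qed
  then show nb: "b \<notin> orbit g a" using bS by blast
  have gt: "g \<circ> transpose a b = f" by (simp add: g_def comp_assoc)
  note M = orbit_comp_transpose_merge[OF g f(2) a b nb, unfolded gt]
  show "orbit f a = orbit g a \<union> orbit g b" using M(1) .
  show "orbit g x = orbit f x" if "x \<notin> orbit f a" for x
    using M(3)[of x] that M(1) by auto
qed

definition orbits :: "('a \<Rightarrow> 'a) \<Rightarrow> 'a set \<Rightarrow> 'a set set" where
  "orbits f A = orbit f ` A"

lemma finite_orbits [simp]: "finite A \<Longrightarrow> finite (orbits f A)"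
  by (simp add: orbits_def)

lemma orbits_merge:
  assumes f: "f permutes A" "finite A" and a: "a \<in> A" and b: "b \<in> A" and ab: "b \<notin> orbit f a"
  shows "orbits (f \<circ> transpose a b) A =
           insert (orbit f a \<union> orbit f b) (orbits f A - {orbit f a, orbit f b})" (is "?L = ?R")
    and "Suc (card (orbits (f \<circ> transpose a b) A)) = card (orbits f A)"
proof -
  let ?g = "f \<circ> transpose a b"
  note M = orbit_comp_transpose_merge[OF f a b ab]
  have g: "orbit ?g x = (if x \<in> orbit f a \<union> orbit f b then orbit f a \<union> orbit f b else orbit f x)" for x
  proof -
    have "orbit ?g x = orbit ?g a" if "x \<in> orbit f a \<union> orbit f b"
      using orbit_eq[OF permutes_comp_transpose[OF f(1) a b] f(2), of x a] M(1) that by simp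
    then show ?thesis using M by auto
  qed
  have iff: "x \<in> orbit f a \<union> orbit f b \<longleftrightarrow> orbit f x = orbit f a \<or> orbit f x = orbit f b" for x
    using orbit_eq[OF f] orbit_self[OF f] by blast
  show eq: "?L = ?R"
  proof
    show "?L \<subseteq> ?R" unfolding orbits_def using iff by (auto simp: g)
    have "orbit f a \<union> orbit f b = orbit ?g a" using M(1) by simp
    moreover have "orbit f x = orbit ?g x" if "orbit f x \<notin> {orbit f a, orbit f b}" for x
      using that iff[of x] by (simp add: g)
    ultimately show "?R \<subseteq> ?L" unfolding orbits_def using a by blast
  qed
  have "orbit f a \<union> orbit f b \<notin> orbits f A - {orbit f a, orbit f b}"
  proof
    assume "orbit f a \<union> orbit f b \<in> orbits f A - {orbit f a, orbit f b}"
    then obtain x where "orbit f x = orbit f a \<union> orbit f b" "orbit f x \<noteq> orbit f a"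
      by (auto simp: orbits_def)
    then show False using orbit_disjoint[OF f] orbit_self[OF f] by blast
  qed
  moreover have "orbit f a \<noteq> orbit f b" using ab orbit_self[OF f] by blast
  moreover have "{orbit f a, orbit f b} \<subseteq> orbits f A" using a b by (auto simp: orbits_def)
  moreover have "card (orbits f A) \<ge> 2"
    using card_mono[OF finite_orbits[OF f(2)] \<open>{orbit f a, orbit f b} \<subseteq> orbits f A\<close>]
      \<open>orbit f a \<noteq> orbit f b\<close> by simp
  ultimately show "Suc (card ?L) = card (orbits f A)"
    using f(2) by (simp add: eq card_Diff_subset)
qed

lemma orbits_split:
  assumes f: "f permutes A" "finite A" and a: "a \<in> A" and b: "b \<in> A"
    and ab: "b \<in> orbit f a" "a \<noteq> b"
  defines "g \<equiv> f \<circ> transpose a b"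
  shows "orbits g A = insert (orbit g a) (insert (orbit g b) (orbits f A - {orbit f a}))"
    and "card (orbits g A) = Suc (card (orbits f A))"
    and "orbit g a \<union> orbit g b = orbit f a" "orbit g a \<inter> orbit g b = {}"
proof -
  note S = orbit_comp_transpose_split[OF f a b ab, folded g_def]
  have g: "g permutes A" unfolding g_def using f(1) a b by (rule permutes_comp_transpose)
  have gt: "g \<circ> transpose a b = f" by (simp add: g_def comp_assoc)
  show "orbit g a \<union> orbit g b = orbit f a" using S(2) by simp
  show "orbit g a \<inter> orbit g b = {}"
    using S(1) orbit_disjoint[OF g f(2)] orbit_self[OF g f(2)] by blast
  note M = orbits_merge[OF g f(2) a b S(1), unfolded gt]
  show "card (orbits g A) = Suc (card (orbits f A))" using M(2) by simp
  have nin: "orbit g a \<union> orbit g b \<notin> orbits g A - {orbit g a, orbit g b}"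
  proof
    assume "orbit g a \<union> orbit g b \<in> orbits g A - {orbit g a, orbit g b}"
    then obtain x where "orbit g x = orbit g a \<union> orbit g b" "orbit g x \<noteq> orbit g a"
      by (auto simp: orbits_def)
    then show False using orbit_disjoint[OF g f(2)] orbit_self[OF g f(2)] by blast
  qed
  have "{orbit g a, orbit g b} \<subseteq> orbits g A" using a b by (auto simp: orbits_def)
  then show "orbits g A = insert (orbit g a) (insert (orbit g b) (orbits f A - {orbit f a}))"
    using M(1) S(2) nin by auto
qed

lemma orbit_fixed: "f x = x \<Longrightarrow> orbit f x = {x}"
  by (simp add: orbit_eq_singleton_iff)

text \<open>The new dart is a fixed point of f, so this is the merging case with a singleton cycle:
  h lands directly after q and the number of cycles stays the same.\<close>

lemma insert_dart:
  assumes f: "f permutes B" "finite B" and h: "h \<notin> B" and q: "q \<in> B"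
  defines "g \<equiv> f \<circ> transpose h q"
  shows "g permutes insert h B"
    and "\<And>x. x \<in> B \<Longrightarrow> orbit g x = (if q \<in> orbit f x then insert h (orbit f x) else orbit f x)"
    and "orbit g h = insert h (orbit f q)"
    and "orbits g (insert h B) = insert (insert h (orbit f q)) (orbits f B - {orbit f q})"
    and "card (orbits g (insert h B)) = card (orbits f B)"
proof -
  have f': "f permutes insert h B" using f(1) by (rule permutes_subset) auto
  have fin: "finite (insert h B)" using f(2) by simp
  have fh: "f h = h" using f(1) h by (simp add: permutes_def)
  note oh = orbit_fixed[of f h, OF fh]
  have qh: "q \<notin> orbit f h" using oh h q by auto
  show gp: "g permutes insert h B" unfolding g_def using q by (intro permutes_comp_transpose[OF f']) auto
  note M = orbit_comp_transpose_merge[OF f' fin _ _ qh, folded g_def, unfolded oh]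
  note O = orbits_merge[OF f' fin _ _ qh, folded g_def, unfolded oh]
  show "orbit g h = insert h (orbit f q)" using M(1) q by simp
  show "orbit g x = (if q \<in> orbit f x then insert h (orbit f x) else orbit f x)" if x: "x \<in> B" for x
  proof (cases "q \<in> orbit f x")
    case True
    then have eq: "orbit f q = orbit f x" by (rule orbit_eq[OF f])
    then have "x \<in> orbit g q" using M(2) q orbit_self[OF f, of x] by auto
    then have "orbit g x = orbit g q" by (rule orbit_eq[OF gp fin])
    then show ?thesis using True eq M(2) q by simp
  next
    case False
    then have "x \<notin> orbit f q" using orbit_eq[OF f] orbit_self[OF f] by blast
    then show ?thesis using M(3)[of x] x h q False by auto
  qed
  have hO: "{h} \<notin> orbits f B"
  proof
    assume "{h} \<in> orbits f B"
    then obtain x where "x \<in> B" "orbit f x = {h}" by (auto simp: orbits_def)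
    then show False using orbit_self[OF f, of x] h by auto
  qed
  have O0: "orbits f (insert h B) = insert {h} (orbits f B)" by (simp add: orbits_def oh)
  show "orbits g (insert h B) = insert (insert h (orbit f q)) (orbits f B - {orbit f q})"
    using O(1) q hO by (auto simp: O0)
  show "card (orbits g (insert h B)) = card (orbits f B)"
    using O(2) q hO f(2) by (simp add: O0)
qed

section \<open>Connectivity by invariant sets, and surgery at the root edge\<close>

section \<open>Opening and closing the root edge\<close>

text \<open>The part of \<open>rooted_map\<close> that survives opening: neither connectivity nor
  the number of fixed points of \<open>opp\<close> is prescribed.\<close>

definition premap :: "'a rmap \<Rightarrow> bool" where
  "premap M \<longleftrightarrow> finite (darts M) \<and> arrow M \<in> darts M \<and> rot M permutes darts M \<and>
     opp M permutes darts M \<and> (\<forall>x. opp M (opp M x) = x)"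

definition dart_closed :: "'a rmap \<Rightarrow> 'a set \<Rightarrow> bool" where
  "dart_closed M S \<longleftrightarrow> S \<subseteq> darts M \<and> (\<forall>x\<in>S. rot M x \<in> S \<and> opp M x \<in> S)"

lemma dart_closedI:
  "S \<subseteq> darts M \<Longrightarrow> (\<And>x. x \<in> S \<Longrightarrow> rot M x \<in> S) \<Longrightarrow> (\<And>x. x \<in> S \<Longrightarrow> opp M x \<in> S) \<Longrightarrow> dart_closed M S"
  by (auto simp: dart_closed_def)

text \<open>A finite invariant set is mapped onto itself, so by injectivity nothing enters it from
  outside.\<close>

lemma permutes_closed_Diff:
  assumes "f permutes A" "finite A" "S \<subseteq> A" "\<And>x. x \<in> S \<Longrightarrow> f x \<in> S" "x \<in> A - S"
  shows "f x \<in> A - S"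
proof -
  have "inj f" using assms(1) by (rule permutes_inj)
  have "f ` S = S"
    using assms(2-4) \<open>inj f\<close> by (intro endo_inj_surj) (auto intro: finite_subset inj_on_subset)
  moreover have "f x \<in> f ` S \<longleftrightarrow> x \<in> S" using \<open>inj f\<close> by (auto simp: inj_def)
  ultimately show ?thesis using assms permutes_in_image[OF assms(1)] by blast
qed

lemma dart_closed_Diff:
  assumes "premap M" "dart_closed M S"
  shows "dart_closed M (darts M - S)"
  using assms permutes_closed_Diff[of "rot M" "darts M" S] permutes_closed_Diff[of "opp M" "darts M" S]
  unfolding premap_def dart_closed_def by blast

definition dart_step :: "'a rmap \<Rightarrow> ('a \<times> 'a) set" where
  "dart_step M = {(h, rot M h) |h. h \<in> darts M} \<union> {(h, opp M h) |h. h \<in> darts M}"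

lemma dart_closed_reachable:
  assumes "premap M" "x \<in> darts M"
  shows "dart_closed M {y. (x, y) \<in> (dart_step M)\<^sup>*}"
proof -
  have sub: "y \<in> darts M" if "(x, y) \<in> (dart_step M)\<^sup>*" for y
    using that
    by induction (use assms permutes_in_image in \<open>fastforce simp: dart_step_def premap_def\<close>)+
  show ?thesis
  proof (rule dart_closedI)
    show "{y. (x, y) \<in> (dart_step M)\<^sup>*} \<subseteq> darts M" using sub by blast
    fix y assume "y \<in> {y. (x, y) \<in> (dart_step M)\<^sup>*}"
    then have y: "(x, y) \<in> (dart_step M)\<^sup>*" by simp
    have "(y, rot M y) \<in> dart_step M" "(y, opp M y) \<in> dart_step M"
      using sub[OF y] by (auto simp: dart_step_def)
    then show "rot M y \<in> {y. (x, y) \<in> (dart_step M)\<^sup>*}" "opp M y \<in> {y. (x, y) \<in> (dart_step M)\<^sup>*}"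
      using y by (auto intro: rtrancl_into_rtrancl)
  qed
qed

text \<open>Connectivity is turned into a statement about invariant sets, which restricts well to
  submaps. In the converse, the set reachable from x contains the arrow, for otherwise its
  complement would be a proper invariant set containing it.\<close>

lemma rooted_map_iff:
  "rooted_map M \<longleftrightarrow> premap M \<and> {x \<in> darts M. opp M x = x} = {arrow M} \<and>
     (\<forall>S. dart_closed M S \<longrightarrow> arrow M \<in> S \<longrightarrow> S = darts M)"
proof
  assume M: "rooted_map M"
  have out: "opp M x = x" if "x \<notin> darts M" for x
    using M that by (auto simp: rooted_map_def permutes_def)
  have pre: "premap M" using M out by (auto simp: rooted_map_def premap_def)
  have "S = darts M" if S: "dart_closed M S" "arrow M \<in> S" for S
  proof -
    have "y \<in> S" if "(arrow M, y) \<in> (dart_step M)\<^sup>*" for y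
      using that by induction (use S in \<open>auto simp: dart_closed_def dart_step_def\<close>)
    then show ?thesis using M S unfolding rooted_map_def dart_step_def[symmetric] dart_closed_def by blast
  qed
  then show "premap M \<and> {x \<in> darts M. opp M x = x} = {arrow M} \<and>
     (\<forall>S. dart_closed M S \<longrightarrow> arrow M \<in> S \<longrightarrow> S = darts M)"
    using pre M by (auto simp: rooted_map_def)
next
  assume M: "premap M \<and> {x \<in> darts M. opp M x = x} = {arrow M} \<and>
     (\<forall>S. dart_closed M S \<longrightarrow> arrow M \<in> S \<longrightarrow> S = darts M)"
  have "(x, y) \<in> (dart_step M)\<^sup>*" if x: "x \<in> darts M" and y: "y \<in> darts M" for x y
  proof -
    let ?S = "{y. (x, y) \<in> (dart_step M)\<^sup>*}"
    have c: "dart_closed M ?S" using dart_closed_reachable[of M x] M x by simp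
    have "arrow M \<in> ?S"
    proof (rule ccontr)
      assume "arrow M \<notin> ?S"
      then have "arrow M \<in> darts M - ?S" using M by (auto simp: premap_def)
      then have "darts M - ?S = darts M" using dart_closed_Diff[OF _ c] M by blast
      then show False using x by auto
    qed
    then have "?S = darts M" using M c by blast
    then show ?thesis using y by blast
  qed
  moreover have "opp M h = h \<longleftrightarrow> h = arrow M" if "h \<in> darts M" for h
  proof -
    have "h \<in> {x \<in> darts M. opp M x = x} \<longleftrightarrow> h \<in> {arrow M}" using M by simp
    then show ?thesis using that by simp
  qed
  ultimately show "rooted_map M"
    using M unfolding rooted_map_def dart_step_def[symmetric] by (auto simp: premap_def)
qed

lemma vertices_orbits: "vertices M = orbits (rot M) (darts M)"
  by (simp add: vertices_def vertex_of_def orbits_def)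

lemma faces_orbits: "faces M = orbits (rot M \<circ> opp M) (darts M)"
  by (simp add: faces_def face_of_def orbits_def)

lemma premap_comp_permutes: "premap M \<Longrightarrow> (rot M \<circ> opp M) permutes darts M"
  by (auto simp: premap_def intro: permutes_compose)

lemma card_edges:
  assumes "rooted_map M"
  shows "card (darts M) = 2 * card (edges M) + 1"
proof -
  have M: "premap M" "{x \<in> darts M. opp M x = x} = {arrow M}" using assms by (auto simp: rooted_map_iff)
  have inv: "opp M (opp M x) = x" for x using M by (simp add: premap_def)
  have ne: "opp M x \<noteq> x" if "x \<in> darts M - {arrow M}" for x using M(2) that by blast
  have out: "opp M x \<in> darts M - {arrow M}" if "x \<in> darts M - {arrow M}" for x
  proof -
    have "opp M (arrow M) = arrow M" using M(2) by blast
    then have "opp M x \<noteq> arrow M" using inv[of x] that by force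
    then show ?thesis using that M permutes_in_image by (fastforce simp: premap_def)
  qed
  have "card (\<Union>(edges M)) = (\<Sum>e\<in>edges M. card e)"
  proof (rule card_Union_disjoint)
    show "pairwise disjnt (edges M)"
      unfolding pairwise_def disjnt_def edges_def edge_of_def by (auto simp: inv) (metis inv)+
    show "\<And>A. A \<in> edges M \<Longrightarrow> finite A" by (auto simp: edges_def edge_of_def)
  qed
  also have "\<dots> = (\<Sum>e\<in>edges M. 2)"
  proof (intro sum.cong refl)
    fix e assume "e \<in> edges M"
    then obtain x where "x \<in> darts M - {arrow M}" "e = {x, opp M x}" by (auto simp: edges_def edge_of_def)
    then show "card e = 2" using ne[of x] by simp
  qed
  also have "\<Union>(edges M) = darts M - {arrow M}"
    using out by (auto simp: edges_def edge_of_def)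
  finally have "card (darts M - {arrow M}) = 2 * card (edges M)" by simp
  moreover have "card (darts M) > 0" "finite (darts M)" "arrow M \<in> darts M"
    using M(1) by (auto simp: premap_def card_gt_0_iff)
  ultimately show ?thesis by simp
qed

text \<open>Euler's relation is doubled so that \<open>2E + 1\<close> becomes the number of darts
  and no subtraction occurs.\<close>

lemma planar_map_iff:
  "planar_map M \<longleftrightarrow> rooted_map M \<and> 2 * card (vertices M) + 2 * card (faces M) = card (darts M) + 3"
  using card_edges[of M] by (auto simp: planar_map_def has_genus_def)

text \<open>
  A legged map has, besides the arrow, a second dart \<open>l\<close> fixed by \<open>opp\<close>, and may consist of two
  components containing one of them each. Closing it makes \<open>l\<close> a half of an edge whose other half
  \<open>h\<close> follows the arrow: \<open>h\<close> is inserted after the arrow, and then swapping the successors of \<open>h\<close>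
  and \<open>l\<close> joins or splits their vertices. The faces only see the insertion of \<open>h\<close>.
\<close>

definition legged :: "'a rmap \<Rightarrow> 'a \<Rightarrow> bool" where
  "legged N l \<longleftrightarrow> premap N \<and> l \<in> darts N \<and> l \<noteq> arrow N \<and> {x \<in> darts N. opp N x = x} = {arrow N, l} \<and>
     (\<forall>S. dart_closed N S \<longrightarrow> arrow N \<in> S \<longrightarrow> l \<in> S \<longrightarrow> S = darts N)"

definition close :: "'a \<Rightarrow> 'a \<Rightarrow> 'a rmap \<Rightarrow> 'a rmap" where
  "close h l N = \<lparr>darts = insert h (darts N),
     rot = rot N \<circ> transpose h (arrow N) \<circ> transpose h l,
     opp = opp N \<circ> transpose h l, arrow = arrow N\<rparr>"

lemma close_simps [simp]:
  "darts (close h l N) = insert h (darts N)"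
  "arrow (close h l N) = arrow N"
  by (simp_all add: close_def)

context
  fixes N :: "'a rmap" and h l :: 'a
  assumes N: "legged N l" and h: "h \<notin> darts N"
begin

lemma legged_facts:
  shows "premap N" "finite (darts N)" "arrow N \<in> darts N" "l \<in> darts N" "l \<noteq> arrow N" "h \<noteq> l" "h \<noteq> arrow N"
    "rot N permutes darts N" "opp N permutes darts N" "opp N (opp N x) = x"
    "rot N h = h" "opp N h = h" "opp N l = l" "opp N (arrow N) = arrow N"
proof -
  show *: "premap N" "l \<in> darts N" "l \<noteq> arrow N" using N by (simp_all add: legged_def)
  then show **: "finite (darts N)" "arrow N \<in> darts N" "rot N permutes darts N" "opp N permutes darts N"
      "opp N (opp N x) = x"
    by (auto simp: premap_def)
  show "h \<noteq> l" "h \<noteq> arrow N" using * ** h by auto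
  show "rot N h = h" "opp N h = h" using ** h by (auto simp: permutes_def)
  have "arrow N \<in> {x \<in> darts N. opp N x = x}" "l \<in> {x \<in> darts N. opp N x = x}"
    using N by (auto simp: legged_def)
  then show "opp N l = l" "opp N (arrow N) = arrow N" by auto
qed

lemma rot_close:
  "rot (close h l N) (arrow N) = h" "rot (close h l N) h = rot N l"
  "rot (close h l N) l = rot N (arrow N)"
  "x \<noteq> h \<Longrightarrow> x \<noteq> l \<Longrightarrow> x \<noteq> arrow N \<Longrightarrow> rot (close h l N) x = rot N x"
  using legged_facts by (auto simp: close_def)

lemma opp_close:
  "opp (close h l N) h = l" "opp (close h l N) l = h"
  "x \<noteq> h \<Longrightarrow> x \<noteq> l \<Longrightarrow> opp (close h l N) x = opp N x"
  using legged_facts by (auto simp: close_def)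

text \<open>\<open>opp N\<close> fixes h, l and the arrow, hence commutes with both transpositions.
  The two copies of the one with l cancel, and the insertion of h after the arrow remains.\<close>

lemma face_perm_close:
  "rot (close h l N) \<circ> opp (close h l N) = (rot N \<circ> opp N) \<circ> transpose h (arrow N)"
proof
  fix x
  have "opp N x \<noteq> h" "opp N x \<noteq> l" "opp N x \<noteq> arrow N" if "x \<noteq> h" "x \<noteq> l" "x \<noteq> arrow N"
    using legged_facts that by metis+
  then show "(rot (close h l N) \<circ> opp (close h l N)) x = ((rot N \<circ> opp N) \<circ> transpose h (arrow N)) x"
    using legged_facts by (auto simp: close_def transpose_def)
qed

lemma premap_close: "premap (close h l N)"
proof -
  have "rot N permutes insert h (darts N)" "opp N permutes insert h (darts N)"
    using legged_facts by (auto intro: permutes_subset)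
  moreover have "opp (close h l N) (opp (close h l N) x) = x" for x
  proof -
    have "opp N x \<noteq> h" "opp N x \<noteq> l" if "x \<noteq> h" "x \<noteq> l"
      using legged_facts that by metis+
    then show ?thesis using legged_facts by (auto simp: close_def transpose_def)
  qed
  ultimately show ?thesis
    using legged_facts unfolding premap_def
    by (auto simp: close_def intro!: permutes_comp_transpose)
qed

lemma rooted_close: "rooted_map (close h l N)"
proof -
  have "{x \<in> darts (close h l N). opp (close h l N) x = x} = {arrow (close h l N)}"
  proof -
    have "{x \<in> darts N. opp N x = x} = {arrow N, l}" using N by (simp add: legged_def)
    then have "opp N x = x \<longleftrightarrow> x = arrow N \<or> x = l" if "x \<in> darts N" for x
      using that by blast
    then have "opp (close h l N) x = x \<longleftrightarrow> x = arrow N" if "x \<in> insert h (darts N)" for x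
      using that legged_facts opp_close(3)[of x] opp_close(1,2) by (cases "x = h"; cases "x = l") auto
    then show ?thesis using legged_facts by auto
  qed
  moreover have "S = darts (close h l N)" if S: "dart_closed (close h l N) S" "arrow (close h l N) \<in> S" for S
  proof -
    have r: "rot (close h l N) x \<in> S" "opp (close h l N) x \<in> S" if "x \<in> S" for x
      using S that by (auto simp: dart_closed_def)
    have o: "arrow N \<in> S" using S by simp
    have hS: "h \<in> S" using r(1)[OF o] rot_close by simp
    have lS: "l \<in> S" using r(2)[OF hS] opp_close by simp
    \<comment> \<open>Only the successors of h, l and the arrow differ between the two maps, and all
      of them lie in S.\<close>
    have "dart_closed N (S - {h})"
    proof (rule dart_closedI)
      show sub: "S - {h} \<subseteq> darts N" using S by (auto simp: dart_closed_def)
      fix x assume x: "x \<in> S - {h}"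
      then have "rot N x \<in> darts N" "opp N x \<in> darts N"
        using sub legged_facts permutes_in_image by fastforce+
      moreover have "rot N x \<in> S"
      proof (cases "x = l \<or> x = arrow N")
        case True
        then show ?thesis using r(1)[OF hS] r(1)[OF lS] rot_close by auto
      next
        case False
        then show ?thesis using r(1)[of x] rot_close(4)[of x] x by simp
      qed
      moreover have "opp N x \<in> S"
        using r(2)[of x] opp_close(3)[of x] x lS legged_facts by (cases "x = l") auto
      ultimately show "rot N x \<in> S - {h}" "opp N x \<in> S - {h}" using h by auto
    qed
    then have "S - {h} = darts N"
      using N o lS legged_facts by (auto simp: legged_def)
    then show ?thesis using hS by auto
  qed
  ultimately show ?thesis using premap_close by (simp add: rooted_map_iff)
qed

lemma card_faces_close: "card (faces (close h l N)) = card (faces N)"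
  using insert_dart(5)[OF premap_comp_permutes[OF legged_facts(1)] _ h, of "arrow N"] legged_facts
  by (simp add: faces_orbits face_perm_close)

lemma orbit_rot_close_arrow: "orbit (rot (close h l N)) (arrow N) = orbit (rot (close h l N)) h"
  using orbit_eq[of "rot (close h l N)" "insert h (darts N)" h "arrow N"]
    orbit.base[of "rot (close h l N)" "arrow N"] premap_close rot_close(1)
  by (simp add: premap_def)

text \<open>The transposition with l acts across two cycles and joins the vertices of the arrow and
  of l: the root edge becomes a loop.\<close>

lemma vertices_close_join:
  assumes "l \<notin> orbit (rot N) (arrow N)"
  defines "R \<equiv> insert h (orbit (rot N) (arrow N) \<union> orbit (rot N) l)"
  shows "root_vertex (close h l N) = R"
    and "vertices (close h l N) = insert R (vertices N - {orbit (rot N) (arrow N), orbit (rot N) l})"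
    and "Suc (card (vertices (close h l N))) = card (vertices N)"
proof -
  let ?g = "rot N \<circ> transpose h (arrow N)"
  note I = insert_dart[OF legged_facts(8,2) h legged_facts(3)]
  have fin: "finite (insert h (darts N))" using legged_facts by simp
  have lnot: "arrow N \<notin> orbit (rot N) l"
    using assms(1) orbit_eq[OF legged_facts(8,2)] orbit_self[OF legged_facts(8,2)] by blast
  have oh: "orbit ?g h = insert h (orbit (rot N) (arrow N))" using I(3) .
  have ol: "orbit ?g l = orbit (rot N) l" using I(2)[of l] lnot legged_facts by simp
  have nin: "l \<notin> orbit ?g h" using assms(1) oh legged_facts by simp
  have rc: "rot (close h l N) = ?g \<circ> transpose h l" by (simp add: close_def)
  note M = orbit_comp_transpose_merge[OF I(1) fin _ _ nin, unfolded oh ol, folded rc]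
  note O = orbits_merge[OF I(1) fin _ _ nin, unfolded oh ol, folded rc]
  show "root_vertex (close h l N) = R"
    using M(1) legged_facts(4) orbit_rot_close_arrow by (simp add: root_vertex_def vertex_of_def R_def)
  have hv: "insert h (orbit (rot N) (arrow N)) \<notin> vertices N"
    using orbit_in[OF legged_facts(8)] h by (auto simp: vertices_orbits orbits_def)
  have "insert (insert h (orbit (rot N) (arrow N))) (vertices N - {orbit (rot N) (arrow N)}) -
      {insert h (orbit (rot N) (arrow N)), orbit (rot N) l} =
      vertices N - {orbit (rot N) (arrow N), orbit (rot N) l}"
    using hv by blast
  then show "vertices (close h l N) = insert R (vertices N - {orbit (rot N) (arrow N), orbit (rot N) l})"
    using O(1) legged_facts(4) by (simp add: vertices_orbits R_def I(4))
  show "Suc (card (vertices (close h l N))) = card (vertices N)"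
    using O(2) I(5) legged_facts by (simp add: vertices_orbits)
qed

text \<open>Here l already lies at the root vertex, so the transposition cuts that vertex in two,
  and the root edge runs between the pieces.\<close>

lemma vertices_close_split:
  assumes "l \<in> orbit (rot N) (arrow N)"
  defines "R \<equiv> root_vertex (close h l N)" and "w \<equiv> vertex_of (close h l N) l"
  shows "R \<union> w = insert h (orbit (rot N) (arrow N))" "R \<inter> w = {}"
    and "vertices (close h l N) = insert R (insert w (vertices N - {orbit (rot N) (arrow N)}))"
    and "card (vertices (close h l N)) = Suc (card (vertices N))"
proof -
  let ?g = "rot N \<circ> transpose h (arrow N)"
  note I = insert_dart[OF legged_facts(8,2) h legged_facts(3)]
  have fin: "finite (insert h (darts N))" using legged_facts by simp
  have oh: "orbit ?g h = insert h (orbit (rot N) (arrow N))" using I(3) .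
  have lin: "l \<in> orbit ?g h" using assms(1) oh by simp
  have rc: "rot (close h l N) = ?g \<circ> transpose h l" by (simp add: close_def)
  note O = orbits_split[OF I(1) fin _ _ lin legged_facts(6), folded rc, unfolded oh]
  then have R: "orbit (rot (close h l N)) h = R"
    by (simp add: R_def root_vertex_def vertex_of_def orbit_rot_close_arrow)
  have w: "orbit (rot (close h l N)) l = w" by (simp add: w_def vertex_of_def)
  show "R \<union> w = insert h (orbit (rot N) (arrow N))" "R \<inter> w = {}"
    using O(3,4) legged_facts unfolding R w by auto
  have hv: "insert h (orbit (rot N) (arrow N)) \<notin> vertices N"
    using orbit_in[OF legged_facts(8)] h by (auto simp: vertices_orbits orbits_def)
  then show "vertices (close h l N) = insert R (insert w (vertices N - {orbit (rot N) (arrow N)}))"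
    using O(1) I(4) legged_facts by (auto simp: vertices_orbits R w)
  show "card (vertices (close h l N)) = Suc (card (vertices N))"
    using O(2) I(5) legged_facts by (simp add: vertices_orbits)
qed

end

text \<open>The transpositions of \<open>close\<close> are undone in reverse order, with h the
  successor of the arrow and l its opposite.\<close>

lemma rooted_map_open:
  assumes "rooted_map M" "darts M \<noteq> {arrow M}"
  obtains N h l where "legged N l" "h \<notin> darts N" "M = close h l N"
proof -
  have M: "premap M" "{x \<in> darts M. opp M x = x} = {arrow M}"
    and conn: "\<And>S. dart_closed M S \<Longrightarrow> arrow M \<in> S \<Longrightarrow> S = darts M"
    using assms by (auto simp: rooted_map_iff)
  have fin: "finite (darts M)" and o: "arrow M \<in> darts M" and r: "rot M permutes darts M"
    and p: "opp M permutes darts M" and inv: "\<And>x. opp M (opp M x) = x"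
    using M by (auto simp: premap_def)
  have po: "opp M (arrow M) = arrow M" using M by blast
  define h where "h = rot M (arrow M)"
  define l where "l = opp M h"
  have ho: "h \<noteq> arrow M"
  proof
    assume "h = arrow M"
    then have "dart_closed M {arrow M}" using o po by (auto simp: dart_closed_def h_def)
    then show False using conn assms(2) by auto
  qed
  have hd: "h \<in> darts M" using o r by (simp add: h_def permutes_in_image)
  have hl: "h \<noteq> l"
  proof
    assume "h = l"
    then have "h \<in> {x \<in> darts M. opp M x = x}" using hd by (simp add: l_def)
    then show False using M(2) ho by simp
  qed
  have ld: "l \<in> darts M" using hd p by (simp add: l_def permutes_in_image)
  have lo: "l \<noteq> arrow M" using ho po inv[of h] by (auto simp: l_def)
  have pl: "opp M l = h" using inv by (simp add: l_def)
  define N where "N = \<lparr>darts = darts M - {h}, rot = rot M \<circ> transpose h l \<circ> transpose h (arrow M),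
    opp = opp M \<circ> transpose h l, arrow = arrow M\<rparr>"
  have Nr: "rot N h = h" "rot N (arrow M) = rot M l" "rot N l = rot M h"
    "\<And>x. x \<noteq> h \<Longrightarrow> x \<noteq> l \<Longrightarrow> x \<noteq> arrow M \<Longrightarrow> rot N x = rot M x"
    using ho hl lo by (auto simp: N_def h_def)
  have No: "opp N h = h" "opp N l = l" "\<And>x. x \<noteq> h \<Longrightarrow> x \<noteq> l \<Longrightarrow> opp N x = opp M x"
    using pl hl by (auto simp: N_def l_def)
  have red: "f permutes (darts M - {h})" if "f permutes darts M" "f h = h" for f :: "'a \<Rightarrow> 'a"
    by (rule permutes_superset[OF that(1)]) (use that(2) in auto)
  have "premap N"
  proof -
    have "rot N permutes darts N"
      unfolding N_def rmap.simps
      by (rule red) (use r hd ld o ho hl lo in \<open>auto simp: h_def[symmetric] intro!: permutes_comp_transpose\<close>)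
    moreover have "opp N permutes darts N"
      unfolding N_def rmap.simps
      by (rule red) (use p hd ld pl in \<open>auto intro!: permutes_comp_transpose\<close>)
    moreover have "opp N (opp N x) = x" for x
    proof -
      have "opp M x \<noteq> h" "opp M x \<noteq> l" if "x \<noteq> h" "x \<noteq> l"
        using that inv l_def pl by metis+
      then show ?thesis using No inv by (cases "x = h"; cases "x = l") auto
    qed
    ultimately show ?thesis using fin o ho by (auto simp: premap_def N_def)
  qed
  moreover have "{x \<in> darts N. opp N x = x} = {arrow N, l}"
  proof -
    have "opp N x = x \<longleftrightarrow> x = arrow M \<or> x = l" if "x \<in> darts M - {h}" for x
      using No M(2) that po lo by (cases "x = l") auto
    then show ?thesis using o ho hl ld by (auto simp: N_def)
  qed
  moreover have "S = darts N" if S: "dart_closed N S" "arrow N \<in> S" "l \<in> S" for S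
  proof -
    have hS: "h \<notin> S" and sub: "S \<subseteq> darts M" using S(1) by (auto simp: dart_closed_def N_def)
    have r': "rot N x \<in> S" "opp N x \<in> S" if "x \<in> S" for x using S that by (auto simp: dart_closed_def)
    have aS: "arrow M \<in> S" using S(2) by (simp add: N_def)
    have "dart_closed M (insert h S)"
    proof (rule dart_closedI)
      show "insert h S \<subseteq> darts M" using sub hd by simp
      fix x assume x: "x \<in> insert h S"
      show "rot M x \<in> insert h S"
        using x Nr r'(1)[of x] r'(1)[OF aS] r'(1)[OF S(3)]
        by (cases "x = h"; cases "x = l"; cases "x = arrow M") (auto simp: h_def)
      show "opp M x \<in> insert h S"
        using x No r'(2)[of x] S(3) pl l_def by (cases "x = h"; cases "x = l") auto
    qed
    then have "insert h S = darts M" using conn aS by blast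
    then show ?thesis using hS by (auto simp: N_def)
  qed
  ultimately have "legged N l" using ld hl lo by (auto simp: legged_def N_def)
  moreover have "h \<notin> darts N" by (simp add: N_def)
  moreover have "M = close h l N"
    by (rule rmap.equality) (use hd in \<open>auto simp: close_def N_def comp_assoc\<close>)
  ultimately show thesis by (rule that)
qed

section \<open>The two shapes of an opened map, and Euler's inequality\<close>

section \<open>Legs and disjoint unions\<close>

text \<open>The leg goes directly after q. A fresh l is fixed by \<open>opp\<close>, since a
  permutation of the old darts leaves it alone.\<close>

definition add_leg :: "'a \<Rightarrow> 'a \<Rightarrow> 'a rmap \<Rightarrow> 'a rmap" where
  "add_leg q l M = \<lparr>darts = insert l (darts M), rot = rot M \<circ> transpose l q, opp = opp M, arrow = arrow M\<rparr>"

text \<open>Composition glues permutations with disjoint supports. The arrow of \<open>M1\<close>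
  stays the arrow, that of \<open>M2\<close> becomes the leg.\<close>

definition disj_union :: "'a rmap \<Rightarrow> 'a rmap \<Rightarrow> 'a rmap" where
  "disj_union M1 M2 = \<lparr>darts = darts M1 \<union> darts M2, rot = rot M1 \<circ> rot M2,
     opp = opp M1 \<circ> opp M2, arrow = arrow M1\<rparr>"

lemma add_leg_simps [simp]:
  "darts (add_leg q l M) = insert l (darts M)" "arrow (add_leg q l M) = arrow M"
  "opp (add_leg q l M) = opp M" "rot (add_leg q l M) = rot M \<circ> transpose l q"
  by (simp_all add: add_leg_def)

lemma disj_union_simps [simp]:
  "darts (disj_union M1 M2) = darts M1 \<union> darts M2" "arrow (disj_union M1 M2) = arrow M1"
  by (simp_all add: disj_union_def)

lemma rooted_map_facts:
  assumes "rooted_map M"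
  shows "premap M" "finite (darts M)" "arrow M \<in> darts M" "rot M permutes darts M" "opp M permutes darts M"
    "\<And>x. opp M (opp M x) = x" "opp M (arrow M) = arrow M"
    "\<And>x. x \<in> darts M \<Longrightarrow> opp M x = x \<longleftrightarrow> x = arrow M"
    "\<And>S. dart_closed M S \<Longrightarrow> arrow M \<in> S \<Longrightarrow> S = darts M"
proof -
  show "premap M" using assms by (simp add: rooted_map_iff)
  then show "finite (darts M)" "arrow M \<in> darts M" "rot M permutes darts M" "opp M permutes darts M"
    "\<And>x. opp M (opp M x) = x" by (auto simp: premap_def)
  have "{x \<in> darts M. opp M x = x} = {arrow M}" using assms by (simp add: rooted_map_iff)
  then show "opp M (arrow M) = arrow M" "\<And>x. x \<in> darts M \<Longrightarrow> opp M x = x \<longleftrightarrow> x = arrow M"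
    by blast+
  show "\<And>S. dart_closed M S \<Longrightarrow> arrow M \<in> S \<Longrightarrow> S = darts M" using assms by (simp add: rooted_map_iff)
qed

context
  fixes M :: "'a rmap" and q l :: 'a
  assumes M: "rooted_map M" and l: "l \<notin> darts M" and q: "q \<in> darts M"
begin

lemma legged_add_leg: "legged (add_leg q l M) l"
proof -
  note F = rooted_map_facts[OF M]
  have fix_l: "rot M l = l" "opp M l = l" using F(4,5) l by (auto simp: permutes_def)
  have "premap (add_leg q l M)"
    using F q permutes_subset[OF F(5), of "insert l (darts M)"] insert_dart(1)[OF F(4,2) l q]
    by (auto simp: premap_def)
  moreover have "{x \<in> insert l (darts M). opp M x = x} = {arrow M, l}"
    using F(3,7,8) fix_l by auto
  moreover have "S = insert l (darts M)"
    if S: "dart_closed (add_leg q l M) S" "arrow M \<in> S" "l \<in> S" for S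
  proof -
    have r: "(rot M \<circ> transpose l q) x \<in> S" "opp M x \<in> S" if "x \<in> S" for x
      using S that by (auto simp: dart_closed_def)
    have "dart_closed M (S - {l})"
    proof (rule dart_closedI)
      show sub: "S - {l} \<subseteq> darts M" using S by (auto simp: dart_closed_def)
      fix x assume x: "x \<in> S - {l}"
      then have "rot M x \<noteq> l" "opp M x \<noteq> l"
        using sub l permutes_in_image[OF F(4)] permutes_in_image[OF F(5)] by (metis subsetD)+
      moreover have "rot M x \<in> S"
        using x r(1)[of x] r(1)[OF S(3)] by (cases "x = q") auto
      ultimately show "rot M x \<in> S - {l}" "opp M x \<in> S - {l}" using r(2)[of x] x by auto
    qed
    then have "S - {l} = darts M" using F(3,9) S(2) l by blast
    then show ?thesis using S(3) by auto
  qed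
  ultimately show ?thesis using F(3) l by (auto simp: legged_def)
qed

text \<open>Moving the transposition past the involution \<open>opp\<close> replaces q by
  \<open>opp M q\<close>; the face permutation again acquires just one inserted dart.\<close>

lemma face_perm_add_leg:
  "rot (add_leg q l M) \<circ> opp (add_leg q l M) = (rot M \<circ> opp M) \<circ> transpose l (opp M q)"
proof
  fix x
  note F = rooted_map_facts[OF M]
  have fix_l: "opp M l = l" using F(5) l by (auto simp: permutes_def)
  have "opp M x = q \<longleftrightarrow> x = opp M q" "opp M x = l \<longleftrightarrow> x = l" using F(6) fix_l by metis+
  then show "(rot (add_leg q l M) \<circ> opp (add_leg q l M)) x = ((rot M \<circ> opp M) \<circ> transpose l (opp M q)) x"
    using fix_l F(6) by (auto simp: transpose_def)
qed

lemma card_faces_add_leg: "card (faces (add_leg q l M)) = card (faces M)"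
proof -
  note F = rooted_map_facts[OF M]
  have "opp M q \<in> darts M" using q F(5) by (simp add: permutes_in_image)
  then show ?thesis
    using insert_dart(5)[OF premap_comp_permutes[OF F(1)] F(2) l] 
    by (simp add: faces_orbits face_perm_add_leg[unfolded add_leg_simps])
qed

lemma vertices_add_leg:
  "vertices (add_leg q l M) = insert (insert l (orbit (rot M) q)) (vertices M - {orbit (rot M) q})"
  "card (vertices (add_leg q l M)) = card (vertices M)"
  "x \<in> darts M \<Longrightarrow> orbit (rot (add_leg q l M)) x =
     (if q \<in> orbit (rot M) x then insert l (orbit (rot M) x) else orbit (rot M) x)"
  "orbit (rot (add_leg q l M)) l = insert l (orbit (rot M) q)"
  using insert_dart[OF rooted_map_facts(4,2)[OF M] l q] by (auto simp: vertices_orbits)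

end

lemma orbits_disjoint:
  assumes "f permutes A" "g permutes B" "A \<inter> B = {}"
  shows "orbits f A \<inter> orbits g B = {}"
proof (rule ccontr)
  assume "orbits f A \<inter> orbits g B \<noteq> {}"
  then obtain x y where "x \<in> A" "y \<in> B" "orbit f x = orbit g y" by (auto simp: orbits_def)
  then have "orbit f x \<subseteq> A \<inter> B"
    using orbit_in[OF assms(1)] orbit_in[OF assms(2)] by (metis le_inf_iff)
  then show False using assms(3) orbit_nonempty[of f x] by auto
qed

context
  fixes M1 M2 :: "'a rmap"
  assumes M1: "rooted_map M1" and M2: "rooted_map M2" and disj: "darts M1 \<inter> darts M2 = {}"
begin

lemma disj_union_apply:
  "x \<in> darts M1 \<Longrightarrow> rot (disj_union M1 M2) x = rot M1 x"
  "x \<in> darts M2 \<Longrightarrow> rot (disj_union M1 M2) x = rot M2 x"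
  "x \<in> darts M1 \<Longrightarrow> opp (disj_union M1 M2) x = opp M1 x"
  "x \<in> darts M2 \<Longrightarrow> opp (disj_union M1 M2) x = opp M2 x"
proof -
  note F1 = rooted_map_facts[OF M1] and F2 = rooted_map_facts[OF M2]
  show "x \<in> darts M1 \<Longrightarrow> rot (disj_union M1 M2) x = rot M1 x"
    using F2(4) disj by (auto simp: disj_union_def permutes_def)
  show "x \<in> darts M1 \<Longrightarrow> opp (disj_union M1 M2) x = opp M1 x"
    using F2(5) disj by (auto simp: disj_union_def permutes_def)
  assume "x \<in> darts M2"
  then have "rot M2 x \<in> darts M2" "opp M2 x \<in> darts M2"
    using F2(4,5) by (auto simp: permutes_in_image)
  then have "rot M2 x \<notin> darts M1" "opp M2 x \<notin> darts M1" using disj by auto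
  then show "rot (disj_union M1 M2) x = rot M2 x" "opp (disj_union M1 M2) x = opp M2 x"
    using F1(4,5) by (auto simp: disj_union_def permutes_def)
qed

lemma disj_union_outside:
  "x \<notin> darts M1 \<Longrightarrow> x \<notin> darts M2 \<Longrightarrow> opp (disj_union M1 M2) x = x"
  using rooted_map_facts(5)[OF M1] rooted_map_facts(5)[OF M2] by (auto simp: disj_union_def permutes_def)

lemma legged_disj_union: "legged (disj_union M1 M2) (arrow M2)"
proof -
  note F1 = rooted_map_facts[OF M1] and F2 = rooted_map_facts[OF M2]
  note A = disj_union_apply
  have in1: "rot M1 x \<in> darts M1" "opp M1 x \<in> darts M1" if "x \<in> darts M1" for x
    using that F1(4,5) by (auto simp: permutes_in_image)
  have in2: "rot M2 x \<in> darts M2" "opp M2 x \<in> darts M2" if "x \<in> darts M2" for x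
    using that F2(4,5) by (auto simp: permutes_in_image)
  have "premap (disj_union M1 M2)"
  proof -
    have "rot (disj_union M1 M2) permutes darts M1 \<union> darts M2"
      "opp (disj_union M1 M2) permutes darts M1 \<union> darts M2"
      using F1(4,5) F2(4,5) by (auto simp: disj_union_def intro!: permutes_compose intro: permutes_subset)
    moreover have "opp (disj_union M1 M2) (opp (disj_union M1 M2) x) = x" for x
      using A(3,4)[of x] A(3)[of "opp M1 x"] A(4)[of "opp M2 x"] in1 in2 F1(6) F2(6) disj_union_outside[of x]
      by (cases "x \<in> darts M1"; cases "x \<in> darts M2") auto
    ultimately show ?thesis using F1(2,3) F2(2) by (simp add: premap_def)
  qed
  moreover have "{x \<in> darts M1 \<union> darts M2. opp (disj_union M1 M2) x = x} = {arrow M1, arrow M2}"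
    using A(3,4) F1(3,8) F2(3,8) by auto
  moreover have "S = darts M1 \<union> darts M2"
    if S: "dart_closed (disj_union M1 M2) S" "arrow M1 \<in> S" "arrow M2 \<in> S" for S
  proof -
    have r: "rot (disj_union M1 M2) x \<in> S" "opp (disj_union M1 M2) x \<in> S" if "x \<in> S" for x
      using S that by (auto simp: dart_closed_def)
    have "dart_closed M1 (S \<inter> darts M1)"
      by (rule dart_closedI) (use in1 r A(1,3) in fastforce)+
    moreover have "dart_closed M2 (S \<inter> darts M2)"
      by (rule dart_closedI) (use in2 r A(2,4) in fastforce)+
    ultimately have "S \<inter> darts M1 = darts M1" "S \<inter> darts M2 = darts M2"
      using F1(3,9) F2(3,9) S(2,3) by blast+
    then show ?thesis using S(1) by (auto simp: dart_closed_def)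
  qed
  moreover have "arrow M2 \<noteq> arrow M1" using F1(3) F2(3) disj by auto
  ultimately show ?thesis using F2(3) by (auto simp: legged_def)
qed

lemma orbit_disj_union:
  "x \<in> darts M1 \<Longrightarrow> orbit (rot (disj_union M1 M2)) x = orbit (rot M1) x"
  "x \<in> darts M2 \<Longrightarrow> orbit (rot (disj_union M1 M2)) x = orbit (rot M2) x"
  "x \<in> darts M1 \<Longrightarrow> orbit (rot (disj_union M1 M2) \<circ> opp (disj_union M1 M2)) x = orbit (rot M1 \<circ> opp M1) x"
  "x \<in> darts M2 \<Longrightarrow> orbit (rot (disj_union M1 M2) \<circ> opp (disj_union M1 M2)) x = orbit (rot M2 \<circ> opp M2) x"
proof -
  note A = disj_union_apply
  have in1: "rot M1 x \<in> darts M1" "opp M1 x \<in> darts M1" if "x \<in> darts M1" for x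
    using that rooted_map_facts(4,5)[OF M1] by (auto simp: permutes_in_image)
  have in2: "rot M2 x \<in> darts M2" "opp M2 x \<in> darts M2" if "x \<in> darts M2" for x
    using that rooted_map_facts(4,5)[OF M2] by (auto simp: permutes_in_image)
  show "x \<in> darts M1 \<Longrightarrow> orbit (rot (disj_union M1 M2)) x = orbit (rot M1) x"
    by (rule orbit_cong0[of _ "darts M1"]) (use A in1 in auto)
  show "x \<in> darts M2 \<Longrightarrow> orbit (rot (disj_union M1 M2)) x = orbit (rot M2) x"
    by (rule orbit_cong0[of _ "darts M2"]) (use A in2 in auto)
  show "x \<in> darts M1 \<Longrightarrow> orbit (rot (disj_union M1 M2) \<circ> opp (disj_union M1 M2)) x = orbit (rot M1 \<circ> opp M1) x"
    by (rule orbit_cong0[of _ "darts M1"]) (use A in1 in auto)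
  show "x \<in> darts M2 \<Longrightarrow> orbit (rot (disj_union M1 M2) \<circ> opp (disj_union M1 M2)) x = orbit (rot M2 \<circ> opp M2) x"
    by (rule orbit_cong0[of _ "darts M2"]) (use A in2 in auto)
qed

lemma vertices_disj_union:
  "vertices (disj_union M1 M2) = vertices M1 \<union> vertices M2" "vertices M1 \<inter> vertices M2 = {}"
proof -
  show "vertices (disj_union M1 M2) = vertices M1 \<union> vertices M2"
    unfolding vertices_orbits orbits_def disj_union_simps image_Un
    by (intro arg_cong2[of _ _ _ _ "(\<union>)"] image_cong refl orbit_disj_union(1,2))
  show "vertices M1 \<inter> vertices M2 = {}"
    unfolding vertices_orbits by (rule orbits_disjoint[OF rooted_map_facts(4)[OF M1]
        rooted_map_facts(4)[OF M2] disj])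
qed

lemma card_faces_disj_union: "card (faces (disj_union M1 M2)) = card (faces M1) + card (faces M2)"
proof -
  have "faces (disj_union M1 M2) = faces M1 \<union> faces M2"
    unfolding faces_orbits orbits_def disj_union_simps image_Un
    by (intro arg_cong2[of _ _ _ _ "(\<union>)"] image_cong refl orbit_disj_union(3,4))
  moreover have "faces M1 \<inter> faces M2 = {}"
    unfolding faces_orbits
    by (rule orbits_disjoint[OF premap_comp_permutes[OF rooted_map_facts(1)[OF M1]]
          premap_comp_permutes[OF rooted_map_facts(1)[OF M2]] disj])
  ultimately show ?thesis
    using rooted_map_facts(2)[OF M1] rooted_map_facts(2)[OF M2]
    by (simp add: card_Un_disjoint faces_orbits)
qed

lemma root_orbits_disj_union:
  "arrow M2 \<notin> orbit (rot (disj_union M1 M2)) (arrow M1)"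
  "orbit (rot (disj_union M1 M2)) (arrow M1) = root_vertex M1"
  "orbit (rot (disj_union M1 M2)) (arrow M2) = root_vertex M2"
  using orbit_disj_union rooted_map_facts(3,4)[OF M1] rooted_map_facts(3)[OF M2] disj
    orbit_in[OF rooted_map_facts(4)[OF M1], of "arrow M1"]
  by (auto simp: root_vertex_def vertex_of_def)

end

text \<open>The question is whether the component of the arrow is everything. If so, l can be
  deleted from its vertex; if not, the remaining darts form the component of l, with l as its
  arrow.\<close>

lemma legged_cases:
  assumes N: "legged N l"
  obtains (leg) M q where "rooted_map M" "l \<notin> darts M" "q \<in> darts M" "N = add_leg q l M"
  | (union) M1 M2 where "rooted_map M1" "rooted_map M2" "darts M1 \<inter> darts M2 = {}"
      "l = arrow M2" "N = disj_union M1 M2"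
proof (cases "\<forall>S. dart_closed N S \<longrightarrow> arrow N \<in> S \<longrightarrow> S = darts N")
  case True
  have pre: "premap N" and lN: "l \<in> darts N" and lo: "l \<noteq> arrow N"
    and fixd: "{x \<in> darts N. opp N x = x} = {arrow N, l}" using N by (auto simp: legged_def)
  have fin: "finite (darts N)" and o: "arrow N \<in> darts N" and r: "rot N permutes darts N"
    and p: "opp N permutes darts N" and inv: "\<And>x. opp N (opp N x) = x"
    using pre by (auto simp: premap_def)
  have pl: "opp N l = l" using fixd by blast
  define q where "q = inv (rot N) l"
  have rq: "rot N q = l" using permutes_surj[OF r] by (simp add: q_def surj_f_inv_f)
  have qN: "q \<in> darts N" using r lN rq by (metis permutes_in_image)
  \<comment> \<open>Were l alone at its vertex, \<open>{l}\<close> would be a component without the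
    arrow.\<close>
  have ql: "q \<noteq> l"
  proof
    assume "q = l"
    then have "dart_closed N {l}" using rq lN pl by (auto simp: dart_closed_def)
    then have "dart_closed N (darts N - {l})" by (rule dart_closed_Diff[OF pre])
    then have "darts N - {l} = darts N" using True[rule_format, of "darts N - {l}"] o lo by blast
    then show False using lN by blast
  qed
  define M where "M = \<lparr>darts = darts N - {l}, rot = rot N \<circ> transpose l q, opp = opp N, arrow = arrow N\<rparr>"
  have red: "f permutes (darts N - {l})" if "f permutes darts N" "f l = l" for f :: "'a \<Rightarrow> 'a"
    by (rule permutes_superset[OF that(1)]) (use that(2) in auto)
  have "rooted_map M"
    unfolding rooted_map_iff
  proof (intro conjI allI impI)
    show "premap M"
      using fin o lo inv red[OF p pl] red[OF permutes_comp_transpose[OF r lN qN]] rq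
      by (auto simp: premap_def M_def)
    have "opp N x = x \<longleftrightarrow> x = arrow N" if "x \<in> darts N - {l}" for x
    proof -
      have "x \<in> {x \<in> darts N. opp N x = x} \<longleftrightarrow> x \<in> {arrow N, l}" by (simp only: fixd)
      then show ?thesis using that by simp
    qed
    then show "{x \<in> darts M. opp M x = x} = {arrow M}" using o lo by (auto simp: M_def)
    fix S assume S: "dart_closed M S" "arrow M \<in> S"
    have sub: "S \<subseteq> darts N - {l}" using S by (auto simp: dart_closed_def M_def)
    have r': "(rot N \<circ> transpose l q) x \<in> S" "opp N x \<in> S" if "x \<in> S" for x
      using S that by (auto simp: dart_closed_def M_def)
    show "S = darts M"
    proof (cases "q \<in> S")
      case True
      have "dart_closed N (insert l S)"
      proof (rule dart_closedI)
        show "insert l S \<subseteq> darts N" using sub lN by auto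
        fix x assume x: "x \<in> insert l S"
        show "rot N x \<in> insert l S"
          using x r'(1)[of x] r'(1)[OF True] rq by (cases "x = l"; cases "x = q") auto
        show "opp N x \<in> insert l S" using x r'(2)[of x] pl by auto
      qed
      then have "insert l S = darts N"
        using \<open>\<forall>S. dart_closed N S \<longrightarrow> arrow N \<in> S \<longrightarrow> S = darts N\<close> S(2) by (auto simp: M_def)
      then show ?thesis using sub by (auto simp: M_def)
    next
      case False
      have "dart_closed N S"
      proof (rule dart_closedI)
        show "S \<subseteq> darts N" using sub by auto
        fix x assume x: "x \<in> S"
        then show "rot N x \<in> S" using r'(1)[of x] False sub by (cases "x = l"; cases "x = q") auto
        show "opp N x \<in> S" using x r'(2) by auto
      qed
      then have "S = darts N"
        using \<open>\<forall>S. dart_closed N S \<longrightarrow> arrow N \<in> S \<longrightarrow> S = darts N\<close> S(2) by (auto simp: M_def)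
      then show ?thesis using sub lN by auto
    qed
  qed
  then show ?thesis
  proof (rule leg)
    show "l \<notin> darts M" by (simp add: M_def)
    show "q \<in> darts M" using ql qN by (simp add: M_def)
    show "N = add_leg q l M"
      by (rule rmap.equality) (use lN in \<open>auto simp: M_def comp_assoc\<close>)
  qed
next
  case False
  then obtain S where S: "dart_closed N S" "arrow N \<in> S" "S \<noteq> darts N" by blast
  have pre: "premap N" and lN: "l \<in> darts N" and lo: "l \<noteq> arrow N"
    and fixd: "{x \<in> darts N. opp N x = x} = {arrow N, l}"
    and conn: "\<And>S. dart_closed N S \<Longrightarrow> arrow N \<in> S \<Longrightarrow> l \<in> S \<Longrightarrow> S = darts N"
    using N by (auto simp: legged_def)
  have fin: "finite (darts N)" and o: "arrow N \<in> darts N" and r: "rot N permutes darts N"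
    and p: "opp N permutes darts N" and inv: "\<And>x. opp N (opp N x) = x"
    using pre by (auto simp: premap_def)
  have fixd': "opp N x = x \<longleftrightarrow> x = arrow N \<or> x = l" if "x \<in> darts N" for x
  proof -
    have "x \<in> {x \<in> darts N. opp N x = x} \<longleftrightarrow> x \<in> {arrow N, l}" by (simp only: fixd)
    then show ?thesis using that by simp
  qed
  have lS: "l \<notin> S" using conn S by blast
  have sub: "S \<subseteq> darts N" using S(1) by (simp add: dart_closed_def)
  \<comment> \<open>Restriction to an invariant set, with the identity outside as
    \<open>permutes\<close> demands.\<close>
  define part where "part = (\<lambda>T a. \<lparr>darts = T, rot = (\<lambda>x. if x \<in> T then rot N x else x),
    opp = (\<lambda>x. if x \<in> T then opp N x else x), arrow = a\<rparr>)"
  have part_perm: "(\<lambda>x. if x \<in> T then f x else x) permutes T"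
    if "f permutes darts N" "T \<subseteq> darts N" "\<And>x. x \<in> T \<Longrightarrow> f x \<in> T" for f :: "'a \<Rightarrow> 'a" and T
  proof (rule bij_imp_permutes)
    have "inj_on f T" using that(1) by (meson permutes_inj inj_on_subset subset_UNIV)
    moreover have "f ` T = T"
      using that(2,3) fin \<open>inj_on f T\<close> by (intro endo_inj_surj) (auto intro: finite_subset)
    ultimately have "bij_betw f T T" by (simp add: bij_betw_def)
    then show "bij_betw (\<lambda>x. if x \<in> T then f x else x) T T" by (simp cong: bij_betw_cong)
  qed auto
  have rooted: "rooted_map (part T a)"
    if T: "dart_closed N T" "a \<in> T" "{x \<in> T. opp N x = x} = {a}"
      and c: "\<And>S'. dart_closed N S' \<Longrightarrow> S' \<subseteq> T \<Longrightarrow> a \<in> S' \<Longrightarrow> S' = T" for T a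
  proof -
    have T': "T \<subseteq> darts N" "\<And>x. x \<in> T \<Longrightarrow> rot N x \<in> T" "\<And>x. x \<in> T \<Longrightarrow> opp N x \<in> T"
      using T(1) by (auto simp: dart_closed_def)
    have ap: "rot (part T a) x = rot N x" "opp (part T a) x = opp N x" if "x \<in> T" for x
      using that by (simp_all add: part_def)
    have da: "darts (part T a) = T" "arrow (part T a) = a" by (simp_all add: part_def)
    show ?thesis
      unfolding rooted_map_iff
    proof (intro conjI allI impI)
      show "premap (part T a)"
        using part_perm[OF r T'(1,2)] part_perm[OF p T'(1,3)] T(2) T' fin inv
        by (auto simp: premap_def part_def intro: finite_subset)
      have "{x \<in> T. opp (part T a) x = x} = {x \<in> T. opp N x = x}" using ap by auto
      then show "{x \<in> darts (part T a). opp (part T a) x = x} = {arrow (part T a)}"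
        using T(3) by (simp add: da)
      fix S' assume S': "dart_closed (part T a) S'" "arrow (part T a) \<in> S'"
      have sub': "S' \<subseteq> T" using S'(1) by (simp add: dart_closed_def da)
      have "dart_closed N S'"
        using S'(1) sub' T'(1) ap unfolding dart_closed_def by (metis subsetD subset_trans)
      then show "S' = darts (part T a)" using c[OF _ sub'] S'(2) da by simp
    qed
  qed
  have c2: "dart_closed N (darts N - S)" by (rule dart_closed_Diff[OF pre S(1)])
  have R1: "rooted_map (part S (arrow N))"
  proof (rule rooted[OF S(1,2)])
    show "{x \<in> S. opp N x = x} = {arrow N}" using fixd' sub S(2) lS by auto
    fix S' assume S': "dart_closed N S'" "S' \<subseteq> S" "arrow N \<in> S'"
    have "dart_closed N (S' \<union> (darts N - S))" using S'(1) c2 by (auto simp: dart_closed_def)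
    then have "S' \<union> (darts N - S) = darts N" using conn S'(3) lN lS by blast
    then show "S' = S" using S'(2) sub by blast
  qed
  have R2: "rooted_map (part (darts N - S) l)"
  proof (rule rooted[OF c2])
    show "l \<in> darts N - S" using lN lS by simp
    show "{x \<in> darts N - S. opp N x = x} = {l}" using fixd' lS lN S(2) by auto
    fix S' assume S': "dart_closed N S'" "S' \<subseteq> darts N - S" "l \<in> S'"
    have "dart_closed N (S \<union> S')" using S'(1) S(1) by (auto simp: dart_closed_def)
    then have "S \<union> S' = darts N" using conn S'(3) S(2) by blast
    then show "S' = darts N - S" using S'(2) by blast
  qed
  have eq: "N = disj_union (part S (arrow N)) (part (darts N - S) l)"
  proof (rule rmap.equality)
    have "rot N x = rot (disj_union (part S (arrow N)) (part (darts N - S) l)) x"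
      "opp N x = opp (disj_union (part S (arrow N)) (part (darts N - S) l)) x" for x
    proof -
      have "rot N x \<in> darts N - S" "opp N x \<in> darts N - S" if "x \<in> darts N - S"
        using c2 that by (auto simp: dart_closed_def)
      moreover have "rot N x = x" "opp N x = x" if "x \<notin> darts N"
        using r p that by (auto simp: permutes_def)
      ultimately show "rot N x = rot (disj_union (part S (arrow N)) (part (darts N - S) l)) x"
        "opp N x = opp (disj_union (part S (arrow N)) (part (darts N - S) l)) x"
        using sub by (auto simp: disj_union_def part_def)
    qed
    then show "rot N = rot (disj_union (part S (arrow N)) (part (darts N - S) l))"
      "opp N = opp (disj_union (part S (arrow N)) (part (darts N - S) l))" by auto
  qed (use sub in \<open>auto simp: disj_union_def part_def\<close>)
  show ?thesis
    by (rule union[OF R1 R2 _ _ eq]) (auto simp: part_def)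
qed

text \<open>The genus is nonnegative. Opening the root edge keeps the faces. With one component
  left, two darts and at most one vertex are lost; with two components the bounds add up
  exactly.\<close>

lemma euler_inequality:
  assumes "rooted_map M"
  shows "2 * card (vertices M) + 2 * card (faces M) \<le> card (darts M) + 3"
  using assms
proof (induction "card (darts M)" arbitrary: M rule: less_induct)
  case less
  show ?case
  proof (cases "darts M = {arrow M}")
    case True
    then show ?thesis by (simp add: vertices_def faces_def)
  next
    case False
    then obtain N h l where N: "legged N l" and h: "h \<notin> darts N" and M: "M = close h l N"
      using rooted_map_open[OF less.prems] by metis
    note F = legged_facts[OF N h]
    have cM: "card (darts M) = Suc (card (darts N))" using h F(2) by (simp add: M)
    have fM: "card (faces M) = card (faces N)" using card_faces_close[OF N h] by (simp add: M)
    from N show ?thesis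
    proof (cases rule: legged_cases)
      case (leg M' q)
      have "card (darts N) = Suc (card (darts M'))"
        using leg rooted_map_facts(2)[OF leg(1)] by simp
      then have "2 * card (vertices M') + 2 * card (faces M') \<le> card (darts M') + 3"
        using less.hyps[OF _ leg(1)] cM by simp
      moreover have "card (vertices M) \<le> Suc (card (vertices M'))"
        using vertices_close_join(3)[OF N h] vertices_close_split(4)[OF N h] vertices_add_leg(2)[OF
            leg(1-3)] leg(4)
        by (cases "l \<in> orbit (rot N) (arrow N)") (auto simp: M)
      moreover have "card (faces N) = card (faces M')" using card_faces_add_leg[OF leg(1-3)] leg(4) by simp
      ultimately show ?thesis using cM fM \<open>card (darts N) = Suc (card (darts M'))\<close> by linarith
    next
      case (union M1 M2)
      note F1 = rooted_map_facts[OF union(1)] and F2 = rooted_map_facts[OF union(2)]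
      have cN: "card (darts N) = card (darts M1) + card (darts M2)"
        using union F1(2) F2(2) by (simp add: card_Un_disjoint)
      have "2 * card (vertices M1) + 2 * card (faces M1) \<le> card (darts M1) + 3"
        "2 * card (vertices M2) + 2 * card (faces M2) \<le> card (darts M2) + 3"
        using less.hyps[OF _ union(1)] less.hyps[OF _ union(2)] cM cN by simp_all
      moreover have "Suc (card (vertices M)) = card (vertices M1) + card (vertices M2)"
        using vertices_close_join(3)[OF N h] root_orbits_disj_union(1)[OF union(1-3)] union(4,5)
          vertices_disj_union[OF union(1-3)] F1(2) F2(2)
        by (simp add: M card_Un_disjoint vertices_orbits)
      moreover have "card (faces N) = card (faces M1) + card (faces M2)"
        using card_faces_disj_union[OF union(1-3)] union(5) by simp
      ultimately show ?thesis using cM cN fM by linarith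
    qed
  qed
qed

section \<open>Every planar map has a code, and every valid code a map\<close>

section \<open>Maps of codes\<close>

lemma orbit_enum:
  assumes "f permutes A" "finite A"
  shows "inj_on (\<lambda>i. (f ^^ i) x) {..<card (orbit f x)}"
    and "orbit f x = (\<lambda>i. (f ^^ i) x) ` {..<card (orbit f x)}"
proof -
  have inj: "inj (f ^^ i)" for i using assms(1) by (simp add: permutes_inj inj_fn)
  have ex: "\<exists>n. 0 < n \<and> (f ^^ n) x = x"
    using orbit_self[OF assms, of x] by (auto simp: orbit_altdef dest: sym)
  define n where "n = (LEAST n. 0 < n \<and> (f ^^ n) x = x)"
  have n: "0 < n" "(f ^^ n) x = x" using LeastI_ex[OF ex] by (simp_all add: n_def)
  have least: "n \<le> i" if "0 < i" "(f ^^ i) x = x" for i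
    unfolding n_def using that by (intro Least_le) auto
  have orb: "orbit f x = (\<lambda>i. (f ^^ i) x) ` {..<n}"
    using orbit_altdef_bounded[OF n(2,1)] by auto
  have ne: "(f ^^ i) x \<noteq> (f ^^ j) x" if "i < j" "j < n" for i j
  proof
    assume eq: "(f ^^ i) x = (f ^^ j) x"
    have "(f ^^ j) x = (f ^^ i) ((f ^^ (j - i)) x)"
      using funpow_add[of i "j - i" f] that by simp
    then have "(f ^^ (j - i)) x = x" using eq inj[of i] by (metis injD)
    then show False using least[of "j - i"] that by simp
  qed
  have "inj_on (\<lambda>i. (f ^^ i) x) {..<n}"
    by (rule inj_onI) (metis lessThan_iff linorder_neqE_nat ne)
  moreover from this have "card (orbit f x) = n" using orb by (simp add: card_image)
  ultimately show "inj_on (\<lambda>i. (f ^^ i) x) {..<card (orbit f x)}"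
    and "orbit f x = (\<lambda>i. (f ^^ i) x) ` {..<card (orbit f x)}" using orb by simp_all
qed

text \<open>A relation, because the names of the darts are arbitrary. In \<open>Edge\<close> the leg
  is put after the k-th dart from the arrow, so that closing cuts off the darts 1 to k together with
  l.\<close>

inductive rep :: "'a rmap \<Rightarrow> code \<Rightarrow> bool" where
  Point: "rep \<lparr>darts = {a}, rot = id, opp = id, arrow = a\<rparr> Point"
| Loop: "rep M1 c1 \<Longrightarrow> rep M2 c2 \<Longrightarrow> darts M1 \<inter> darts M2 = {} \<Longrightarrow> h \<notin> darts M1 \<union> darts M2 \<Longrightarrow>
    rep (close h (arrow M2) (disj_union M1 M2)) (Loop c1 c2)"
| Edge: "rep M c \<Longrightarrow> h \<notin> darts M \<Longrightarrow> l \<notin> darts M \<Longrightarrow> h \<noteq> l \<Longrightarrow> k \<le> root_deg c \<Longrightarrow>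
    rep (close h l (add_leg ((rot M ^^ k) (arrow M)) l M)) (Edge k c)"

lemma funpow_in_darts:
  assumes "rooted_map M"
  shows "(rot M ^^ k) (arrow M) \<in> darts M"
  using rooted_map_facts(3,4)[OF assms] by (induction k) (auto simp: permutes_in_image)

lemma rep_rooted: "rep M c \<Longrightarrow> rooted_map M"
proof (induction rule: rep.induct)
  case (Point a)
  have "S = {a}" if "S \<subseteq> {a}" "a \<in> S" for S using that by auto
  then show ?case by (auto simp: rooted_map_iff premap_def dart_closed_def permutes_def)
next
  case (Loop M1 c1 M2 c2 h)
  then show ?case by (intro rooted_close legged_disj_union) auto
next
  case (Edge M c h l k)
  then show ?case by (intro rooted_close legged_add_leg funpow_in_darts) auto
qed

text \<open>The cycle leads from l to the first dart after the arrow, on to the k-th, after which l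
  was inserted, and back. For \<open>k = 0\<close> the dart l is its own successor, which makes a
  leaf.\<close>

lemma new_vertex:
  fixes M :: "'a rmap" and k :: nat and h l :: 'a
  assumes M: "rooted_map M" and h: "h \<notin> darts M" "h \<noteq> l" and l: "l \<notin> darts M"
    and k: "k < card (root_vertex M)"
  defines "q \<equiv> (rot M ^^ k) (arrow M)"
  shows "vertex_of (close h l (add_leg q l M)) l = insert l ((\<lambda>i. (rot M ^^ i) (arrow M)) ` {1..k})"
    and "card (vertex_of (close h l (add_leg q l M)) l) = Suc k"
proof -
  note F = rooted_map_facts[OF M]
  let ?N = "add_leg q l M"
  let ?C = "close h l ?N"
  let ?p = "\<lambda>i. (rot M ^^ i) (arrow M)"
  have q: "q \<in> darts M" unfolding q_def using M by (rule funpow_in_darts)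
  have pd: "?p i \<in> darts M" for i using M by (rule funpow_in_darts)
  note L = legged_add_leg[OF M l q]
  have hN: "h \<notin> darts ?N" using h by simp
  have inj: "inj_on ?p {..<card (root_vertex M)}"
    using orbit_enum(1)[OF F(4,2), of "arrow M"] by (simp add: root_vertex_def vertex_of_def)
  have inj': "?p i = ?p j \<longleftrightarrow> i = j" if "i \<le> k" "j \<le> k" for i j
    using inj_on_eq_iff[OF inj] that k by simp
  have step: "rot ?C (?p i) = ?p (Suc i)" if "1 \<le> i" "i < k" for i
  proof -
    have "?p i \<noteq> arrow M" using inj'[of i 0] that by simp
    moreover have "?p i \<noteq> q" using inj'[of i k] that by (simp add: q_def)
    moreover have "?p i \<noteq> h" "?p i \<noteq> l" using pd[of i] h l by auto
    ultimately show ?thesis using rot_close(4)[OF L hN, of "?p i"] by simp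
  qed
  have last: "rot ?C (?p k) = l" if "1 \<le> k"
  proof -
    have "?p k \<noteq> arrow M" using inj'[of k 0] that by simp
    moreover have "?p k \<noteq> h" "?p k \<noteq> l" using pd[of k] h l by auto
    moreover have "rot M l = l" using F(4) l by (simp add: permutes_def)
    ultimately show ?thesis using rot_close(4)[OF L hN, of "?p k"] by (simp add: q_def)
  qed
  have first: "rot ?C l = (if k = 0 then l else ?p 1)"
  proof (cases "k = 0")
    case True
    then show ?thesis using rot_close(3)[OF L hN] F(4) l by (simp add: q_def permutes_def)
  next
    case False
    then have "arrow M \<noteq> q" using inj'[of 0 k] by (simp add: q_def)
    moreover have "arrow M \<noteq> l" using F(3) l by auto
    ultimately show ?thesis using rot_close(3)[OF L hN] False by simp
  qed
  let ?S = "insert l (?p ` {1..k})"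
  have "orbit (rot ?C) l \<subseteq> ?S"
  proof (rule orbit_subset_closed)
    fix y assume "y \<in> ?S"
    then consider "y = l" | i where "1 \<le> i" "i \<le> k" "y = ?p i" by auto
    then show "rot ?C y \<in> ?S"
    proof cases
      case 1
      then show ?thesis using first by (auto intro!: image_eqI[of _ _ 1])
    next
      case 2
      show ?thesis
      proof (cases "i = k")
        case True
        then show ?thesis using 2 last by simp
      next
        case False
        then have "rot ?C y = ?p (Suc i)" "Suc i \<in> {1..k}" using 2 step by simp_all
        then show ?thesis by blast
      qed
    qed
  qed simp
  moreover have "?p i \<in> orbit (rot ?C) l" if "1 \<le> i" "i \<le> k" for i
    using that
  proof (induction i rule: nat_induct_at_least)
    case base
    then show ?case using orbit.base[of "rot ?C" l] first by simp
  next
    case (Suc i)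
    then show ?case using orbit.step[of "?p i" "rot ?C" l] step[of i] by simp
  qed
  moreover have "l \<in> orbit (rot ?C) l"
    using rooted_map_facts(2,4)[OF rooted_close[OF L hN]] by (intro orbit_self)
  ultimately show w: "vertex_of ?C l = ?S"
    unfolding vertex_of_def by (intro equalityI) auto
  have "l \<notin> ?p ` {1..k}" using pd l by auto
  moreover have "inj_on ?p {1..k}" using inj' by (auto intro: inj_onI)
  ultimately show "card (vertex_of ?C l) = Suc k" unfolding w by (simp add: card_image)
qed

definition other_vertices :: "'a rmap \<Rightarrow> 'a set set" where
  "other_vertices M = vertices M - {root_vertex M}"

lemma root_vertex_in: "rooted_map M \<Longrightarrow> root_vertex M \<in> vertices M"
  using rooted_map_facts(3) by (auto simp: root_vertex_def vertices_def)

lemma vertex_subset: "rooted_map M \<Longrightarrow> v \<in> vertices M \<Longrightarrow> v \<subseteq> darts M"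
  using orbit_in[OF rooted_map_facts(4)] by (fastforce simp: vertices_def vertex_of_def)

lemma finite_vertices: "rooted_map M \<Longrightarrow> finite (vertices M)"
  by (simp add: vertices_def rooted_map_facts(2))

lemma close_add_leg_stats:
  fixes M :: "'a rmap" and k :: nat and h l :: 'a
  assumes M: "rooted_map M" and h: "h \<notin> darts M" "h \<noteq> l" and l: "l \<notin> darts M"
    and k: "k < card (root_vertex M)"
  defines "C \<equiv> close h l (add_leg ((rot M ^^ k) (arrow M)) l M)"
  shows "card (root_vertex C) = Suc (card (root_vertex M) - k)"
    and "other_vertices C = insert (vertex_of C l) (other_vertices M)"
    and "vertex_of C l \<notin> other_vertices M"
proof -
  note F = rooted_map_facts[OF M]
  define q where "q = (rot M ^^ k) (arrow M)"
  let ?N = "add_leg q l M"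
  have C: "C = close h l ?N" by (simp add: C_def q_def)
  have q: "q \<in> darts M" unfolding q_def using M by (rule funpow_in_darts)
  note L = legged_add_leg[OF M l q]
  have hN: "h \<notin> darts ?N" using h by simp
  have rv: "root_vertex M = orbit (rot M) (arrow M)" by (simp add: root_vertex_def vertex_of_def)
  have qo: "q \<in> orbit (rot M) (arrow M)"
    using funpow_in_orbit[OF orbit_self[OF F(4,2)]] by (simp add: q_def)
  have oq: "orbit (rot M) q = root_vertex M" unfolding rv by (rule orbit_eq[OF F(4,2) qo])
  have oN: "orbit (rot ?N) (arrow ?N) = insert l (root_vertex M)"
    using vertices_add_leg(3)[OF M l q F(3)] qo by (simp add: rv)
  note S = vertices_close_split[OF L hN, folded C, unfolded oN]
  have w: "card (vertex_of C l) = Suc k" using new_vertex(2)[OF M h l k] by (simp add: C_def)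
  have fr: "finite (root_vertex M)" using vertex_subset[OF M root_vertex_in[OF M]] F(2) finite_subset by blast
  have rd: "root_vertex M \<subseteq> darts M" using M by (intro vertex_subset root_vertex_in)
  have un: "root_vertex C \<union> vertex_of C l = insert h (insert l (root_vertex M))"
    and dis: "root_vertex C \<inter> vertex_of C l = {}"
    and V: "vertices C = insert (root_vertex C) (insert (vertex_of C l) (vertices ?N - {insert l
        (root_vertex M)}))"
    using S by auto
  have "finite (root_vertex C \<union> vertex_of C l)" unfolding un using fr by simp
  \<comment> \<open>The two pieces together form the old root vertex enlarged by h and l; the known
    size of one gives that of the other.\<close>
  then have "card (root_vertex C) + card (vertex_of C l) = card (root_vertex C \<union> vertex_of C l)"
    using dis by (simp add: card_Un_disjoint)
  also have "\<dots> = Suc (Suc (card (root_vertex M)))"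
    unfolding un using h l rd fr by (subst card_insert_disjoint; auto)+
  finally show "card (root_vertex C) = Suc (card (root_vertex M) - k)" using w k by simp
  have lin: "l \<in> vertex_of C l" "h \<in> root_vertex C"
  proof -
    note FC = rooted_map_facts[OF rooted_close[OF L hN], folded C]
    show "l \<in> vertex_of C l" unfolding vertex_of_def by (rule orbit_self[OF FC(4,2)])
    show "h \<in> root_vertex C"
      using orbit.base[of "rot C" "arrow C"] rot_close(1)[OF L hN]
          by (simp add: root_vertex_def vertex_of_def C)
  qed
  have nin: "v \<in> vertices M \<Longrightarrow> l \<notin> v \<and> h \<notin> v" for v using vertex_subset[OF M, of v] l h by auto
  have "vertices ?N - {insert l (root_vertex M)} = other_vertices M"
    using vertices_add_leg(1)[OF M l q] nin by (auto simp: oq other_vertices_def)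
  then have V': "vertices C = insert (root_vertex C) (insert (vertex_of C l) (other_vertices M))"
      using V by simp
  show "vertex_of C l \<notin> other_vertices M" using nin lin by (auto simp: other_vertices_def)
  have "root_vertex C \<notin> insert (vertex_of C l) (other_vertices M)"
    using nin lin dis by (auto simp: other_vertices_def)
  then show "other_vertices C = insert (vertex_of C l) (other_vertices M)"
    using V' by (simp add: other_vertices_def)
qed

text \<open>A root vertex contains its arrow, so its size exceeds its degree by 1. The arrow of
  \<open>M2\<close>, now a half-edge, and the new dart h account for the degree
  \<open>d1 + d2 + 2\<close>.\<close>

lemma close_disj_union_stats:
  fixes M1 M2 :: "'a rmap"
  assumes M: "rooted_map M1" "rooted_map M2" "darts M1 \<inter> darts M2 = {}" and h: "h \<notin> darts M1 \<union> darts M2"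
  defines "C \<equiv> close h (arrow M2) (disj_union M1 M2)"
  shows "card (root_vertex C) = Suc (card (root_vertex M1) + card (root_vertex M2))"
    and "other_vertices C = other_vertices M1 \<union> other_vertices M2"
    and "other_vertices M1 \<inter> other_vertices M2 = {}"
proof -
  note L = legged_disj_union[OF M]
  have hN: "h \<notin> darts (disj_union M1 M2)" using h by simp
  note R = root_orbits_disj_union[OF M]
  note J = vertices_close_join[OF L hN, folded C_def, unfolded disj_union_simps R(2,3), OF R(1)[unfolded R(2)]]
  have sub: "root_vertex M1 \<subseteq> darts M1" "root_vertex M2 \<subseteq> darts M2"
    using vertex_subset[OF M(1) root_vertex_in[OF M(1)]] vertex_subset[OF M(2) root_vertex_in[OF M(2)]]
        by simp_all
  have fin: "finite (root_vertex M1)" "finite (root_vertex M2)"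
    using sub rooted_map_facts(2)[OF M(1)] rooted_map_facts(2)[OF M(2)] finite_subset by blast+
  have "root_vertex M1 \<inter> root_vertex M2 = {}" "h \<notin> root_vertex M1 \<union> root_vertex M2" using sub M(3) h by auto
  then show "card (root_vertex C) = Suc (card (root_vertex M1) + card (root_vertex M2))"
    unfolding J(1) using fin by (simp add: card_Un_disjoint)
  have d: "vertices M1 \<inter> vertices M2 = {}" using vertices_disj_union(2)[OF M] .
  then show "other_vertices M1 \<inter> other_vertices M2 = {}" by (auto simp: other_vertices_def)
  have "v \<in> vertices M1 \<union> vertices M2 \<Longrightarrow> h \<notin> v" for v
    using vertex_subset[OF M(1), of v] vertex_subset[OF M(2), of v] h by auto
  then have "insert h (root_vertex M1 \<union> root_vertex M2) \<notin> vertices M1 \<union> vertices M2" by blast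
  then show "other_vertices C = other_vertices M1 \<union> other_vertices M2"
    using J(2) d root_vertex_in[OF M(1)] root_vertex_in[OF M(2)]
    unfolding other_vertices_def J(1) vertices_disj_union(1)[OF M] by auto
qed

lemma rep_stats:
  assumes "rep M c"
  shows "valid c \<and> card (darts M) = 2 * nedges c + 1 \<and> card (faces M) = Suc (nloops c) \<and>
    card (root_vertex M) = Suc (root_deg c) \<and>
    (\<forall>P. card {v \<in> other_vertices M. P (card v)} = nverts P c)"
  using assms
proof (induction rule: rep.induct)
  case (Point a)
  have "orbit id a = {a}" by (rule orbit_fixed) simp
  then show ?case
    by (auto simp: faces_def face_of_def other_vertices_def vertices_def root_vertex_def vertex_of_def)
next
  case (Loop M1 c1 M2 c2 h)
  note M = rep_rooted[OF Loop.hyps(1)] rep_rooted[OF Loop.hyps(2)] Loop.hyps(3)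
  note St = close_disj_union_stats[OF M Loop.hyps(4)]
  have hN: "h \<notin> darts (disj_union M1 M2)" using Loop.hyps(4) by simp
  have fin: "finite (other_vertices M1)" "finite (other_vertices M2)"
    using finite_vertices M by (auto simp: other_vertices_def)
  let ?C = "close h (arrow M2) (disj_union M1 M2)"
  have "card {v \<in> other_vertices ?C. P (card v)} = nverts P c1 + nverts P c2" for P
  proof -
    have "{v \<in> other_vertices ?C. P (card v)} =
        {v \<in> other_vertices M1. P (card v)} \<union> {v \<in> other_vertices M2. P (card v)}"
      using St(2) by auto
    moreover have "{v \<in> other_vertices M1. P (card v)} \<inter> {v \<in> other_vertices M2. P (card v)} = {}"
      using St(3) by auto
    ultimately show ?thesis using Loop.IH fin by (simp add: card_Un_disjoint)
  qed
  moreover have "card (darts ?C) = 2 * nedges (Loop c1 c2) + 1"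
    using Loop.IH Loop.hyps(3,4) rooted_map_facts(2)[OF M(1)] rooted_map_facts(2)[OF M(2)]
    by (simp add: card_Un_disjoint)
  moreover have "card (faces ?C) = Suc (nloops (Loop c1 c2))"
    using card_faces_close[OF legged_disj_union[OF M] hN] card_faces_disj_union[OF M] Loop.IH by simp
  ultimately show ?case using St(1) Loop.IH by simp
next
  case (Edge M c h l k)
  note M = rep_rooted[OF Edge.hyps(1)]
  have k: "k < card (root_vertex M)" using Edge by simp
  note St = close_add_leg_stats[OF M Edge.hyps(2,4,3) k]
  note w = new_vertex(2)[OF M Edge.hyps(2,4,3) k]
  define q where "q = (rot M ^^ k) (arrow M)"
  let ?C = "close h l (add_leg q l M)"
  have q: "q \<in> darts M" unfolding q_def using M by (rule funpow_in_darts)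
  note L = legged_add_leg[OF M Edge.hyps(3) q]
  have hN: "h \<notin> darts (add_leg q l M)" using Edge.hyps by simp
  have fin: "finite (other_vertices M)"
    using finite_vertices[OF M] by (auto simp: other_vertices_def)
  have "card {v \<in> other_vertices ?C. P (card v)} = nverts P (Edge k c)" for P
  proof -
    have "{v \<in> other_vertices ?C. P (card v)} = (if P (Suc k) then {vertex_of ?C l} else {}) \<union>
        {v \<in> other_vertices M. P (card v)}"
      using St(2) w by (auto simp: q_def)
    then show ?thesis using Edge.IH fin St(3) by (simp add: q_def)
  qed
  moreover have "card (darts ?C) = 2 * nedges (Edge k c) + 1"
    using Edge.IH Edge.hyps(2,3,4) rooted_map_facts(2)[OF M] by simp
  moreover have "card (faces ?C) = Suc (nloops (Edge k c))"
    using card_faces_close[OF L hN] card_faces_add_leg[OF M Edge.hyps(3) q] Edge.IH by simp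
  moreover have "card (root_vertex ?C) = Suc (root_deg (Edge k c))"
    using St(1) Edge.IH Edge.hyps(5) by (simp add: q_def Suc_diff_le)
  ultimately show ?case using Edge.IH Edge.hyps(5) by (simp add: q_def)
qed

lemma card_vertices_other: "rooted_map M \<Longrightarrow> card (vertices M) = Suc (card (other_vertices M))"
  unfolding other_vertices_def by (intro card.remove root_vertex_in finite_vertices)

lemma rep_planar:
  assumes "rep M c"
  shows "planar_map M"
proof -
  have "card (other_vertices M) = nverts (\<lambda>_. True) c"
    using rep_stats[OF assms] by (auto dest: spec[of _ "\<lambda>_. True"])
  then show ?thesis
    using rep_stats[OF assms] rep_rooted[OF assms] card_vertices_other[OF rep_rooted[OF assms]] nedges_eq[of c]
    by (simp add: planar_map_iff)
qed

text \<open>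
  In the planar case equality holds in Euler's inequality, also for the smaller maps. This excludes a
  loop at the root such that splitting the root vertex there leaves the map connected.
\<close>

lemma planar_rep:
  assumes "planar_map M"
  shows "\<exists>c. rep M c"
  using assms
proof (induction "card (darts M)" arbitrary: M rule: less_induct)
  case less
  have M: "rooted_map M" and eq: "2 * card (vertices M) + 2 * card (faces M) = card (darts M) + 3"
    using less.prems by (auto simp: planar_map_iff)
  show ?case
  proof (cases "darts M = {arrow M}")
    case True
    then have "rot M = id" "opp M = id" using rooted_map_facts(4,5)[OF M] by (auto simp: permutes_sing)
    then have "M = \<lparr>darts = {arrow M}, rot = id, opp = id, arrow = arrow M\<rparr>"
      using True by (auto intro: rmap.equality)
    then show ?thesis using rep.Point by metis
  next
    case False
    then obtain N h l where N: "legged N l" and h: "h \<notin> darts N" and M_eq: "M = close h l N"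
      using rooted_map_open[OF M] by metis
    note F = legged_facts[OF N h]
    have cM: "card (darts M) = Suc (card (darts N))" using h F(2) by (simp add: M_eq)
    have fM: "card (faces M) = card (faces N)" using card_faces_close[OF N h] by (simp add: M_eq)
    from N show ?thesis
    proof (cases rule: legged_cases)
      case (leg M' q)
      note F' = rooted_map_facts[OF leg(1)]
      have cN: "card (darts N) = Suc (card (darts M'))" using leg F'(2) by simp
      have fN: "card (faces N) = card (faces M')" using card_faces_add_leg[OF leg(1-3)] leg(4) by simp
      have vN: "card (vertices N) = card (vertices M')" using vertices_add_leg(2)[OF leg(1-3)] leg(4) by simp
      \<comment> \<open>Otherwise closing would merge two vertices, and \<open>M'\<close> would
        exceed Euler's bound.\<close>
      have lin: "l \<in> orbit (rot N) (arrow N)"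
      proof (rule ccontr)
        assume "l \<notin> orbit (rot N) (arrow N)"
        from vertices_close_join(3)[OF N h this] have "Suc (card (vertices M)) = card (vertices M')"
          by (simp add: M_eq vN)
        then show False using euler_inequality[OF leg(1)] eq cM cN fM fN by linarith
      qed
      have "card (vertices M) = Suc (card (vertices M'))"
        using vertices_close_split(4)[OF N h lin] by (simp add: M_eq vN)
      then have "planar_map M'" using leg(1) eq cM cN fM fN by (simp add: planar_map_iff)
      then have "\<exists>c. rep M' c" using cM cN by (intro less.hyps) auto
      then obtain c where c: "rep M' c" ..
      \<comment> \<open>The leg is in the cycle of the arrow only if it was inserted there, which
        yields the position k.\<close>
      have "q \<in> orbit (rot M') (arrow M')"
      proof (rule ccontr)
        assume "q \<notin> orbit (rot M') (arrow M')"
        then have "orbit (rot N) (arrow N) = orbit (rot M') (arrow M')"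
          using vertices_add_leg(3)[OF leg(1-3) F'(3)] leg(4) by simp
        then show False using lin orbit_in[OF F'(4,3)] leg(2) by auto
      qed
      then obtain k where k: "k < card (root_vertex M')" "q = (rot M' ^^ k) (arrow M')"
        using orbit_enum(2)[OF F'(4,2), of "arrow M'"] by (auto simp: root_vertex_def vertex_of_def)
      have "k \<le> root_deg c" using k(1) rep_stats[OF c] by simp
      then have "rep M (Edge k c)"
        unfolding M_eq leg(4) k(2) using h leg(2,4) by (intro rep.Edge[OF c]) auto
      then show ?thesis ..
    next
      case (union M1 M2)
      note F1 = rooted_map_facts[OF union(1)] and F2 = rooted_map_facts[OF union(2)]
      have cN: "card (darts N) = card (darts M1) + card (darts M2)"
        using union F1(2) F2(2) by (simp add: card_Un_disjoint)
      have vM: "Suc (card (vertices M)) = card (vertices M1) + card (vertices M2)"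
        using vertices_close_join(3)[OF N h] root_orbits_disj_union(1)[OF union(1-3)] union(4,5)
          vertices_disj_union[OF union(1-3)] F1(2) F2(2)
        by (simp add: M_eq card_Un_disjoint vertices_orbits)
      have fN: "card (faces N) = card (faces M1) + card (faces M2)"
        using card_faces_disj_union[OF union(1-3)] union(5) by simp
      \<comment> \<open>The two Euler bounds add up to the equality for M, so both are
        attained.\<close>
      have "planar_map M1" "planar_map M2"
        using euler_inequality[OF union(1)] euler_inequality[OF union(2)] union(1,2) eq cM cN fM vM fN
        by (simp_all add: planar_map_iff)
      then have "\<exists>c. rep M1 c" "\<exists>c. rep M2 c" using cM cN by (auto intro!: less.hyps)
      then obtain c1 c2 where "rep M1 c1" "rep M2 c2" by blast
      then have "rep M (Loop c1 c2)"
        unfolding M_eq union(5,4) using h union(3,5) by (intro rep.Loop) auto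
      then show ?thesis ..
    qed
  qed
qed

text \<open>The forbidden set X keeps darts fresh in the induction, in particular the two maps at a
  loop disjoint.\<close>

lemma exists_rep:
  assumes "valid c" "finite X"
  shows "\<exists>M :: nat rmap. rep M c \<and> darts M \<inter> X = {}"
  using assms
proof (induction c arbitrary: X)
  case Point
  from ex_new_if_finite[OF infinite_UNIV_nat Point(2)] obtain a where "a \<notin> X" by blast
  then show ?case using rep.Point[of a] by (intro exI[of _ "\<lparr>darts = {a}, rot = id, opp = id, arrow = a\<rparr>"]) auto
next
  case (Loop c1 c2)
  obtain M1 :: "nat rmap" where M1: "rep M1 c1" "darts M1 \<inter> X = {}"
    using Loop.IH(1)[of X] Loop.prems by auto
  have f1: "finite (X \<union> darts M1)" using rooted_map_facts(2)[OF rep_rooted[OF M1(1)]] Loop.prems by simp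
  obtain M2 where M2: "rep M2 c2" "darts M2 \<inter> (X \<union> darts M1) = {}"
    using Loop.IH(2)[of "X \<union> darts M1"] Loop.prems f1 by auto
  have "finite (X \<union> darts M1 \<union> darts M2)" using rooted_map_facts(2)[OF rep_rooted[OF M2(1)]] f1 by simp
  from ex_new_if_finite[OF infinite_UNIV_nat this] obtain h where h: "h \<notin> X \<union> darts M1 \<union> darts M2" by blast
  have "rep (close h (arrow M2) (disj_union M1 M2)) (Loop c1 c2)" using M1 M2 h by (intro rep.Loop) auto
  moreover have "darts (close h (arrow M2) (disj_union M1 M2)) \<inter> X = {}" using M1(2) M2(2) h by auto
  ultimately show ?case by blast
next
  case (Edge k c)
  obtain M :: "nat rmap" where M: "rep M c" "darts M \<inter> X = {}"
    using Edge.IH[of X] Edge.prems by auto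
  have f: "finite (X \<union> darts M)" using rooted_map_facts(2)[OF rep_rooted[OF M(1)]] Edge.prems by simp
  from ex_new_if_finite[OF infinite_UNIV_nat this] obtain h where h: "h \<notin> X \<union> darts M" by blast
  have "finite (insert h (X \<union> darts M))" using f by simp
  from ex_new_if_finite[OF infinite_UNIV_nat this] obtain l where l: "l \<notin> insert h (X \<union> darts M)" by blast
  let ?M = "close h l (add_leg ((rot M ^^ k) (arrow M)) l M)"
  have "rep ?M (Edge k c)" using M h l Edge.prems by (intro rep.Edge) auto
  moreover have "darts ?M \<inter> X = {}" using M(2) h l by auto
  ultimately show ?case by blast
qed

section \<open>Rigidity of rooted maps, and codes as complete invariants\<close>

section \<open>Isomorphisms\<close>

lemma map_isoD:
  assumes "map_iso g M N"
  shows "bij_betw g (darts M) (darts N)" "g (arrow M) = arrow N"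
    "\<And>x. x \<in> darts M \<Longrightarrow> g (rot M x) = rot N (g x)" "\<And>x. x \<in> darts M \<Longrightarrow> g (opp M x) = opp N (g x)"
    "inj_on g (darts M)" "g ` darts M = darts N" "\<And>x. x \<in> darts M \<Longrightarrow> g x \<in> darts N"
  using assms by (auto simp: map_iso_def bij_betw_def)

lemma premap_facts:
  assumes "premap M"
  shows "finite (darts M)" "arrow M \<in> darts M" "rot M permutes darts M" "opp M permutes darts M"
    "\<And>x. rot M x \<in> darts M \<longleftrightarrow> x \<in> darts M" "\<And>x. opp M x \<in> darts M \<longleftrightarrow> x \<in> darts M"
  using assms by (auto simp: premap_def permutes_in_image)

lemma map_iso_trans:
  assumes "map_iso g M N" "map_iso f N K"
  shows "map_iso (f \<circ> g) M K"
  unfolding map_iso_def using map_isoD[OF assms(1)] map_isoD[OF assms(2)] 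
  by (auto intro: bij_betw_trans)

lemma map_iso_sym:
  assumes "premap M" "map_iso g M N"
  shows "map_iso (inv_into (darts M) g) N M"
proof -
  note P = premap_facts[OF assms(1)] and I = map_isoD[OF assms(2)]
  let ?f = "inv_into (darts M) g"
  have f: "?f (g x) = x" if "x \<in> darts M" for x using I(5) that by simp
  have "?f (rot N y) = rot M (?f y) \<and> ?f (opp N y) = opp M (?f y)" if y: "y \<in> darts N" for y
  proof -
    obtain x where x: "x \<in> darts M" "y = g x" using I(6) y by auto
    have "rot N y = g (rot M x)" "opp N y = g (opp M x)" using I(3,4) x by simp_all
    then show ?thesis using f P x by simp
  qed
  moreover have "?f (arrow N) = arrow M" using f[OF P(2)] I(2) by simp
  ultimately show ?thesis using bij_betw_inv_into[OF I(1)] by (simp add: map_iso_def)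
qed

lemma orbit_image:
  assumes "x \<in> A" "\<And>y. y \<in> A \<Longrightarrow> f y \<in> A" "\<And>y. y \<in> A \<Longrightarrow> g (f y) = f' (g y)"
  shows "g ` orbit f x = orbit f' (g x)"
proof -
  have sub: "orbit f x \<subseteq> A" using assms(1,2) by (rule orbit_subset_closed)
  have "g y \<in> orbit f' (g x)" if "y \<in> orbit f x" for y
    using that
  proof induction
    case base
    then show ?case using orbit.base[of f' "g x"] assms(1,3) by simp
  next
    case (step y)
    then show ?case using orbit.step[OF step.IH] assms(3)[of y] sub by auto
  qed
  moreover have "y \<in> g ` orbit f x" if "y \<in> orbit f' (g x)" for y
    using that
  proof induction
    case base
    then show ?case using orbit.base[of f x] assms(1,3) by (auto intro!: image_eqI[of _ _ "f x"])
  next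
    case (step y)
    then obtain z where "z \<in> orbit f x" "y = g z" by auto
    then show ?case using orbit.step[of z f x] assms(3)[of z] sub by (auto intro!: image_eqI[of _ _ "f z"])
  qed
  ultimately show ?thesis by auto
qed

context
  fixes M :: "'a rmap" and N :: "'b rmap" and g
  assumes M: "premap M" and g: "map_iso g M N"
begin

lemma map_iso_vertex_of: "x \<in> darts M \<Longrightarrow> g ` vertex_of M x = vertex_of N (g x)"
  unfolding vertex_of_def
  by (rule orbit_image[of _ "darts M"]) (use premap_facts[OF M] map_isoD[OF g] in auto)

lemma map_iso_face_of: "x \<in> darts M \<Longrightarrow> g ` face_of M x = face_of N (g x)"
  unfolding face_of_def
  by (rule orbit_image[of _ "darts M"]) (use premap_facts[OF M] map_isoD[OF g] in auto)

lemma map_iso_edge_of: "x \<in> darts M \<Longrightarrow> g ` edge_of M x = edge_of N (g x)"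
  using map_isoD[OF g] by (simp add: edge_of_def)

lemma map_iso_vertices: "vertices N = (`) g ` vertices M"
  unfolding vertices_def map_isoD(6)[OF g, symmetric] image_image
  by (intro image_cong refl) (simp add: map_iso_vertex_of)

lemma map_iso_faces: "faces N = (`) g ` faces M"
  unfolding faces_def map_isoD(6)[OF g, symmetric] image_image
  by (intro image_cong refl) (simp add: map_iso_face_of)

lemma map_iso_root_vertex: "root_vertex N = g ` root_vertex M"
  using map_iso_vertex_of[of "arrow M"] premap_facts(2)[OF M] map_isoD(2)[OF g] by (simp add: root_vertex_def)

lemma map_iso_inj_image: "inj_on ((`) g) (Pow (darts M))"
  using map_isoD(5)[OF g] by (rule inj_on_image_Pow)

lemma map_iso_cards:
  "card (vertices N) = card (vertices M)" "card (faces N) = card (faces M)" "card (darts N) = card (darts M)"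
proof -
  have "vertices M \<subseteq> Pow (darts M)"
    using orbit_in[OF premap_facts(3)[OF M]] by (auto simp: vertices_orbits orbits_def)
  then show "card (vertices N) = card (vertices M)"
    unfolding map_iso_vertices using map_iso_inj_image by (intro card_image) (rule inj_on_subset)
  have "faces M \<subseteq> Pow (darts M)"
    using orbit_in[OF premap_comp_permutes[OF M]] by (auto simp: faces_orbits orbits_def)
  then show "card (faces N) = card (faces M)"
    unfolding map_iso_faces using map_iso_inj_image by (intro card_image) (rule inj_on_subset)
  show "card (darts N) = card (darts M)" using bij_betw_same_card[OF map_isoD(1)[OF g]] by simp
qed

end

text \<open>The darts fixed by g form an invariant set containing the arrow, so connectivity yields
  all of them. Distinct marks on one rooted map are therefore never isomorphic.\<close>

lemma map_iso_id_on:
  assumes M: "rooted_map M" and g: "map_iso g M M" and x: "x \<in> darts M"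
  shows "g x = x"
proof -
  have "dart_closed M {x \<in> darts M. g x = x}"
    using premap_facts[OF rooted_map_facts(1)[OF M]] map_isoD[OF g] by (intro dart_closedI) auto
  moreover have "arrow M \<in> {x \<in> darts M. g x = x}"
    using rooted_map_facts(3)[OF M] map_isoD(2)[OF g] by simp
  ultimately have "{x \<in> darts M. g x = x} = darts M" by (rule rooted_map_facts(9)[OF M])
  then show ?thesis using x by blast
qed

lemma bij_betw_insert_iff:
  assumes "a \<notin> A" "f a \<notin> B"
  shows "bij_betw f (insert a A) (insert (f a) B) \<longleftrightarrow> bij_betw f A B"
  using assms notIn_Un_bij_betw3[of a A f B] by simp

text \<open>On B, g carries the transposition of a and b to that of their images; as involutions,
  the extra factors cancel in either direction.\<close>

lemma intertwines_comp_transpose: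
  assumes inj: "inj_on g B" and ab: "a \<in> B" "b \<in> B"
  shows "(\<forall>x\<in>B. g ((f \<circ> transpose a b) x) = (f' \<circ> transpose (g a) (g b)) (g x)) \<longleftrightarrow>
    (\<forall>x\<in>B. g (f x) = f' (g x))"
proof -
  have conj: "g (transpose a b x) = transpose (g a) (g b) (g x)" "transpose a b x \<in> B" if "x \<in> B" for x
    using that ab inj_on_eq_iff[OF inj] by (auto simp: transpose_def)
  show ?thesis
  proof (intro iffI ballI)
    fix x assume *: "\<forall>x\<in>B. g ((f \<circ> transpose a b) x) = (f' \<circ> transpose (g a) (g b)) (g x)" and x: "x \<in> B"
    show "g (f x) = f' (g x)"
      using bspec[OF * conj(2)[OF x]] conj(1)[OF x] by simp
  next
    fix x assume *: "\<forall>x\<in>B. g (f x) = f' (g x)" and x: "x \<in> B"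
    show "g ((f \<circ> transpose a b) x) = (f' \<circ> transpose (g a) (g b)) (g x)"
      using bspec[OF * conj(2)[OF x]] conj(1)[OF x] by simp
  qed
qed

lemma map_iso_close_iff:
  assumes N: "legged N l" "h \<notin> darts N" and N': "legged N' l'" "h' \<notin> darts N'"
    and g: "g h = h'" "g l = l'"
  shows "map_iso g (close h l N) (close h' l' N') \<longleftrightarrow> map_iso g N N'"
proof -
  note F = legged_facts[OF N] and F' = legged_facts[OF N']
  have bij: "bij_betw g (insert h (darts N)) (insert h' (darts N')) \<longleftrightarrow> bij_betw g (darts N) (darts N')"
    using bij_betw_insert_iff[of h "darts N" g "darts N'"] N(2) N'(2) g(1) by simp
  have "(\<forall>x\<in>insert h (darts N). g (rot (close h l N) x) = rot (close h' l' N') (g x) \<and>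
        g (opp (close h l N) x) = opp (close h' l' N') (g x)) \<longleftrightarrow>
      (\<forall>x\<in>darts N. g (rot N x) = rot N' (g x) \<and> g (opp N x) = opp N' (g x))"
    if "bij_betw g (insert h (darts N)) (insert h' (darts N'))" "g (arrow N) = arrow N'"
  proof -
    note T = intertwines_comp_transpose[OF bij_betw_imp_inj_on[OF that(1)]]
    have "(\<forall>x\<in>insert h (darts N). g (rot (close h l N) x) = rot (close h' l' N') (g x)) \<longleftrightarrow>
        (\<forall>x\<in>insert h (darts N). g (rot N x) = rot N' (g x))"
      using T[of h l "rot N \<circ> transpose h (arrow N)" "rot N' \<circ> transpose h' (arrow N')"]
        T[of h "arrow N" "rot N" "rot N'"] F(3,4) g that(2) by (simp add: close_def)
    moreover have "(\<forall>x\<in>insert h (darts N). g (opp (close h l N) x) = opp (close h' l' N') (g x)) \<longleftrightarrow>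
        (\<forall>x\<in>insert h (darts N). g (opp N x) = opp N' (g x))"
      using T[of h l "opp N" "opp N'"] F(4) g by (simp add: close_def)
    ultimately show ?thesis using F(11,12) F'(11,12) g(1) by (simp only: ball_conj_distrib ball_simps) simp
  qed
  then show ?thesis unfolding map_iso_def close_simps bij[symmetric] by blast
qed

text \<open>No choice is left: h is the successor of the arrow and l its opposite, and g respects
  both relations.\<close>

lemma map_iso_close_imp:
  assumes N: "legged N l" "h \<notin> darts N" and N': "legged N' l'" "h' \<notin> darts N'"
    and g: "map_iso g (close h l N) (close h' l' N')"
  shows "map_iso g N N'" "g l = l'"
proof -
  note I = map_isoD[OF g, unfolded close_simps] and F = legged_facts[OF N]
  have gh: "g h = h'" using I(3)[of "arrow N"] rot_close(1)[OF N] rot_close(1)[OF N'] F(3) I(2) by simp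
  show gl: "g l = l'" using I(4)[of h] opp_close(1)[OF N] opp_close(1)[OF N'] gh by simp
  show "map_iso g N N'" using map_iso_close_iff[OF N N' gh gl] g by simp
qed

lemma map_iso_cong:
  assumes "premap M" "map_iso f M N" "\<And>x. x \<in> darts M \<Longrightarrow> g x = f x"
  shows "map_iso g M N"
  using assms(2,3) premap_facts[OF assms(1)] bij_betw_cong[of "darts M" g f "darts N"]
  unfolding map_iso_def by auto

lemma map_iso_close:
  assumes N: "legged N l" "h \<notin> darts N" and N': "legged N' l'" "h' \<notin> darts N'"
    and g: "map_iso g N N'" "g l = l'"
  shows "map_iso (g(h := h')) (close h l N) (close h' l' N')"
proof -
  have "map_iso (g(h := h')) N N'"
    using N(2) by (intro map_iso_cong[OF legged_facts(1)[OF N] g(1)]) auto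
  then show ?thesis
    using map_iso_close_iff[OF N N', of "g(h := h')"] legged_facts(6)[OF N] g(2) by simp
qed

lemma rot_add_leg:
  assumes "rooted_map M" "l \<notin> darts M" "q \<in> darts M"
  shows "rot (add_leg q l M) q = l"
  using assms rooted_map_facts(4)[OF assms(1)] by (auto simp: permutes_def)

lemma map_iso_add_leg_iff:
  assumes M: "rooted_map M" "l \<notin> darts M" "q \<in> darts M" and M': "rooted_map M'" "l' \<notin> darts M'" "q' \<in> darts M'"
    and g: "g l = l'" "g q = q'"
  shows "map_iso g (add_leg q l M) (add_leg q' l' M') \<longleftrightarrow> map_iso g M M'"
proof -
  have fixd: "rot M l = l" "opp M l = l" "rot M' l' = l'" "opp M' l' = l'"
    using rooted_map_facts(4,5)[OF M(1)] rooted_map_facts(4,5)[OF M'(1)] M(2) M'(2) by (auto simp: permutes_def)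
  have bij: "bij_betw g (insert l (darts M)) (insert l' (darts M')) \<longleftrightarrow> bij_betw g (darts M) (darts M')"
    using bij_betw_insert_iff[of l "darts M" g "darts M'"] M(2) M'(2) g(1) by simp
  have "(\<forall>x\<in>insert l (darts M). g (rot (add_leg q l M) x) = rot (add_leg q' l' M') (g x)) \<longleftrightarrow>
      (\<forall>x\<in>insert l (darts M). g (rot M x) = rot M' (g x))"
    if "bij_betw g (insert l (darts M)) (insert l' (darts M'))"
    using intertwines_comp_transpose[OF bij_betw_imp_inj_on[OF that], of l q "rot M" "rot M'"] M(3) g
    by (simp add: add_leg_def)
  then have "(\<forall>x\<in>insert l (darts M). g (rot (add_leg q l M) x) = rot (add_leg q' l' M') (g x) \<and>
        g (opp M x) = opp M' (g x)) \<longleftrightarrow> (\<forall>x\<in>darts M. g (rot M x) = rot M' (g x) \<and> g (opp M x) = opp M' (g x))"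
    if "bij_betw g (insert l (darts M)) (insert l' (darts M'))"
    using that fixd g(1) by (simp only: ball_conj_distrib ball_simps) simp
  then show ?thesis unfolding map_iso_def add_leg_simps(1,2,3) bij[symmetric] by blast
qed

lemma map_iso_add_leg_imp:
  assumes M: "rooted_map M" "l \<notin> darts M" "q \<in> darts M" and M': "rooted_map M'" "l' \<notin> darts M'" "q' \<in> darts M'"
    and g: "map_iso g (add_leg q l M) (add_leg q' l' M')" "g l = l'"
  shows "map_iso g M M'" "g q = q'"
proof -
  have "rot (add_leg q' l' M') (g q) = rot (add_leg q' l' M') q'"
    using map_isoD(3)[OF g(1), of q] rot_add_leg[OF M] rot_add_leg[OF M'] M(3) g(2) by simp
  moreover have "premap (add_leg q' l' M')" using legged_add_leg[OF M'] unfolding legged_def by (rule conjunct1)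
  ultimately show gq: "g q = q'" using injD[OF permutes_inj[OF premap_facts(3)]] by metis
  show "map_iso g M M'" using map_iso_add_leg_iff[OF M M' g(2) gq] g(1) by simp
qed

lemma map_iso_add_leg:
  assumes M: "rooted_map M" "l \<notin> darts M" "q \<in> darts M" and M': "rooted_map M'" "l' \<notin> darts M'" "q' \<in> darts M'"
    and g: "map_iso g M M'" "g q = q'"
  shows "map_iso (g(l := l')) (add_leg q l M) (add_leg q' l' M')"
proof -
  have "map_iso (g(l := l')) M M'"
    using M(2) by (intro map_iso_cong[OF rooted_map_facts(1)[OF M(1)] g(1)]) auto
  moreover have "q \<noteq> l" using M(2,3) by auto
  ultimately show ?thesis
    using map_iso_add_leg_iff[OF M M', of "g(l := l')"] g(2) by simp
qed

lemma map_iso_funpow: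
  assumes "rooted_map M" "map_iso g M N"
  shows "g ((rot M ^^ k) (arrow M)) = (rot N ^^ k) (arrow N)"
proof (induction k)
  case 0
  then show ?case using map_isoD(2)[OF assms(2)] by simp
next
  case (Suc k)
  then show ?case using map_isoD(3)[OF assms(2) funpow_in_darts[OF assms(1), of k]] by simp
qed

lemma map_iso_disj_union:
  assumes M: "rooted_map M1" "rooted_map M2" "darts M1 \<inter> darts M2 = {}"
    and M': "rooted_map M1'" "rooted_map M2'" "darts M1' \<inter> darts M2' = {}"
    and f: "map_iso f M1 M1'" and g: "map_iso g M2 M2'"
  shows "map_iso (\<lambda>x. if x \<in> darts M1 then f x else g x) (disj_union M1 M2) (disj_union M1' M2')"
proof -
  note F = map_isoD[OF f] and G = map_isoD[OF g]
  note P1 = premap_facts[OF rooted_map_facts(1)[OF M(1)]] and P2 = premap_facts[OF rooted_map_facts(1)[OF M(2)]]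
  let ?g = "\<lambda>x. if x \<in> darts M1 then f x else g x"
  have g2: "?g x = g x" if "x \<in> darts M2" for x using that M(3) by auto
  have "bij_betw ?g (darts M1 \<union> darts M2) (darts M1' \<union> darts M2')"
  proof (rule bij_betw_combine)
    show "bij_betw ?g (darts M1) (darts M1')" using F(1) by (simp cong: bij_betw_cong)
    show "bij_betw ?g (darts M2) (darts M2')" using G(1) by (simp add: g2 cong: bij_betw_cong)
  qed fact
  moreover have "?g (rot (disj_union M1 M2) x) = rot (disj_union M1' M2') (?g x) \<and>
      ?g (opp (disj_union M1 M2) x) = opp (disj_union M1' M2') (?g x)" if x: "x \<in> darts M1 \<union> darts M2" for x
  proof (cases "x \<in> darts M1")
    case True
    then show ?thesis
      using disj_union_apply(1,3)[OF M, of x] disj_union_apply(1,3)[OF M', of "f x"] F P1(5,6) by simp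
  next
    case False
    then have x2: "x \<in> darts M2" using x by simp
    then have "rot M2 x \<notin> darts M1" "opp M2 x \<notin> darts M1" using P2(5,6) M(3) by blast+
    then show ?thesis using False x2
       disj_union_apply(2,4)[OF M, of x] disj_union_apply(2,4)[OF M', of "g x"] G(3,4,7) by simp
  qed
  moreover have "?g (arrow M1) = arrow M1'" using F(2) P1(2) by simp
  ultimately show ?thesis unfolding map_iso_def disj_union_simps by blast
qed

text \<open>The darts of \<open>M1\<close> sent into \<open>M1'\<close> form an invariant set with
  the arrow; likewise for the second components, whose arrows are matched by hypothesis.\<close>

lemma map_iso_disj_union_imp:
  assumes M: "rooted_map M1" "rooted_map M2" "darts M1 \<inter> darts M2 = {}"
    and M': "rooted_map M1'" "rooted_map M2'" "darts M1' \<inter> darts M2' = {}"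
    and g: "map_iso g (disj_union M1 M2) (disj_union M1' M2')" "g (arrow M2) = arrow M2'"
  shows "map_iso g M1 M1'" "map_iso g M2 M2'"
proof -
  note I = map_isoD[OF g(1), unfolded disj_union_simps]
  note A = disj_union_apply[OF M] and A' = disj_union_apply[OF M']
  note P1 = premap_facts[OF rooted_map_facts(1)[OF M(1)]] and P2 = premap_facts[OF rooted_map_facts(1)[OF M(2)]]
    and P1' = premap_facts[OF rooted_map_facts(1)[OF M'(1)]] and P2' =
        premap_facts[OF rooted_map_facts(1)[OF M'(2)]]
  have "dart_closed M1 {x \<in> darts M1. g x \<in> darts M1'}"
  proof (rule dart_closedI)
    fix x assume "x \<in> {x \<in> darts M1. g x \<in> darts M1'}"
    then have x: "x \<in> darts M1" "g x \<in> darts M1'" by auto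
    then show "rot M1 x \<in> {x \<in> darts M1. g x \<in> darts M1'}" "opp M1 x \<in> {x \<in> darts M1. g x \<in> darts M1'}"
      using P1(5,6)[of x] P1'(5,6)[of "g x"] I(3,4)[of x] A(1,3)[OF x(1)] A'(1,3)[OF x(2)] by auto
  qed auto
  moreover have "arrow M1 \<in> {x \<in> darts M1. g x \<in> darts M1'}" using P1(2) P1'(2) I(2) by simp
  ultimately have s1: "{x \<in> darts M1. g x \<in> darts M1'} = darts M1" by (rule rooted_map_facts(9)[OF M(1)])
  have "dart_closed M2 {x \<in> darts M2. g x \<in> darts M2'}"
  proof (rule dart_closedI)
    fix x assume "x \<in> {x \<in> darts M2. g x \<in> darts M2'}"
    then have x: "x \<in> darts M2" "g x \<in> darts M2'" by auto
    then show "rot M2 x \<in> {x \<in> darts M2. g x \<in> darts M2'}" "opp M2 x \<in> {x \<in> darts M2. g x \<in> darts M2'}"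
      using P2(5,6)[of x] P2'(5,6)[of "g x"] I(3,4)[of x] A(2,4)[OF x(1)] A'(2,4)[OF x(2)] by auto
  qed auto
  moreover have "arrow M2 \<in> {x \<in> darts M2. g x \<in> darts M2'}" using P2(2) P2'(2) g(2) by simp
  ultimately have s2: "{x \<in> darts M2. g x \<in> darts M2'} = darts M2" by (rule rooted_map_facts(9)[OF M(2)])
  have sub: "g ` darts M1 \<subseteq> darts M1'" "g ` darts M2 \<subseteq> darts M2'" using s1 s2 by blast+
  have un: "g ` darts M1 \<union> g ` darts M2 = darts M1' \<union> darts M2'" using I(6) by (simp add: image_Un)
  have img: "g ` darts M1 = darts M1'"
  proof
    show "darts M1' \<subseteq> g ` darts M1"
    proof
      fix y assume "y \<in> darts M1'"
      then show "y \<in> g ` darts M1" using un sub(2) M'(3) by blast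
    qed
  qed (rule sub)
  have img2: "g ` darts M2 = darts M2'"
  proof
    show "darts M2' \<subseteq> g ` darts M2"
    proof
      fix y assume "y \<in> darts M2'"
      then show "y \<in> g ` darts M2" using un sub(1) M'(3) by blast
    qed
  qed (rule sub)
  have inj: "inj_on g (darts M1)" "inj_on g (darts M2)" using I(5) by (auto intro: inj_on_subset)
  show "map_iso g M1 M1'"
    unfolding map_iso_def bij_betw_def
  proof (intro conjI ballI)
    fix x assume x: "x \<in> darts M1"
    then have "g x \<in> darts M1'" using sub by auto
    then show "g (rot M1 x) = rot M1' (g x)" "g (opp M1 x) = opp M1' (g x)"
      using I(3,4)[of x] A(1,3)[OF x] A'(1,3)[of "g x"] x by simp_all
  qed (use inj img I(2) in auto)
  show "map_iso g M2 M2'"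
    unfolding map_iso_def bij_betw_def
  proof (intro conjI ballI)
    fix x assume x: "x \<in> darts M2"
    then have "g x \<in> darts M2'" using sub by auto
    then show "g (rot M2 x) = rot M2' (g x)" "g (opp M2 x) = opp M2' (g x)"
      using I(3,4)[of x] A(2,4)[OF x] A'(2,4)[of "g x"] x by simp_all
  qed (use inj img2 g(2) in auto)
qed

text \<open>In the first map the leg lies in the cycle of the arrow, in the second in another
  component. Hence \<open>Edge\<close> and \<open>Loop\<close> codes never represent isomorphic
  maps.\<close>

lemma not_iso_add_leg_disj_union:
  assumes M: "rooted_map M" "l \<notin> darts M"
    and M': "rooted_map M1" "rooted_map M2" "darts M1 \<inter> darts M2 = {}"
    and g: "map_iso g (add_leg ((rot M ^^ k) (arrow M)) l M) (disj_union M1 M2)" "g l = arrow M2"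
  shows False
proof -
  let ?q = "(rot M ^^ k) (arrow M)"
  let ?N = "add_leg ?q l M"
  note F = rooted_map_facts[OF M(1)]
  have q: "?q \<in> darts M" using M(1) by (rule funpow_in_darts)
  have pre: "premap ?N" using legged_add_leg[OF M q] by (simp add: legged_def)
  have "?q \<in> orbit (rot M) (arrow M)" using funpow_in_orbit[OF orbit_self[OF F(4,2)]] .
  then have "l \<in> vertex_of ?N (arrow ?N)"
    using vertices_add_leg(3)[OF M q F(3)] by (simp add: vertex_of_def)
  then have "g l \<in> vertex_of (disj_union M1 M2) (g (arrow ?N))"
    using map_iso_vertex_of[OF pre g(1), of "arrow ?N"] F(3) by auto
  then show False
    using root_orbits_disj_union(1)[OF M'] map_isoD(2)[OF g(1)] g(2) by (simp add: vertex_of_def)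
qed

lemma rep_unique:
  assumes "rep M c" "rep N c'" "map_iso g M N"
  shows "c = c'"
  using assms
proof (induction arbitrary: N c' g rule: rep.induct)
  case (Point a)
  have "nedges c' = 0"
    using rep_stats[OF Point.prems(1)] map_iso_cards(3)[OF _ Point.prems(2)] rep_rooted[OF rep.Point]
      rooted_map_facts(1) by fastforce
  then show ?case by (cases c') auto
next
  case (Loop M1 c1 M2 c2 h)
  let ?C = "close h (arrow M2) (disj_union M1 M2)"
  note M = rep_rooted[OF Loop.hyps(1)] rep_rooted[OF Loop.hyps(2)] Loop.hyps(3)
  have hN: "h \<notin> darts (disj_union M1 M2)" using Loop.hyps(4) by simp
  note L = legged_disj_union[OF M]
  from Loop.prems(1) show ?case
  proof cases
    case (Point a)
    then have "card (darts ?C) = 1" using map_iso_cards(3)[OF _ Loop.prems(2)]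
      rooted_map_facts(1)[OF rooted_close[OF L hN]] by simp
    then show ?thesis using rep_stats[OF rep.Loop[OF Loop.hyps(1-4)]] by simp
  next
    case (Loop M1' c1' M2' c2' h')
    note M' = rep_rooted[OF Loop(3)] rep_rooted[OF Loop(4)] Loop(5)
    have hN': "h' \<notin> darts (disj_union M1' M2')" using Loop(6) by simp
    note g = map_iso_close_imp[OF L hN legged_disj_union[OF M'] hN' Loop.prems(2)[unfolded Loop(1)]]
    note g' = map_iso_disj_union_imp[OF M M' g]
    show ?thesis using Loop.IH(1)[OF Loop(3) g'(1)] Loop.IH(2)[OF Loop(4) g'(2)] Loop(2) by simp
  next
    case (Edge M' c'' h' l' k)
    note M' = rep_rooted[OF Edge(3)]
    note L' = legged_add_leg[OF M' Edge(5) funpow_in_darts[OF M'], of k]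
    have hN': "h' \<notin> darts (add_leg ((rot M' ^^ k) (arrow M')) l' M')" using Edge by simp
    note g = map_iso_close_imp[OF L hN L' hN' Loop.prems(2)[unfolded Edge(1)]]
    have pre: "premap (disj_union M1 M2)" using L by (simp add: legged_def)
    \<comment> \<open>The isomorphism is inverted, so that the \<open>Edge\<close> map becomes the
      source.\<close>
    have "inv_into (darts (disj_union M1 M2)) g l' = arrow M2"
      using g map_isoD(5)[OF g(1)] rooted_map_facts(3)[OF M(2)] by (auto intro: inv_into_f_eq)
    then show ?thesis
      using not_iso_add_leg_disj_union[OF M' Edge(5) M map_iso_sym[OF pre g(1)]] by simp
  qed
next
  case (Edge M c h l k)
  note M = rep_rooted[OF Edge.hyps(1)]
  define q where "q = (rot M ^^ k) (arrow M)"
  have q: "q \<in> darts M" unfolding q_def using M by (rule funpow_in_darts)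
  note L = legged_add_leg[OF M Edge.hyps(3) q]
  have hN: "h \<notin> darts (add_leg q l M)" using Edge.hyps by simp
  note iso = Edge.prems(2)[folded q_def]
  from Edge.prems(1) show ?case
  proof cases
    case (Point a)
    then have "card (darts (close h l (add_leg q l M))) = 1" using map_iso_cards(3)[OF _ iso]
      rooted_map_facts(1)[OF rooted_close[OF L hN]] by simp
    then show ?thesis using rep_stats[OF rep.Edge[OF Edge.hyps(1-5)]] by (simp add: q_def)
  next
    case (Loop M1' c1' M2' c2' h')
    note M' = rep_rooted[OF Loop(3)] rep_rooted[OF Loop(4)] Loop(5)
    have hN': "h' \<notin> darts (disj_union M1' M2')" using Loop(6) by simp
    note g = map_iso_close_imp[OF L hN legged_disj_union[OF M'] hN' iso[unfolded Loop(1)]]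
    show ?thesis using not_iso_add_leg_disj_union[OF M Edge.hyps(3) M' g[unfolded q_def]] ..
  next
    case (Edge M' c'' h' l' k')
    note M' = rep_rooted[OF Edge(3)]
    define q' where "q' = (rot M' ^^ k') (arrow M')"
    have q': "q' \<in> darts M'" unfolding q'_def using M' by (rule funpow_in_darts)
    note L' = legged_add_leg[OF M' Edge(5) q']
    have hN': "h' \<notin> darts (add_leg q' l' M')" using Edge by simp
    note g = map_iso_close_imp[OF L hN L' hN' iso[unfolded Edge(1), folded q'_def]]
    note g' = map_iso_add_leg_imp[OF M \<open>l \<notin> darts M\<close> q M' Edge(5) q' g]
    have c: "c = c''" using Edge.IH[OF Edge(3) g'(1)] .
    have "(rot M' ^^ k) (arrow M') = (rot M' ^^ k') (arrow M')"
      using map_iso_funpow[OF M g'(1), of k] g'(2) by (simp add: q_def q'_def)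
    moreover have "k < card (orbit (rot M') (arrow M'))" "k' < card (orbit (rot M') (arrow M'))"
      using rep_stats[OF Edge(3)] Edge(7) \<open>k \<le> root_deg c\<close> c by (simp_all add: root_vertex_def vertex_of_def)
    \<comment> \<open>The position is recovered because the iterates within one turn around the root
      vertex are distinct.\<close>
    ultimately have "k = k'"
      using inj_onD[OF orbit_enum(1)[OF rooted_map_facts(4,2)[OF M'], of "arrow M'"]] by simp
    then show ?thesis using c Edge(2) by simp
  qed
qed

lemma rep_iso:
  assumes "rep M c" "rep N c"
  shows "\<exists>g. map_iso g M N"
  using assms
proof (induction arbitrary: N rule: rep.induct)
  case (Point a)
  from Point.prems obtain b where "N = \<lparr>darts = {b}, rot = id, opp = id, arrow = b\<rparr>" by cases auto
  then have "map_iso (\<lambda>_. b) \<lparr>darts = {a}, rot = id, opp = id, arrow = a\<rparr> N"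
    by (simp add: map_iso_def bij_betw_def)
  then show ?case by (rule exI[of _ "\<lambda>_. b"])
next
  case (Loop M1 c1 M2 c2 h)
  note M = rep_rooted[OF Loop.hyps(1)] rep_rooted[OF Loop.hyps(2)] Loop.hyps(3)
  have hN: "h \<notin> darts (disj_union M1 M2)" using Loop.hyps(4) by simp
  from Loop.prems obtain M1' M2' h' where N: "N = close h' (arrow M2') (disj_union M1' M2')"
    "rep M1' c1" "rep M2' c2" "darts M1' \<inter> darts M2' = {}" "h' \<notin> darts M1' \<union> darts M2'" by cases auto
  note M' = rep_rooted[OF N(2)] rep_rooted[OF N(3)] N(4)
  have hN': "h' \<notin> darts (disj_union M1' M2')" using N(5) by simp
  obtain f g where fg: "map_iso f M1 M1'" "map_iso g M2 M2'" using Loop.IH N(2,3) by metis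
  have "arrow M2 \<notin> darts M1" using rooted_map_facts(3)[OF M(2)] M(3) by auto
  then show ?case
    unfolding N(1)
    using map_iso_close[OF legged_disj_union[OF M] hN legged_disj_union[OF M'] hN' map_iso_disj_union[OF
        M M' fg]]
      map_isoD(2)[OF fg(2)] by auto
next
  case (Edge M c h l k)
  note M = rep_rooted[OF Edge.hyps(1)]
  have q: "(rot M ^^ k) (arrow M) \<in> darts M" using M by (rule funpow_in_darts)
  from Edge.prems obtain M' h' l' where N: "N = close h' l' (add_leg ((rot M' ^^ k) (arrow M')) l' M')"
    "rep M' c" "h' \<notin> darts M'" "l' \<notin> darts M'" "h' \<noteq> l'" by cases auto
  note M' = rep_rooted[OF N(2)]
  have q': "(rot M' ^^ k) (arrow M') \<in> darts M'" using M' by (rule funpow_in_darts)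
  obtain g where g: "map_iso g M M'" using Edge.IH[OF N(2)] by blast
  have hN: "h \<notin> darts (add_leg ((rot M ^^ k) (arrow M)) l M)" using Edge.hyps by simp
  have hN': "h' \<notin> darts (add_leg ((rot M' ^^ k) (arrow M')) l' M')" using N by simp
  show ?case
    unfolding N(1)
    using map_iso_close[OF legged_add_leg[OF M Edge.hyps(3) q] hN legged_add_leg[OF M' N(4) q'] hN'
      map_iso_add_leg[OF M Edge.hyps(3) q M' N(4) q' g map_iso_funpow[OF M g]]]
    by auto
qed

section \<open>The exploration reaches all faces and makes one discovery fewer\<close>

section \<open>Discoveries\<close>

text \<open>
  The face permutation after opening the edges in \<open>E\<close>. The exploration follows it, since an edge
  that has been traversed has discovered faces on both sides and is never opened later.
\<close>

definition open_perm :: "'a rmap \<Rightarrow> 'a set set \<Rightarrow> 'a \<Rightarrow> 'a" where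
  "open_perm M E x = (if edge_of M x \<in> E then rot M x else rot M (opp M x))"

context
  fixes M :: "'a rmap"
  assumes M: "rooted_map M"
begin

lemmas rooted_facts = rooted_map_facts[OF M]
lemmas dart_facts = premap_facts[OF rooted_facts(1)]

lemma edge_of_opp: "edge_of M (opp M x) = edge_of M x"
  using rooted_facts(6) by (auto simp: edge_of_def)

lemma open_perm_permutes: "open_perm M E permutes darts M"
proof -
  define p where "p = (\<lambda>x. if edge_of M x \<in> E then x else opp M x)"
  have inv: "p (p x) = x" for x using rooted_facts(6) edge_of_opp by (simp add: p_def)
  have "p permutes darts M"
    unfolding permutes_def
  proof (intro conjI allI impI)
    show "p x = x" if "x \<notin> darts M" for x
      using that rooted_facts(5) by (auto simp: p_def permutes_def)
    show "\<exists>!x. p x = y" for y using inv by metis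
  qed
  then have "rot M \<circ> p permutes darts M" using rooted_facts(4) by (rule permutes_compose)
  moreover have "open_perm M E = rot M \<circ> p" by (auto simp: open_perm_def p_def)
  ultimately show ?thesis by simp
qed

lemma open_perm_empty: "open_perm M {} = rot M \<circ> opp M"
  by (auto simp: open_perm_def)

text \<open>Opening an edge exchanges the successors of its halves, so an edge between two cycles
  merges them.\<close>

lemma open_perm_insert:
  assumes "edge_of M h \<notin> E"
  shows "open_perm M (insert (edge_of M h) E) = open_perm M E \<circ> transpose h (opp M h)"
proof
  fix x
  show "open_perm M (insert (edge_of M h) E) x = (open_perm M E \<circ> transpose h (opp M h)) x"
  proof (cases "x = h \<or> x = opp M h")
    case True
    then show ?thesis using assms edge_of_opp rooted_facts(6) by (auto simp: open_perm_def)
  next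
    case False
    then have "edge_of M x \<noteq> edge_of M h" by (auto simp: edge_of_def doubleton_eq_iff)
    then show ?thesis using False by (simp add: open_perm_def)
  qed
qed

lemma face_perm_permutes: "(rot M \<circ> opp M) permutes darts M"
  using rooted_facts(1) by (rule premap_comp_permutes)

lemma face_of_self: "x \<in> face_of M x"
  unfolding face_of_def by (rule orbit_self[OF face_perm_permutes rooted_facts(2)])

lemma face_of_eq: "y \<in> face_of M x \<Longrightarrow> face_of M y = face_of M x"
  unfolding face_of_def by (rule orbit_eq[OF face_perm_permutes rooted_facts(2)])

lemma face_subset: "f \<in> faces M \<Longrightarrow> f \<subseteq> darts M"
  using orbit_in[OF face_perm_permutes] by (auto simp: faces_def face_of_def)

lemma edges_subset: "e \<in> edges M \<Longrightarrow> e \<subseteq> darts M"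
  using dart_facts by (auto simp: edges_def edge_of_def)

lemma in_Union_faces:
  assumes "F \<subseteq> faces M"
  shows "x \<in> \<Union>F \<longleftrightarrow> x \<in> darts M \<and> face_of M x \<in> F"
proof
  assume "x \<in> \<Union>F"
  then obtain f where f: "f \<in> F" "x \<in> f" by auto
  then obtain y where y: "f = face_of M y" using assms by (auto simp: faces_def)
  then have "face_of M x = f" using f face_of_eq by simp
  then show "x \<in> darts M \<and> face_of M x \<in> F" using f assms face_subset by auto
qed (use face_of_self in auto)

text \<open>The discovered faces form a single cycle through the arrow, of which the exploration is
  an initial stretch. Every dart passed has a discovered face on its other side, so opening further
  edges does not alter the path.\<close>

definition explore_inv :: "'a \<Rightarrow> 'a set set \<Rightarrow> 'a set set \<Rightarrow> bool" where
  "explore_inv h E F \<longleftrightarrow> E \<subseteq> edges M \<and> F \<subseteq> faces M \<and> card F = Suc (card E) \<and> arrow M \<in> \<Union>F \<and>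
     \<Union>E \<subseteq> \<Union>F \<and> (\<forall>x\<in>\<Union>F. orbit (open_perm M E) x = \<Union>F) \<and>
     (\<exists>k. h = (open_perm M E ^^ k) (rot M (arrow M)) \<and>
       (\<forall>j<k. (open_perm M E ^^ j) (rot M (arrow M)) \<noteq> arrow M \<and>
              opp M ((open_perm M E ^^ j) (rot M (arrow M))) \<in> \<Union>F))"

lemma open_perm_arrow: "open_perm M E (arrow M) = rot M (arrow M)"
  using rooted_facts(7) by (simp add: open_perm_def)

lemma funpow_rot_arrow: "(open_perm M E ^^ k) (rot M (arrow M)) = (open_perm M E ^^ Suc k) (arrow M)"
  by (simp only: funpow_Suc_right comp_apply open_perm_arrow)

lemma explore_inv_in:
  assumes "explore_inv h E F"
  shows "(open_perm M E ^^ k) (rot M (arrow M)) \<in> \<Union>F" "h \<in> \<Union>F" "h \<in> darts M"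
proof -
  have "orbit (open_perm M E) (arrow M) = \<Union>F" using assms by (auto simp: explore_inv_def)
  moreover have "(open_perm M E ^^ Suc k) (arrow M) \<in> orbit (open_perm M E) (arrow M)" for k
    unfolding orbit_altdef by blast
  ultimately show *: "(open_perm M E ^^ k) (rot M (arrow M)) \<in> \<Union>F" for k
    unfolding funpow_rot_arrow by blast
  then show "h \<in> \<Union>F" using assms by (auto simp: explore_inv_def)
  then show "h \<in> darts M" using assms in_Union_faces by (auto simp: explore_inv_def)
qed

lemma explore_inv_move:
  assumes inv: "explore_inv h E F" and h: "h \<noteq> arrow M" "opp M h \<in> \<Union>F"
  shows "explore_inv (open_perm M E h) E F"
proof -
  obtain k where k: "h = (open_perm M E ^^ k) (rot M (arrow M))"
    "\<forall>j<k. (open_perm M E ^^ j) (rot M (arrow M)) \<noteq> arrow M \<and>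
              opp M ((open_perm M E ^^ j) (rot M (arrow M))) \<in> \<Union>F"
    using inv by (auto simp: explore_inv_def)
  have "open_perm M E h = (open_perm M E ^^ Suc k) (rot M (arrow M)) \<and>
      (\<forall>j<Suc k. (open_perm M E ^^ j) (rot M (arrow M)) \<noteq> arrow M \<and>
              opp M ((open_perm M E ^^ j) (rot M (arrow M))) \<in> \<Union>F)"
    using k h by (auto simp: less_Suc_eq)
  then show ?thesis using inv unfolding explore_inv_def by blast
qed

lemma explore_inv_discover:
  assumes inv: "explore_inv h E F" and h: "h \<noteq> arrow M" "edge_of M h \<notin> E" "face_of M (opp M h) \<notin> F"
  shows "explore_inv (rot M h) (insert (edge_of M h) E) (insert (face_of M (opp M h)) F)"
proof -
  let ?f = "open_perm M E" and ?l = "opp M h"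
  let ?E = "insert (edge_of M h) E" and ?F = "insert (face_of M ?l) F"
  let ?g = "open_perm M ?E"
  have E: "E \<subseteq> edges M" and F: "F \<subseteq> faces M" and c: "card F = Suc (card E)" and a: "arrow M \<in> \<Union>F"
    and EF: "\<Union>E \<subseteq> \<Union>F" and orb: "\<And>x. x \<in> \<Union>F \<Longrightarrow> orbit ?f x = \<Union>F"
    using inv by (auto simp: explore_inv_def)
  obtain k where k: "h = (?f ^^ k) (rot M (arrow M))"
    "\<And>j. j < k \<Longrightarrow> (?f ^^ j) (rot M (arrow M)) \<noteq> arrow M \<and> opp M ((?f ^^ j) (rot M (arrow M))) \<in> \<Union>F"
    using inv by (auto simp: explore_inv_def)
  have hd: "h \<in> darts M" and hF: "h \<in> \<Union>F" using explore_inv_in[OF inv] by auto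
  have ld: "?l \<in> darts M" using hd dart_facts by simp
  have lF: "?l \<notin> \<Union>F" using h(3) in_Union_faces[OF F] by blast
  have dis: "y \<notin> \<Union>F" if "y \<in> face_of M ?l" for y
    using face_of_eq[OF that] h(3) in_Union_faces[OF F, of y] by simp
  \<comment> \<open>The new face meets no opened edge, so it is still a cycle of the current
    permutation.\<close>
  have ol: "orbit ?f ?l = face_of M ?l"
    unfolding face_of_def
  proof (rule sym, rule orbit_cong0[of _ "face_of M ?l"])
    show "?l \<in> face_of M ?l" by (rule face_of_self)
    show "rot M \<circ> opp M \<in> face_of M ?l \<rightarrow> face_of M ?l"
      by (auto simp: face_of_def dest: orbit.step)
    fix y assume "y \<in> face_of M ?l"
    then have "edge_of M y \<notin> E" using dis[of y] EF by (auto simp: edge_of_def)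
    then show "(rot M \<circ> opp M) y = ?f y" by (simp add: open_perm_def)
  qed
  have oh: "orbit ?f h = \<Union>F" using orb hF by simp
  have g: "?g = ?f \<circ> transpose h ?l" using h(2) by (rule open_perm_insert)
  have nl: "?l \<notin> orbit ?f h" using oh lF by simp
  note Mg = orbit_comp_transpose_merge[OF open_perm_permutes rooted_facts(2) hd ld nl, folded g, unfolded oh ol]
  have eh: "edge_of M h \<in> edges M" using hd h(1) by (auto simp: edges_def)
  have fl: "face_of M ?l \<in> faces M" using ld by (auto simp: faces_def)
  have fin: "finite E" "finite F"
    using E F rooted_facts(2) by (auto simp: edges_def faces_def intro: finite_subset)
  have og: "orbit ?g x = \<Union>?F" if "x \<in> \<Union>?F" for x
  proof -
    have "x \<in> orbit ?g h" using that Mg(1) by auto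
    then have "orbit ?g x = orbit ?g h" by (rule orbit_eq[OF open_perm_permutes rooted_facts(2)])
    then show ?thesis using Mg(1) by auto
  qed
  \<comment> \<open>Earlier darts have both halves in discovered faces, hence differ from h and its
    opposite.\<close>
  have path: "(?g ^^ j) (rot M (arrow M)) = (?f ^^ j) (rot M (arrow M))" if "j \<le> k" for j
    using that
  proof (induction j)
    case (Suc j)
    let ?x = "(?f ^^ j) (rot M (arrow M))"
    have "opp M ?x \<in> \<Union>F" "?x \<in> \<Union>F" using k(2)[of j] explore_inv_in(1)[OF inv] Suc.prems by auto
    then have "?x \<noteq> h" "?x \<noteq> ?l" using lF by metis+
    then have "?g ?x = ?f ?x" by (simp add: g)
    then show ?case using Suc by simp
  qed simp
  have gh: "?g h = rot M h" by (simp add: open_perm_def)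
  have "rot M h = (?g ^^ Suc k) (rot M (arrow M))" using path[of k] k(1) gh by simp
  moreover have "(?g ^^ j) (rot M (arrow M)) \<noteq> arrow M \<and> opp M ((?g ^^ j) (rot M (arrow M))) \<in> \<Union>?F"
    if "j < Suc k" for j
  proof (cases "j = k")
    case True
    then show ?thesis using path[of k] k(1) h(1) face_of_self[of ?l] by auto
  next
    case False
    then show ?thesis using path[of j] k(2)[of j] that by auto
  qed
  ultimately have "\<exists>k. rot M h = (?g ^^ k) (rot M (arrow M)) \<and>
      (\<forall>j<k. (?g ^^ j) (rot M (arrow M)) \<noteq> arrow M \<and> opp M ((?g ^^ j) (rot M (arrow M))) \<in> \<Union>?F)"
    by blast
  moreover have "\<Union>?E \<subseteq> \<Union>?F" using EF hF face_of_self[of ?l] by (auto simp: edge_of_def)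
  moreover have "card ?F = Suc (card ?E)" using c fin h(2,3) by simp
  moreover have "?E \<subseteq> edges M" "?F \<subseteq> faces M" "arrow M \<in> \<Union>?F" using E F eh fl a by auto
  ultimately show ?thesis
    unfolding explore_inv_def using og by (intro conjI ballI)
qed

lemma explores_inv:
  assumes "explores M h E F"
  shows "explore_inv h E F"
  using assms
proof induction
  case start
  let ?F = "{face_of M (arrow M)}"
  have "orbit (open_perm M {}) x = face_of M (arrow M)" if "x \<in> face_of M (arrow M)" for x
    using face_of_eq[OF that] by (simp add: open_perm_empty face_of_def)
  moreover have "\<exists>k. rot M (arrow M) = (open_perm M {} ^^ k) (rot M (arrow M)) \<and>
      (\<forall>j<k. (open_perm M {} ^^ j) (rot M (arrow M)) \<noteq> arrow M \<and>
        opp M ((open_perm M {} ^^ j) (rot M (arrow M))) \<in> \<Union>?F)"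
    by (rule exI[of _ 0]) simp
  ultimately show ?case
    unfolding explore_inv_def using face_of_self rooted_facts(3) by (auto simp: faces_def)
next
  case (discover h E F)
  then show ?case by (intro explore_inv_discover)
next
  case (skip_opened h E F)
  then have "opp M h \<in> \<Union>F" by (auto simp: explore_inv_def edge_of_def)
  then show ?case
    using explore_inv_move[OF skip_opened.IH skip_opened.hyps(2)] skip_opened.hyps(3)
        by (simp add: open_perm_def)
next
  case (traverse h E F)
  have "F \<subseteq> faces M" using traverse.IH by (simp add: explore_inv_def)
  then have "opp M h \<in> \<Union>F"
    using traverse.hyps(4) explore_inv_in(3)[OF traverse.IH] dart_facts(6) in_Union_faces by blast
  then show ?case
    using explore_inv_move[OF traverse.IH traverse.hyps(2)] traverse.hyps(3) by (simp add: open_perm_def)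
qed

text \<open>From a state with the greatest number of opened edges the walk can only follow its
  cycle, which contains the arrow.\<close>

lemma explores_finishes: "\<exists>E F. explores M (arrow M) E F"
proof (rule ccontr)
  assume neg: "\<not> ?thesis"
  have fin: "finite (edges M)" using rooted_facts(2) by (simp add: edges_def)
  define X where "X = {E. \<exists>h F. explores M h E F}"
  have "card E \<le> card (edges M)" if "E \<in> X" for E
  proof -
    from that obtain h F where "explores M h E F" by (auto simp: X_def)
    then have "E \<subseteq> edges M" using explores_inv by (auto simp: explore_inv_def)
    then show ?thesis using fin by (intro card_mono)
  qed
  moreover have "{} \<in> X" using explores.start by (auto simp: X_def)
  ultimately have "\<exists>E. E \<in> X \<and> (\<forall>E'. E' \<in> X \<longrightarrow> card E' \<le> card E)"
    by (intro ex_has_greatest_nat[of _ "{}" _ "Suc (card (edges M))"]) (auto simp: less_Suc_eq_le)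
  then obtain E where E: "E \<in> X" "\<And>E'. E' \<in> X \<Longrightarrow> card E' \<le> card E" by blast
  then obtain h F where ex: "explores M h E F" by (auto simp: X_def)
  note inv = explores_inv[OF ex]
  have finE: "finite E" using inv fin by (auto simp: explore_inv_def intro: finite_subset)
  have "explores M ((open_perm M E ^^ n) h) E F" for n
  proof (induction n)
    case 0
    then show ?case using ex by simp
  next
    case (Suc n)
    let ?x = "(open_perm M E ^^ n) h"
    have ne: "?x \<noteq> arrow M" using Suc neg by metis
    show ?case
    proof (cases "edge_of M ?x \<in> E")
      case True
      then show ?thesis using explores.skip_opened[OF Suc ne True] True by (simp add: open_perm_def[of M E ?x])
    next
      case False
      show ?thesis
      proof (cases "face_of M (opp M ?x) \<in> F")
        case True
        then show ?thesis using explores.traverse[OF Suc ne False True] False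
            by (simp add: open_perm_def[of M E ?x])
      next
        case nF: False
        have "insert (edge_of M ?x) E \<in> X"
          using explores.discover[OF Suc ne False nF] by (auto simp: X_def)
        then show ?thesis using E(2) False finE by fastforce
      qed
    qed
  qed
  moreover have "arrow M \<in> orbit (open_perm M E) h"
    using inv explore_inv_in(2)[OF inv] by (auto simp: explore_inv_def)
  ultimately have "explores M (arrow M) E F" unfolding orbit_altdef by auto
  then show False using neg by blast
qed

text \<open>A complete turn passes every dart of the merged cycle, so the discovered darts are
  closed under \<open>opp\<close>. Following faces closes them under \<open>rot\<close>, and
  connectivity gives all darts.\<close>

lemma explores_final:
  assumes "explores M (arrow M) E F"
  shows "F = faces M"
proof -
  note inv = explores_inv[OF assms]
  have F: "F \<subseteq> faces M" and aF: "arrow M \<in> \<Union>F" and orb: "orbit (open_perm M E) (arrow M) = \<Union>F"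
    using inv by (auto simp: explore_inv_def)
  obtain k where k: "arrow M = (open_perm M E ^^ k) (rot M (arrow M))"
    "\<And>j. j < k \<Longrightarrow> opp M ((open_perm M E ^^ j) (rot M (arrow M))) \<in> \<Union>F"
    using inv by (auto simp: explore_inv_def)
  have per: "(open_perm M E ^^ Suc k) (arrow M) = arrow M" using k(1) funpow_rot_arrow by simp
  have oppF: "opp M x \<in> \<Union>F" if "x \<in> \<Union>F" for x
  proof -
    have "x \<in> {(open_perm M E ^^ m) (arrow M) |m. m < Suc k}"
      using that orb orbit_altdef_bounded[OF per] by simp
    then obtain m where m: "m < Suc k" "x = (open_perm M E ^^ m) (arrow M)" by blast
    show ?thesis
    proof (cases m)
      case 0
      then show ?thesis using m aF rooted_facts(7) by simp
    next
      case (Suc j)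
      then show ?thesis using k(2)[of j] m by (simp only: funpow_rot_arrow)
    qed
  qed
  have "dart_closed M (\<Union>F)"
  proof (rule dart_closedI)
    show "\<Union>F \<subseteq> darts M" using F face_subset by blast
    fix x assume x: "x \<in> \<Union>F"
    show "opp M x \<in> \<Union>F" using x by (rule oppF)
    then obtain f where f: "f \<in> F" "opp M x \<in> f" by auto
    then obtain y where "f = face_of M y" using F by (auto simp: faces_def)
    then have "(rot M \<circ> opp M) (opp M x) \<in> f"
      using f(2) orbit.step[of "opp M x" "rot M \<circ> opp M"] by (simp only: face_of_def)
    then show "rot M x \<in> \<Union>F" using f(1) rooted_facts(6) by auto
  qed
  then have "\<Union>F = darts M" using aF rooted_facts(9) by blast
  then have "face_of M x \<in> F" if "x \<in> darts M" for x using in_Union_faces[OF F] that by blast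
  then show ?thesis using F by (auto simp: faces_def)
qed

text \<open>The rules exclude each other, so the exploration iterates one function, made to stay put
  at the arrow. This makes any two of its states comparable.\<close>

definition explore_next :: "'a \<times> 'a set set \<times> 'a set set \<Rightarrow> 'a \<times> 'a set set \<times> 'a set set" where
  "explore_next = (\<lambda>(h, E, F). if h = arrow M then (h, E, F)
     else if edge_of M h \<in> E then (rot M h, E, F)
     else if face_of M (opp M h) \<in> F then (rot M (opp M h), E, F)
     else (rot M h, insert (edge_of M h) E, insert (face_of M (opp M h)) F))"

lemma explores_iterate:
  assumes "explores M h E F"
  shows "\<exists>n. (h, E, F) = (explore_next ^^ n) (rot M (arrow M), {}, {face_of M (arrow M)})"
  using assms
proof induction
  case start
  show ?case by (rule exI[of _ 0]) simp
next
  case (discover h E F)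
  then obtain n where "(h, E, F) = (explore_next ^^ n) (rot M (arrow M), {}, {face_of M (arrow M)})" by blast
  then show ?case using discover.hyps by (intro exI[of _ "Suc n"]) (auto simp: explore_next_def dest: sym)
next
  case (skip_opened h E F)
  then obtain n where "(h, E, F) = (explore_next ^^ n) (rot M (arrow M), {}, {face_of M (arrow M)})" by blast
  then show ?case using skip_opened.hyps by (intro exI[of _ "Suc n"]) (auto simp: explore_next_def dest: sym)
next
  case (traverse h E F)
  then obtain n where "(h, E, F) = (explore_next ^^ n) (rot M (arrow M), {}, {face_of M (arrow M)})" by blast
  then show ?case using traverse.hyps by (intro exI[of _ "Suc n"]) (auto simp: explore_next_def dest: sym)
qed

lemma explore_next_mono: "fst (snd s) \<subseteq> fst (snd (explore_next s))"
  by (cases s) (auto simp: explore_next_def)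

lemma explore_next_funpow_mono:
  assumes "m \<le> n"
  shows "fst (snd ((explore_next ^^ m) s)) \<subseteq> fst (snd ((explore_next ^^ n) s))"
  using assms
proof (induction rule: dec_induct)
  case (step n)
  then show ?case using explore_next_mono[of "(explore_next ^^ n) s"] by simp
qed simp

lemma explores_final_max:
  assumes "explores M h E F" "explores M (arrow M) E' F'"
  shows "E \<subseteq> E'"
proof -
  let ?s = "(rot M (arrow M), {}, {face_of M (arrow M)})"
  obtain m n where m: "(h, E, F) = (explore_next ^^ m) ?s" and n: "(arrow M, E', F') = (explore_next ^^ n) ?s"
    using explores_iterate[OF assms(1)] explores_iterate[OF assms(2)] by blast
  show ?thesis
  proof (cases "m \<le> n")
    case True
    then show ?thesis using explore_next_funpow_mono[OF True, of ?s] by (simp flip: m n)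
  next
    case False
    have "explore_next (arrow M, E', F') = (arrow M, E', F')" by (simp add: explore_next_def)
    then have "(explore_next ^^ (d + n)) ?s = (arrow M, E', F')" for d
      by (induction d) (simp_all flip: n)
    from this[of "m - n"] have "(explore_next ^^ m) ?s = (arrow M, E', F')" using False by simp
    then show ?thesis using m by simp
  qed
qed

lemma card_discoveries: "Suc (card (discoveries M)) = card (faces M)" "discoveries M \<subseteq> edges M"
proof -
  obtain E F where EF: "explores M (arrow M) E F" using explores_finishes by blast
  have "discoveries M = E"
    unfolding discoveries_def using EF explores_final_max by blast
  moreover have "card F = Suc (card E)" "E \<subseteq> edges M" using explores_inv[OF EF] by (auto simp: explore_inv_def)
  ultimately show "Suc (card (discoveries M)) = card (faces M)" "discoveries M \<subseteq> edges M"
    using explores_final[OF EF] by auto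
qed

end

text \<open>The membership tests survive the transport because taking images is injective on sets of
  darts.\<close>

lemma explores_iso:
  assumes M: "rooted_map M" and g: "map_iso g M N" and ex: "explores M h E F"
  shows "explores N (g h) ((`) g ` E) ((`) g ` F)"
  using ex
proof induction
  case start
  note I = map_isoD[OF g] and P = rooted_map_facts[OF M]
  show ?case
    using explores.start[of N] I(2,3) P(3) map_iso_face_of[OF P(1) g P(3)] by simp
next
  case (discover h E F)
  note I = map_isoD[OF g] and P = rooted_map_facts[OF M]
  note inv = explores_inv[OF M discover.hyps(1)]
  have hd: "h \<in> darts M" using explore_inv_in(3)[OF M inv] .
  then have ld: "opp M h \<in> darts M" using premap_facts(6)[OF P(1)] by simp
  have EF: "E \<subseteq> edges M" "F \<subseteq> faces M" using inv by (simp_all add: explore_inv_def[OF M])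
  have "face_of M (opp M h) \<in> faces M" "edge_of M h \<in> edges M"
    using hd ld discover.hyps(2) by (simp_all add: faces_def edges_def)
  then have "edge_of M h \<subseteq> darts M" "face_of M (opp M h) \<subseteq> darts M"
    using edges_subset[OF M] face_subset[OF M] by blast+
  moreover have "E \<subseteq> Pow (darts M)" "F \<subseteq> Pow (darts M)"
    using EF edges_subset[OF M] face_subset[OF M] by blast+
  ultimately have sub: "E \<subseteq> Pow (darts M)" "F \<subseteq> Pow (darts M)" "edge_of M h \<in> Pow (darts M)"
    "face_of M (opp M h) \<in> Pow (darts M)" by simp_all
  note E = map_iso_edge_of[OF P(1) g hd] and F = map_iso_face_of[OF P(1) g ld]
  note inj = map_iso_inj_image[OF P(1) g]
  have "g h \<noteq> arrow N" using I(5,2) P(3) hd discover.hyps(2) by (metis inj_onD)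
  moreover have "edge_of N (g h) \<notin> (`) g ` E"
    using discover.hyps(3) sub inj_on_image_mem_iff[OF inj] by (simp flip: E)
  moreover have "face_of N (opp N (g h)) \<notin> (`) g ` F"
    using discover.hyps(4) inj_on_image_mem_iff[OF inj sub(4,2)] F I(4)[OF hd] by simp
  ultimately show ?case
    using explores.discover[OF discover.IH] I(3,4)[OF hd] E F by simp
next
  case (skip_opened h E F)
  note I = map_isoD[OF g] and P = rooted_map_facts[OF M]
  have hd: "h \<in> darts M" using explore_inv_in(3)[OF M explores_inv[OF M skip_opened.hyps(1)]] .
  have "g h \<noteq> arrow N" using I(5,2) P(3) hd skip_opened.hyps(2) by (metis inj_onD)
  moreover have "edge_of N (g h) \<in> (`) g ` E"
    using skip_opened.hyps(3) map_iso_edge_of[OF P(1) g hd] by blast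
  ultimately show ?case
    using explores.skip_opened[OF skip_opened.IH] I(3)[OF hd] by simp
next
  case (traverse h E F)
  note I = map_isoD[OF g] and P = rooted_map_facts[OF M]
  note inv = explores_inv[OF M traverse.hyps(1)]
  have hd: "h \<in> darts M" using explore_inv_in(3)[OF M inv] .
  then have ld: "opp M h \<in> darts M" using premap_facts(6)[OF P(1)] by simp
  have sub: "E \<subseteq> Pow (darts M)" "edge_of M h \<in> Pow (darts M)"
    using inv edges_subset[OF M] hd ld by (auto simp: explore_inv_def[OF M] edge_of_def)
  note E = map_iso_edge_of[OF P(1) g hd] and F = map_iso_face_of[OF P(1) g ld]
  note inj = map_iso_inj_image[OF P(1) g]
  have "g h \<noteq> arrow N" using I(5,2) P(3) hd traverse.hyps(2) by (metis inj_onD)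
  moreover have "edge_of N (g h) \<notin> (`) g ` E"
    using traverse.hyps(3) sub inj_on_image_mem_iff[OF inj] by (simp flip: E)
  moreover have "face_of N (opp N (g h)) \<in> (`) g ` F"
    using traverse.hyps(4) I(4)[OF hd] F by (metis imageI)
  ultimately show ?case
    using explores.traverse[OF traverse.IH] I(3)[OF ld] I(4)[OF hd] by simp
qed

lemma discoveries_iso:
  assumes M: "rooted_map M" and g: "map_iso g M N" and e: "e \<in> discoveries M"
  shows "g ` e \<in> discoveries N"
  using explores_iso[OF M g] e unfolding discoveries_def by blast

section \<open>From coefficient identities to bijections between isomorphism classes\<close>

section \<open>Counting\<close>

definition code_sum :: "code set \<Rightarrow> (code \<Rightarrow> int) \<Rightarrow> nat \<Rightarrow> nat \<Rightarrow> int" where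
  "code_sum K w n f = (\<Sum>c | c \<in> K \<and> nedges c = n \<and> Suc (nloops c) = f. w c)"

lemma sum_diag: "(\<Sum>(i, j)\<in>{(i, j). i + j = n}. \<phi> i j) = (\<Sum>i\<le>n. \<phi> i (n - i :: nat))"
  by (rule sum.reindex_bij_witness[of _ "\<lambda>i. (i, n - i)" fst]) auto

lemma sum_diag_pos:
  "(\<Sum>(i, j)\<in>{(i, j). i + j = Suc (Suc m) \<and> 1 \<le> i \<and> 1 \<le> j}. \<phi> i j) = (\<Sum>i\<le>m. \<phi> (Suc i) (Suc (m - i)))"
  by (rule sum.reindex_bij_witness[of _ "\<lambda>i. (Suc i, Suc (m - i))" "\<lambda>(i, j). i - 1"])
     (auto intro!: arg_cong2[of _ _ _ _ \<phi>])

lemma code_wt_nth: "code_wt w c $ m = (if nloops c = m then w c else 0)"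
  by (auto simp: code_wt_def fps_X_power_nth)

text \<open>The exponent of u is the number of faces minus 1, so the extra factor u makes face
  numbers add up: \<open>(f1 - 1) + (f2 - 1) + 1 = f - 1\<close>.\<close>

lemma product_coefficient:
  fixes A B L :: "int fps fps"
  assumes "L = fps_const fps_X * (A * B)" "f \<ge> 1"
    and a: "\<And>n m. A $ n $ m = a n (Suc m)" and b: "\<And>n m. B $ n $ m = b n (Suc m)"
    and l: "\<And>n m. L $ n $ m = l n (Suc m)"
  shows "l n f = (\<Sum>(i, j)\<in>{(i, j). i + j = n}. \<Sum>(f1, f2)\<in>{(f1, f2). f1 + f2 = f \<and> f1 \<ge> 1 \<and> f2 \<ge> 1}.
    a i f1 * b j f2)"
proof -
  obtain m where m: "f = Suc m" using assms(2) by (cases f) auto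
  have l': "l n f = (fps_X * ((A * B) $ n)) $ m" using l[of n m] by (simp add: m assms(1))
  show ?thesis
  proof (cases m)
    case 0
    \<comment> \<open>One face does not split into two positive parts, and the factor u kills the
      coefficient.\<close>
    then have B: "{(f1, f2). f1 + f2 = f \<and> f1 \<ge> 1 \<and> f2 \<ge> (1::nat)} = {}" using m by auto
    have "l n f = 0" using l' 0 by simp
    then show ?thesis unfolding B by (simp add: case_prod_unfold)
  next
    case (Suc k)
    have "l n f = (A * B) $ n $ k" unfolding l' Suc by simp
    also have "\<dots> = (\<Sum>i\<le>n. \<Sum>j\<le>k. a i (Suc j) * b (n - i) (Suc (k - j)))"
      by (simp add: fps_mult_nth fps_sum_nth a b atLeast0AtMost)
    finally show ?thesis unfolding m Suc sum_diag_pos sum_diag .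
  qed
qed

abbreviation "planar_codes \<equiv> {c. valid c}"
abbreviation "precubic_codes \<equiv> {c. valid c \<and> degs_in {1, 3} c \<and> root_deg c = 1}"

lemma degs_in_UNIV: "degs_in UNIV c"
  by (induction c) auto

lemma total_series_nth: "total_series UNIV (code_wt w) $ n $ m = code_sum planar_codes w n (Suc m)"
proof -
  have "total_series UNIV (code_wt w) $ n $ m = (\<Sum>c\<in>codes UNIV n. if nloops c = m then w c else 0)"
    by (simp add: total_series_def fps_sum_nth code_wt_nth)
  also have "\<dots> = (\<Sum>c | c \<in> codes UNIV n \<and> nloops c = m. w c)"
    by (simp add: sum.inter_filter)
  also have "{c. c \<in> codes UNIV n \<and> nloops c = m} = {c. c \<in> planar_codes \<and> nedges c = n \<and>
      Suc (nloops c) = Suc m}"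
    by (auto simp: codes_def degs_in_UNIV)
  finally show ?thesis by (simp only: code_sum_def)
qed

lemma root1_series_nth: "root1_series (code_wt w) $ n $ m = code_sum precubic_codes w n (Suc m)"
proof -
  have "root1_series (code_wt w) $ n $ m =
      (\<Sum>c | c \<in> codes {1, 3} n \<and> root_deg c = 1. if nloops c = m then w c else 0)"
    by (simp add: root1_series_def fps_sum_nth code_wt_nth)
  also have "\<dots> = (\<Sum>c | c \<in> {c. c \<in> codes {1, 3} n \<and> root_deg c = 1} \<and> nloops c = m. w c)"
    by (subst sum.inter_filter) auto
  also have "{c. c \<in> {c. c \<in> codes {1, 3} n \<and> root_deg c = 1} \<and> nloops c = m} =
      {c. c \<in> precubic_codes \<and> nedges c = n \<and> Suc (nloops c) = Suc m}"
    by (auto simp: codes_def)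
  finally show ?thesis by (simp only: code_sum_def)
qed

lemma planar_count:
  assumes "f \<ge> 1"
  shows "code_sum planar_codes (\<lambda>c. int (nloops c)) n f =
    (\<Sum>(i, j)\<in>{(i, j). i + j = n}. \<Sum>(f1, f2)\<in>{(f1, f2). f1 + f2 = f \<and> f1 \<ge> 1 \<and> f2 \<ge> 1}.
      code_sum planar_codes (\<lambda>c. 1 + int (nverts (\<lambda>_. True) c)) i f1 *
      code_sum planar_codes (\<lambda>c. int (nverts (\<lambda>k. k = 1) c)) j f2)"
  by (rule product_coefficient[OF _ assms total_series_nth total_series_nth total_series_nth])
     (simp only: series_general(1) mult.assoc)

lemma precubic_code_count:
  assumes "f \<ge> 1"
  shows "code_sum precubic_codes (\<lambda>c. int (nloops c)) n f =
    (\<Sum>(i, j)\<in>{(i, j). i + j = n}. \<Sum>(f1, f2)\<in>{(f1, f2). f1 + f2 = f \<and> f1 \<ge> 1 \<and> f2 \<ge> 1}.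
      code_sum precubic_codes (\<lambda>c. int (nverts (\<lambda>k. k = 1) c)) i f1 *
      code_sum precubic_codes (\<lambda>c. int (nverts (\<lambda>k. k = 1) c)) j f2)"
  by (rule product_coefficient[OF _ assms root1_series_nth root1_series_nth root1_series_nth])
     (simp only: series_precubic power2_eq_square)

lemma leaf_count:
  "code_sum planar_codes (\<lambda>c. int (nverts (\<lambda>k. k = 1) c)) 0 (Suc m) = 0"
  "code_sum planar_codes (\<lambda>c. int (nverts (\<lambda>k. k = 1) c)) (Suc j) (Suc m) =
     code_sum planar_codes (\<lambda>c. 2 * int (nedges c) + 1) j (Suc m)"
  unfolding total_series_nth[symmetric] series_general(2) by simp_all

text \<open>The form suits relations that are reflexive only on part of the type, as isomorphism of
  rooted maps is.\<close>

lemma quotient_bij: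
  assumes "\<And>i. i \<in> I \<Longrightarrow> p i \<in> X" and "\<And>x. x \<in> X \<Longrightarrow> \<exists>i\<in>I. (p i, x) \<in> r"
    and "\<And>i j. i \<in> I \<Longrightarrow> j \<in> I \<Longrightarrow> (p i, p j) \<in> r \<Longrightarrow> i = j" and "sym r" "trans r"
  shows "bij_betw (\<lambda>i. r `` {p i}) I (X // r)"
  unfolding bij_betw_def
proof
  \<comment> \<open>Some representative is related to \<open>p j\<close>, and by the third
    assumption it is \<open>p j\<close> itself.\<close>
  have refl: "(p j, p j) \<in> r" if "j \<in> I" for j using assms(1-3) that by metis
  show "inj_on (\<lambda>i. r `` {p i}) I"
  proof (rule inj_onI)
    fix i j assume ij: "i \<in> I" "j \<in> I" "r `` {p i} = r `` {p j}"
    then have "p j \<in> r `` {p i}" using refl[of j] by auto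
    then show "i = j" using assms(3) ij by auto
  qed
  show "(\<lambda>i. r `` {p i}) ` I = X // r"
  proof
    show "(\<lambda>i. r `` {p i}) ` I \<subseteq> X // r" using assms(1) by (auto intro: quotientI)
    show "X // r \<subseteq> (\<lambda>i. r `` {p i}) ` I"
    proof
      fix C assume "C \<in> X // r"
      then obtain x where x: "x \<in> X" "C = r `` {x}" by (auto elim: quotientE)
      then obtain i where i: "i \<in> I" "(p i, x) \<in> r" using assms(2) by blast
      then have "r `` {p i} = r `` {x}" using assms(4,5) by (auto dest: symD transD)
      then show "C \<in> (\<lambda>i. r `` {p i}) ` I" using i x by auto
    qed
  qed
qed

definition map_of_code :: "code \<Rightarrow> nat rmap" where
  "map_of_code c = (SOME M. rep M c)"

lemma rep_map_of_code: "valid c \<Longrightarrow> rep (map_of_code c) c"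
  unfolding map_of_code_def using exists_rep[of c "{}"] by (auto intro: someI_ex)

lemma iso_rel_equiv: "sym iso_rel" "trans iso_rel"
proof -
  show "sym iso_rel"
    using map_iso_sym rooted_map_facts(1) by (fastforce simp: sym_def iso_rel_def)
  show "trans iso_rel"
    using map_iso_trans by (fastforce simp: trans_def iso_rel_def)
qed

lemma marked_iso_rel_equiv: "sym marked_iso_rel" "trans marked_iso_rel"
proof -
  show "sym marked_iso_rel"
  proof (rule symI)
    fix x y assume "(x, y) \<in> marked_iso_rel"
    then obtain M S N T g where xy: "x = (M, S)" "y = (N, T)" "rooted_map M" "rooted_map N" "S \<subseteq> darts M"
      "T \<subseteq> darts N" "map_iso g M N" "T = g ` S"
      by (auto simp: marked_iso_rel_def)
    let ?f = "inv_into (darts M) g"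
    have "map_iso ?f N M" using map_iso_sym[OF rooted_map_facts(1)] xy by blast
    moreover have "S = ?f ` T"
      using inv_into_image_cancel[OF map_isoD(5)[OF xy(7)] xy(5)] xy(8) by simp
    ultimately show "(y, x) \<in> marked_iso_rel" using xy by (auto simp: marked_iso_rel_def)
  qed
  show "trans marked_iso_rel"
  proof (rule transI)
    fix x y z assume "(x, y) \<in> marked_iso_rel" "(y, z) \<in> marked_iso_rel"
    then obtain M S N T K V f g where xy: "x = (M, S)" "y = (N, T)" "z = (K, V)"
      "rooted_map M" "rooted_map K" "S \<subseteq> darts M" "V \<subseteq> darts K"
      "map_iso g M N" "T = g ` S" "map_iso f N K" "V = f ` T"
      by (auto simp: marked_iso_rel_def)
    have "map_iso (f \<circ> g) M K" "V = (f \<circ> g) ` S" using map_iso_trans xy by (auto simp: image_comp)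
    then show "(x, z) \<in> marked_iso_rel" using xy by (auto simp: marked_iso_rel_def)
  qed
qed

lemma iso_quotient:
  assumes K: "\<And>c. c \<in> K \<Longrightarrow> valid c" and P: "\<And>M c. rep M c \<Longrightarrow> P M \<longleftrightarrow> c \<in> K"
    and planar: "\<And>M. P M \<Longrightarrow> planar_map M"
  shows "card ({M. P M} // iso_rel) = card K"
proof -
  have "bij_betw (\<lambda>c. iso_rel `` {map_of_code c}) K ({M. P M} // iso_rel)"
  proof (rule quotient_bij)
    show "map_of_code c \<in> {M. P M}" if "c \<in> K" for c
      using P[OF rep_map_of_code[OF K[OF that]]] that by simp
    show "\<exists>c\<in>K. (map_of_code c, M) \<in> iso_rel" if "M \<in> {M. P M}" for M
    proof -
      have "planar_map M" using planar that by simp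
      then obtain c where c: "rep M c" using planar_rep by blast
      then have "c \<in> K" using P that by simp
      moreover have r: "rep (map_of_code c) c" using K calculation rep_map_of_code by blast
      ultimately show ?thesis
        using rep_iso[OF r c] rep_rooted[OF c] rep_rooted[OF r] by (auto simp: iso_rel_def)
    qed
    show "c = c'" if "c \<in> K" "c' \<in> K" "(map_of_code c, map_of_code c') \<in> iso_rel" for c c'
      using that rep_unique rep_map_of_code K unfolding iso_rel_def by blast
  qed (rule iso_rel_equiv)+
  then show ?thesis using bij_betw_same_card by metis
qed

definition marked_class :: "code \<times> nat set \<Rightarrow> (nat rmap \<times> nat set) set" where
  "marked_class = (\<lambda>(c, v). marked_iso_rel `` {(map_of_code c, v)})"

definition marked_codes :: "code set \<Rightarrow> (nat rmap \<Rightarrow> nat set set) \<Rightarrow> (code \<times> nat set) set" where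
  "marked_codes K mk = (SIGMA c:K. mk (map_of_code c))"

text \<open>The common interface of vertices, leaves and discoveries, under which marks pass to
  isomorphism classes.\<close>

definition natural_marking :: "(nat rmap \<Rightarrow> nat set set) \<Rightarrow> bool" where
  "natural_marking mk \<longleftrightarrow> (\<forall>M v. rooted_map M \<longrightarrow> v \<in> mk M \<longrightarrow> v \<subseteq> darts M) \<and>
     (\<forall>M N g v. rooted_map M \<longrightarrow> rooted_map N \<longrightarrow> map_iso g M N \<longrightarrow> v \<in> mk M \<longrightarrow> g ` v \<in> mk N)"

text \<open>Rooted maps have no automorphisms, so a class of marked maps is a code with a mark on its map.\<close>

lemma marked_quotient:
  assumes K: "\<And>c. c \<in> K \<Longrightarrow> valid c" and P: "\<And>M c. rep M c \<Longrightarrow> P M \<longleftrightarrow> c \<in> K"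
    and planar: "\<And>M. P M \<Longrightarrow> planar_map M" and mk: "natural_marking mk"
  shows "bij_betw marked_class (marked_codes K mk) ({(M, v). P M \<and> v \<in> mk M} // marked_iso_rel)"
proof -
  have sub: "v \<subseteq> darts M" if "rooted_map M" "v \<in> mk M" for M v
    using mk that by (simp add: natural_marking_def)
  have nat: "g ` v \<in> mk N" if "rooted_map M" "rooted_map N" "map_iso g M N" "v \<in> mk M" for M N g v
    using mk that unfolding natural_marking_def by blast
  have "bij_betw (\<lambda>i. marked_iso_rel `` {(map_of_code (fst i), snd i)}) (marked_codes K mk)
      ({(M, v). P M \<and> v \<in> mk M} // marked_iso_rel)"
  proof (rule quotient_bij)
    show "(map_of_code (fst i), snd i) \<in> {(M, v). P M \<and> v \<in> mk M}" if "i \<in> marked_codes K mk" for i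
      using P[OF rep_map_of_code[OF K]] that by (auto simp: marked_codes_def)
    show "\<exists>i\<in>marked_codes K mk. ((map_of_code (fst i), snd i), x) \<in> marked_iso_rel"
      if "x \<in> {(M, v). P M \<and> v \<in> mk M}" for x
    proof -
      obtain M v where "x = (M, v)" by (cases x)
      then have x: "x = (M, v)" "P M" "v \<in> mk M" using that by simp_all
      then have "planar_map M" using planar by simp
      then obtain c where c: "rep M c" using planar_rep by blast
      then have cK: "c \<in> K" using P x by simp
      then have r: "rep (map_of_code c) c" using K rep_map_of_code by blast
      note R = rep_rooted[OF c] rep_rooted[OF r]
      obtain g where g: "map_iso g M (map_of_code c)" using rep_iso[OF c r] by blast
      have gv: "g ` v \<in> mk (map_of_code c)" using nat[OF R g x(3)] .
      have "((M, v), (map_of_code c, g ` v)) \<in> marked_iso_rel"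
        using R g sub[OF R(1) x(3)] sub[OF R(2) gv] by (auto simp: marked_iso_rel_def)
      then have "((map_of_code c, g ` v), x) \<in> marked_iso_rel"
        using marked_iso_rel_equiv(1) x(1) by (auto dest: symD)
      then show ?thesis using cK gv by (intro bexI[of _ "(c, g ` v)"]) (auto simp: marked_codes_def)
    qed
    show "i = j" if ij: "i \<in> marked_codes K mk" "j \<in> marked_codes K mk"
      "((map_of_code (fst i), snd i), (map_of_code (fst j), snd j)) \<in> marked_iso_rel" for i j
    proof -
      obtain g where g: "map_iso g (map_of_code (fst i)) (map_of_code (fst j))" "snd j = g ` snd i"
        "snd i \<subseteq> darts (map_of_code (fst i))" "rooted_map (map_of_code (fst i))"
        using ij(3) by (auto simp: marked_iso_rel_def)
      have "fst i \<in> K" "fst j \<in> K" using ij by (auto simp: marked_codes_def)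
      then have eq: "fst i = fst j" using rep_unique[OF rep_map_of_code rep_map_of_code g(1)] K by blast
      have g': "map_iso g (map_of_code (fst i)) (map_of_code (fst i))" using g(1) by (simp only: eq)
      have "g ` snd i = id ` snd i"
        using map_iso_id_on[OF g(4) g'] g(3) by (intro image_cong) auto
      then have "g ` snd i = snd i" by simp
      then show ?thesis using eq g(2) by (simp add: prod_eq_iff)
    qed
  qed (rule marked_iso_rel_equiv)+
  then show ?thesis by (simp add: marked_class_def case_prod_unfold)
qed

definition code_stat :: "code \<times> nat set \<Rightarrow> nat \<times> nat" where
  "code_stat = (\<lambda>(c, v). (nedges c, Suc (nloops c)))"

lemma marked_class_stats:
  assumes "valid (fst i)" "(M, S) \<in> marked_class i"
  shows "card (edges M) = fst (code_stat i)" "card (faces M) = snd (code_stat i)"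
proof -
  have r: "rep (map_of_code (fst i)) (fst i)" using assms(1) by (rule rep_map_of_code)
  obtain g where g: "map_iso g (map_of_code (fst i)) M" "rooted_map M"
    using assms(2) by (auto simp: marked_class_def marked_iso_rel_def case_prod_unfold)
  note C = map_iso_cards[OF rooted_map_facts(1)[OF rep_rooted[OF r]] g(1)]
  show "card (edges M) = fst (code_stat i)"
    using C(3) card_edges[OF g(2)] rep_stats[OF r] by (simp add: code_stat_def case_prod_unfold)
  show "card (faces M) = snd (code_stat i)"
    using C(2) rep_stats[OF r] by (simp add: code_stat_def case_prod_unfold)
qed

text \<open>Finite fibres of equal size are matched by arbitrary bijections, which are then glued
  along the common statistic.\<close>

lemma fibre_bijection:
  assumes "\<And>t. finite {x \<in> X. s x = t}" "\<And>t. finite {y \<in> Y. s' y = t}"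
    and "\<And>t. card {x \<in> X. s x = t} = card {y \<in> Y. s' y = t}"
  shows "\<exists>\<Phi>. bij_betw \<Phi> X Y \<and> (\<forall>x\<in>X. s' (\<Phi> x) = s x)"
proof -
  have "\<exists>b. bij_betw b {x \<in> X. s x = t} {y \<in> Y. s' y = t}" for t
    using assms by (intro finite_same_card_bij)
  then obtain b where b: "\<And>t. bij_betw (b t) {x \<in> X. s x = t} {y \<in> Y. s' y = t}" by metis
  define \<Phi> where "\<Phi> = (\<lambda>x. b (s x) x)"
  have im: "\<Phi> x \<in> Y \<and> s' (\<Phi> x) = s x" if "x \<in> X" for x
    using bij_betwE[OF b[of "s x"]] that by (auto simp: \<Phi>_def)
  have "inj_on \<Phi> X"
  proof (rule inj_onI)
    fix x x' assume x: "x \<in> X" "x' \<in> X" "\<Phi> x = \<Phi> x'"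
    then have "s x = s x'" using im by metis
    then show "x = x'" using x bij_betw_imp_inj_on[OF b[of "s x"]] by (auto simp: \<Phi>_def inj_on_def)
  qed
  moreover have "y \<in> \<Phi> ` X" if y: "y \<in> Y" for y
  proof -
    have "y \<in> b (s' y) ` {x \<in> X. s x = s' y}" using bij_betw_imp_surj_on[OF b[of "s' y"]] y by auto
    then obtain x where x: "x \<in> X" "s x = s' y" "y = b (s' y) x" by auto
    then have "y = \<Phi> x" by (simp add: \<Phi>_def)
    then show ?thesis using x(1) by blast
  qed
  ultimately show ?thesis using im by (auto simp: bij_betw_def)
qed

lemma fibre_marked_codes:
  assumes K: "\<And>c. c \<in> K \<Longrightarrow> valid c" and w: "\<And>c. c \<in> K \<Longrightarrow> int (card (mk (map_of_code c))) = w c"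
    and fin: "\<And>c. c \<in> K \<Longrightarrow> finite (mk (map_of_code c))"
  shows "finite {i \<in> marked_codes K mk. code_stat i = (n, f)}"
    and "int (card {i \<in> marked_codes K mk. code_stat i = (n, f)}) = code_sum K w n f"
proof -
  let ?C = "{c. c \<in> K \<and> nedges c = n \<and> Suc (nloops c) = f}"
  have finC: "finite ?C"
    by (rule finite_subset[OF _ finite_codes[of UNIV n]]) (use K in \<open>auto simp: codes_def degs_in_UNIV\<close>)
  have eq: "{i \<in> marked_codes K mk. code_stat i = (n, f)} = (SIGMA c:?C. mk (map_of_code c))"
    by (auto simp: marked_codes_def code_stat_def)
  show "finite {i \<in> marked_codes K mk. code_stat i = (n, f)}"
    unfolding eq using finC fin by (intro finite_SigmaI) auto
  show "int (card {i \<in> marked_codes K mk. code_stat i = (n, f)}) = code_sum K w n f"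
    unfolding eq code_sum_def using finC fin w by (subst card_SigmaI) auto
qed

text \<open>The convolution counts pairs by total edges and faces, so the fibres on both sides have
  equal size.\<close>

lemma bijection_from_counts:
  assumes q: "bij_betw marked_class I1 X1" "bij_betw marked_class I2 X2" "bij_betw marked_class I3 X3"
    and valid: "\<And>i. i \<in> I1 \<union> I2 \<union> I3 \<Longrightarrow> valid (fst i)"
    and fin: "\<And>n f. finite {i \<in> I1. code_stat i = (n, f)}" "\<And>n f. finite {i \<in> I2. code_stat i = (n, f)}"
      "\<And>n f. finite {i \<in> I3. code_stat i = (n, f)}"
    and count: "\<And>n f. f \<ge> 1 \<Longrightarrow> int (card {i \<in> I1. code_stat i = (n, f)}) =
      (\<Sum>(i, j)\<in>{(i, j). i + j = n}. \<Sum>(f1, f2)\<in>{(f1, f2). f1 + f2 = f \<and> f1 \<ge> 1 \<and> f2 \<ge> 1}.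
         int (card {x \<in> I2. code_stat x = (i, f1)}) * int (card {x \<in> I3. code_stat x = (j, f2)}))"
  shows "\<exists>\<Phi>. bij_betw \<Phi> X1 (X2 \<times> X3) \<and> preserves_edges_faces X1 \<Phi>"
proof -
  let ?s = "\<lambda>(x, y). (fst (code_stat x) + fst (code_stat y), snd (code_stat x) + snd (code_stat y))"
  have pos: "snd (code_stat x) \<ge> 1" for x by (simp add: code_stat_def case_prod_unfold)
  have fibre: "finite {y \<in> I2 \<times> I3. ?s y = (n, f)} \<and>
      int (card {y \<in> I2 \<times> I3. ?s y = (n, f)}) = int (card {i \<in> I1. code_stat i = (n, f)})" for n f
  proof -
    let ?A = "{(i, j). i + j = n} :: (nat \<times> nat) set"
    let ?B = "{(f1, f2). f1 + f2 = f \<and> f1 \<ge> 1 \<and> f2 \<ge> 1} :: (nat \<times> nat) set"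
    have finA: "finite ?A" by (rule finite_subset[of _ "{..n} \<times> {..n}"]) auto
    have finB: "finite ?B" by (rule finite_subset[of _ "{..f} \<times> {..f}"]) auto
    let ?F = "\<lambda>((i, j), (f1, f2)). {x \<in> I2. code_stat x = (i, f1)} \<times> {x \<in> I3. code_stat x = (j, f2)}"
    have eq: "{y \<in> I2 \<times> I3. ?s y = (n, f)} = (\<Union>t\<in>?A \<times> ?B. ?F t)"
    proof (intro equalityI subsetI)
      fix y assume "y \<in> {y \<in> I2 \<times> I3. ?s y = (n, f)}"
      then obtain u v where y: "y = (u, v)" "u \<in> I2" "v \<in> I3"
        "fst (code_stat u) + fst (code_stat v) = n" "snd (code_stat u) + snd (code_stat v) = f" by auto
      let ?t = "((fst (code_stat u), fst (code_stat v)), (snd (code_stat u), snd (code_stat v)))"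
      have "?t \<in> ?A \<times> ?B" using y pos[of u] pos[of v] by simp
      moreover have "y \<in> ?F ?t" using y by simp
      ultimately show "y \<in> (\<Union>t\<in>?A \<times> ?B. ?F t)" by (rule UN_I)
    qed auto
    have finF: "finite (?F t)" for t using fin by (cases t) auto
    have "finite (\<Union>t\<in>?A \<times> ?B. ?F t)" using finA finB finF by blast
    moreover have "int (card (\<Union>t\<in>?A \<times> ?B. ?F t)) = (\<Sum>t\<in>?A \<times> ?B. int (card (?F t)))"
      using finA finB finF by (subst card_UN_disjoint) auto
    moreover have "\<dots> = (\<Sum>(i, j)\<in>?A. \<Sum>(f1, f2)\<in>?B.
         int (card {x \<in> I2. code_stat x = (i, f1)}) * int (card {x \<in> I3. code_stat x = (j, f2)}))"
      by (simp add: sum.cartesian_product case_prod_unfold card_cartesian_product)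
    moreover have "\<dots> = int (card {i \<in> I1. code_stat i = (n, f)})"
    proof (cases "f \<ge> 1")
      case True
      then show ?thesis using count by simp
    next
      case False
      \<comment> \<open>No map has zero faces, so both fibres are empty.\<close>
      then have "?B = {}" "{i \<in> I1. code_stat i = (n, f)} = {}" by (auto simp: code_stat_def)
      then show ?thesis by (simp only: sum.empty card.empty case_prod_unfold) simp
    qed
    ultimately show ?thesis unfolding eq by simp
  qed
  have "\<exists>\<Phi>0. bij_betw \<Phi>0 I1 (I2 \<times> I3) \<and> (\<forall>x\<in>I1. ?s (\<Phi>0 x) = code_stat x)"
  proof (rule fibre_bijection)
    fix t :: "nat \<times> nat"
    obtain n f where t: "t = (n, f)" by (cases t)
    show "finite {x \<in> I1. code_stat x = t}" unfolding t by (rule fin(1))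
    show "finite {y \<in> I2 \<times> I3. ?s y = t}" unfolding t using fibre by (rule conjunct1)
    show "card {x \<in> I1. code_stat x = t} = card {y \<in> I2 \<times> I3. ?s y = t}"
      unfolding t using fibre[of n f, THEN conjunct2] by (simp only: of_nat_eq_iff)
  qed
  then obtain \<Phi>0 where \<Phi>0: "bij_betw \<Phi>0 I1 (I2 \<times> I3)" "\<And>x. x \<in> I1 \<Longrightarrow> ?s (\<Phi>0 x) = code_stat x"
    by blast
  let ?q = "map_prod marked_class marked_class"
  have qb: "bij_betw ?q (I2 \<times> I3) (X2 \<times> X3)" using q(2,3) by (rule bij_betw_map_prod)
  \<comment> \<open>A class is sent to its marked code, then to the matched pair of marked codes,
    then to their classes.\<close>
  define \<Phi> where "\<Phi> = ?q \<circ> \<Phi>0 \<circ> inv_into I1 marked_class"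
  have "bij_betw \<Phi> X1 (X2 \<times> X3)"
    unfolding \<Phi>_def comp_assoc
    using bij_betw_trans[OF bij_betw_inv_into[OF q(1)] bij_betw_trans[OF \<Phi>0(1) qb]] by (simp add: comp_assoc)
  moreover have "preserves_edges_faces X1 \<Phi>"
    unfolding preserves_edges_faces_def
  proof (intro ballI, clarify)
    fix x M S M1 S1 M2 S2
    assume x: "x \<in> X1" "(M, S) \<in> x" "(M1, S1) \<in> fst (\<Phi> x)" "(M2, S2) \<in> snd (\<Phi> x)"
    obtain i where i: "i \<in> I1" "x = marked_class i" using q(1) x(1) by (auto simp: bij_betw_def)
    have "inv_into I1 marked_class x = i" using q(1) i by (auto simp: bij_betw_def)
    then have P: "\<Phi> x = ?q (\<Phi>0 i)" by (simp add: \<Phi>_def)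
    obtain i2 i3 where i23: "\<Phi>0 i = (i2, i3)" by (cases "\<Phi>0 i")
    have "i2 \<in> I2" "i3 \<in> I3" using bij_betwE[OF \<Phi>0(1)] i i23 by force+
    then have "valid (fst i)" "valid (fst i2)" "valid (fst i3)" using valid i by auto
    note st = marked_class_stats[OF this(1)] marked_class_stats[OF this(2)] marked_class_stats[OF this(3)]
    have "code_stat i = (fst (code_stat i2) + fst (code_stat i3), snd (code_stat i2) + snd (code_stat i3))"
      using \<Phi>0(2)[OF i(1)] i23 by simp
    then show "card (edges M) = card (edges M1) + card (edges M2) \<and>
        card (faces M) = card (faces M1) + card (faces M2)"
      using st x i P i23 by simp
  qed
  ultimately show ?thesis by blast
qed

lemma degree_root: "degree M (root_vertex M) = card (root_vertex M) - 1" if "rooted_map M"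
proof -
  have "arrow M \<in> root_vertex M"
    unfolding root_vertex_def vertex_of_def using rooted_map_facts(2,4)[OF that] by (intro orbit_self)
  then show ?thesis
    using vertex_subset[OF that root_vertex_in[OF that]] rooted_map_facts(2)[OF that]
    by (auto simp: degree_def intro: card_Diff_singleton finite_subset)
qed

lemma degree_other:
  assumes "rooted_map M" "v \<in> other_vertices M"
  shows "degree M v = card v"
proof -
  obtain x where x: "v = vertex_of M x" "v \<noteq> root_vertex M"
    using assms(2) by (auto simp: other_vertices_def vertices_def)
  have "arrow M \<notin> v"
    using x orbit_eq[OF rooted_map_facts(4,2)[OF assms(1)], of "arrow M" x]
    by (auto simp: root_vertex_def vertex_of_def)
  then show ?thesis by (simp add: degree_def)
qed

lemma leaves_other: "rooted_map M \<Longrightarrow> leaves M = {v \<in> other_vertices M. card v = 1}"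
proof -
  assume M: "rooted_map M"
  have "leaves M = {v \<in> other_vertices M. degree M v = 1}"
    by (simp add: leaves_def other_vertices_def conj_ac)
  also have "\<dots> = {v \<in> other_vertices M. card v = 1}"
    using degree_other[OF M] by (intro Collect_cong conj_cong) simp_all
  finally show ?thesis .
qed

lemma rep_nverts: "rep M c \<Longrightarrow> card {v \<in> other_vertices M. P (card v)} = nverts P c"
proof -
  assume "rep M c"
  then have "\<forall>P. card {v \<in> other_vertices M. P (card v)} = nverts P c" using rep_stats by blast
  then show ?thesis by simp
qed

lemma precubic_rep:
  assumes "rep M c"
  shows "planar_precubic_map M \<longleftrightarrow> c \<in> precubic_codes"
proof -
  note R = rep_rooted[OF assms] and St = rep_stats[OF assms]
  have rd: "degree M (root_vertex M) = root_deg c" using degree_root[OF R] St by simp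
  have "vertices M = insert (root_vertex M) (other_vertices M)"
    using root_vertex_in[OF R] by (auto simp: other_vertices_def)
  then have "(\<forall>v\<in>vertices M. degree M v \<in> {1, 3}) \<and> degree M (root_vertex M) = 1 \<longleftrightarrow>
      (\<forall>v\<in>other_vertices M. card v \<in> {1, 3}) \<and> root_deg c = 1"
    using degree_other[OF R] rd by auto
  \<comment> \<open>Absence of forbidden degrees is rephrased as a zero count, which the code
    determines.\<close>
  also have "(\<forall>v\<in>other_vertices M. card v \<in> {1, 3}) \<longleftrightarrow> degs_in {1, 3} c"
  proof -
    have "finite (other_vertices M)" using finite_vertices[OF R] by (simp add: other_vertices_def)
    then have "(\<forall>v\<in>other_vertices M. card v \<in> {1, 3}) \<longleftrightarrow> card {v \<in> other_vertices M. card v \<notin> {1, 3}} = 0"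
      by auto
    moreover have "card {v \<in> other_vertices M. card v \<notin> {1, 3}} = nverts (\<lambda>k. k \<notin> {1, 3}) c"
      by (rule rep_nverts[OF assms])
    ultimately show ?thesis by (simp only: degs_in_iff_nverts)
  qed
  finally show ?thesis using rep_planar[OF assms] St by (auto simp: planar_precubic_map_def)
qed

lemma natural_vertices: "natural_marking vertices"
  unfolding natural_marking_def
proof (intro conjI allI impI)
  show "v \<subseteq> darts M" if "rooted_map M" "v \<in> vertices M" for M :: "nat rmap" and v
    using that by (rule vertex_subset)
  show "g ` v \<in> vertices N" if "rooted_map M" "rooted_map N" "map_iso g M N" "v \<in> vertices M"
    for M N :: "nat rmap" and g v
    using that map_iso_vertices[OF rooted_map_facts(1)] by blast
qed

lemma natural_leaves: "natural_marking leaves"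
  unfolding natural_marking_def
proof (intro conjI allI impI)
  show "v \<subseteq> darts M" if "rooted_map M" "v \<in> leaves M" for M :: "nat rmap" and v
    using that vertex_subset by (auto simp: leaves_def)
  show "g ` v \<in> leaves N" if M: "rooted_map M" "rooted_map N" "map_iso g M N" and v: "v \<in> leaves M"
    for M N :: "nat rmap" and g v
  proof -
    have v': "v \<in> vertices M" "v \<noteq> root_vertex M" "card v = 1"
      using v M(1) leaves_other by (auto simp: other_vertices_def)
    have pre: "premap M" using rooted_map_facts(1)[OF M(1)] .
    have "v \<in> Pow (darts M)" "root_vertex M \<in> Pow (darts M)"
      using vertex_subset[OF M(1)] v'(1) root_vertex_in[OF M(1)] by auto
    then have "g ` v \<noteq> g ` root_vertex M" using inj_onD[OF map_iso_inj_image[OF pre M(3)]] v'(2) by blast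
    moreover have "g ` v \<in> vertices N" using map_iso_vertices[OF pre M(3)] v'(1) by blast
    moreover have "card (g ` v) = 1"
      using v'(3) by (metis card_1_singletonE card_1_singleton_iff One_nat_def image_insert image_empty)
    ultimately show ?thesis
      using leaves_other[OF M(2)] map_iso_root_vertex[OF pre M(3)] by (simp add: other_vertices_def)
  qed
qed

lemma natural_discoveries: "natural_marking discoveries"
  unfolding natural_marking_def
proof (intro conjI allI impI)
  show "v \<subseteq> darts M" if "rooted_map M" "v \<in> discoveries M" for M :: "nat rmap" and v
    using card_discoveries(2)[OF that(1)] edges_subset[OF that(1)] that(2) by blast
  show "g ` v \<in> discoveries N" if "rooted_map M" "rooted_map N" "map_iso g M N" "v \<in> discoveries M"
    for M N :: "nat rmap" and g v
    using that(1,3,4) by (rule discoveries_iso)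
qed

lemma planar_rep_iff: "rep M c \<Longrightarrow> planar_map M \<longleftrightarrow> c \<in> planar_codes"
  using rep_planar rep_stats by auto

lemma mark_counts:
  assumes "valid c"
  shows "int (card (vertices (map_of_code c))) = 1 + int (nverts (\<lambda>_. True) c)"
    "int (card (leaves (map_of_code c))) = int (nverts (\<lambda>k. k = 1) c)"
    "int (card (discoveries (map_of_code c))) = int (nloops c)"
    "finite (vertices (map_of_code c))" "finite (leaves (map_of_code c))" "finite (discoveries (map_of_code c))"
proof -
  note r = rep_map_of_code[OF assms]
  note R = rep_rooted[OF r] and St = rep_stats[OF r]
  have "card (other_vertices (map_of_code c)) = nverts (\<lambda>_. True) c"
    using St by (auto dest: spec[of _ "\<lambda>_. True"])
  then show "int (card (vertices (map_of_code c))) = 1 + int (nverts (\<lambda>_. True) c)"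
    using card_vertices_other[OF R] by simp
  have "card {v \<in> other_vertices (map_of_code c). card v = 1} = nverts (\<lambda>k. k = 1) c"
    by (rule rep_nverts[OF r])
  then show "int (card (leaves (map_of_code c))) = int (nverts (\<lambda>k. k = 1) c)"
    using leaves_other[OF R] by simp
  show "int (card (discoveries (map_of_code c))) = int (nloops c)"
    using card_discoveries(1)[OF R] St by simp
  show "finite (vertices (map_of_code c))" using R by (rule finite_vertices)
  then show "finite (leaves (map_of_code c))" by (auto simp: leaves_def intro: finite_subset)
  have "finite (edges (map_of_code c))" using rooted_map_facts(2)[OF R] by (simp add: edges_def)
  then show "finite (discoveries (map_of_code c))" using card_discoveries(2)[OF R]
      by (rule finite_subset[rotated])
qed

lemma code_sum_cong:
  "(\<And>c. c \<in> K \<Longrightarrow> nedges c = n \<Longrightarrow> Suc (nloops c) = f \<Longrightarrow> v c = w c) \<Longrightarrow> code_sum K v n f = code_sum K w n f"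
  unfolding code_sum_def by (rule sum.cong) auto

lemma code_sum_const: "code_sum K (\<lambda>_. a) n f = a * int (card {c \<in> K. nedges c = n \<and> Suc (nloops c) = f})"
  by (simp add: code_sum_def)

lemma rep_edges_faces:
  assumes "rep M c"
  shows "card (edges M) = nedges c" "card (faces M) = Suc (nloops c)"
  using card_edges[OF rep_rooted[OF assms]] rep_stats[OF assms] by auto

lemma Q_codes: "Q n f = card {c \<in> planar_codes. nedges c = n \<and> Suc (nloops c) = f}"
  unfolding Q_def by (rule iso_quotient) (auto simp: planar_rep_iff rep_edges_faces)

lemma precubic_count_codes:
  "precubic_count n f = card {c \<in> precubic_codes. nedges c = n \<and> Suc (nloops c) = f}"
  unfolding precubic_count_def
proof (rule iso_quotient)
  show "planar_map M" if "planar_precubic_map M \<and> card (edges M) = n \<and> card (faces M) = f" for M :: "nat rmap"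
    using that by (simp add: planar_precubic_map_def)
qed (auto simp: precubic_rep rep_edges_faces)

lemma precubic_leaf_count_codes:
  "int (precubic_leaf_count n f) = code_sum precubic_codes (\<lambda>c. int (nverts (\<lambda>k. k = 1) c)) n f"
proof -
  let ?K = "{c \<in> precubic_codes. nedges c = n \<and> Suc (nloops c) = f}"
  let ?P = "\<lambda>M :: nat rmap. planar_precubic_map M \<and> card (edges M) = n \<and> card (faces M) = f"
  have bij: "bij_betw marked_class (marked_codes ?K leaves) ({(M, v). ?P M \<and> v \<in> leaves M} // marked_iso_rel)"
  proof (rule marked_quotient[OF _ _ _ natural_leaves])
    show "planar_map M" if "?P M" for M
      using that by (simp add: planar_precubic_map_def)
  qed (auto simp: precubic_rep rep_edges_faces)
  have "{(M, v). ?P M \<and> v \<in> leaves M} = {(M, v). planar_precubic_map M \<and> v \<in> leaves M \<and>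
              card (edges M) = n \<and> card (faces M) = f}" by auto
  then have "precubic_leaf_count n f = card (marked_codes ?K leaves)"
    using bij_betw_same_card[OF bij] by (simp only: precubic_leaf_count_def)
  also have "marked_codes ?K leaves = {i \<in> marked_codes precubic_codes leaves. code_stat i = (n, f)}"
    by (auto simp: marked_codes_def code_stat_def)
  also have "int (card \<dots>) = code_sum precubic_codes (\<lambda>c. int (nverts (\<lambda>k. k = 1) c)) n f"
    by (rule fibre_marked_codes(2)) (auto simp: mark_counts)
  finally show ?thesis .
qed

lemma code_sum_nloops:
  "code_sum K (\<lambda>c. int (nloops c)) n f = (int f - 1) * int (card {c \<in> K. nedges c = n \<and> Suc (nloops c) = f})"
  unfolding code_sum_const[symmetric] by (rule code_sum_cong) auto

lemma marked_bijection:
  assumes K: "\<And>c. c \<in> K \<Longrightarrow> valid c" and P: "\<And>M c. rep M c \<Longrightarrow> P M \<longleftrightarrow> c \<in> K"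
    and planar: "\<And>M. P M \<Longrightarrow> planar_map M"
    and mk: "natural_marking mk1" "natural_marking mk2"
    and w1: "\<And>c. c \<in> K \<Longrightarrow> int (card (mk1 (map_of_code c))) = w1 c" "\<And>c. c \<in> K \<Longrightarrow> finite (mk1 (map_of_code c))"
    and w2: "\<And>c. c \<in> K \<Longrightarrow> int (card (mk2 (map_of_code c))) = w2 c" "\<And>c. c \<in> K \<Longrightarrow> finite (mk2 (map_of_code c))"
    and count: "\<And>n f. f \<ge> 1 \<Longrightarrow> code_sum K (\<lambda>c. int (nloops c)) n f =
      (\<Sum>(i, j)\<in>{(i, j). i + j = n}. \<Sum>(f1, f2)\<in>{(f1, f2). f1 + f2 = f \<and> f1 \<ge> 1 \<and> f2 \<ge> 1}.
         code_sum K w1 i f1 * code_sum K w2 j f2)"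
  defines "cls \<equiv> \<lambda>mk. {(M, v). P M \<and> v \<in> mk M} // marked_iso_rel"
  shows "\<exists>\<Phi>. bij_betw \<Phi> (cls discoveries) (cls mk1 \<times> cls mk2) \<and> preserves_edges_faces (cls discoveries) \<Phi>"
proof -
  have q: "bij_betw marked_class (marked_codes K mk) (cls mk)" if "natural_marking mk" for mk
    unfolding cls_def by (rule marked_quotient[OF K P planar that])
  have F1: "finite {i \<in> marked_codes K mk1. code_stat i = (n, f)}"
    "int (card {i \<in> marked_codes K mk1. code_stat i = (n, f)}) = code_sum K w1 n f" for n f
    using K w1 by (auto intro: fibre_marked_codes)
  have F2: "finite {i \<in> marked_codes K mk2. code_stat i = (n, f)}"
    "int (card {i \<in> marked_codes K mk2. code_stat i = (n, f)}) = code_sum K w2 n f" for n f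
    using K w2 by (auto intro: fibre_marked_codes)
  have F: "finite {i \<in> marked_codes K discoveries. code_stat i = (n, f)}"
    "int (card {i \<in> marked_codes K discoveries. code_stat i = (n, f)}) =
        code_sum K (\<lambda>c. int (nloops c)) n f" for n f
    by (rule fibre_marked_codes[OF K]; simp add: K mark_counts)+
  show ?thesis
  proof (rule bijection_from_counts[OF q[OF natural_discoveries] q[OF mk(1)] q[OF mk(2)]])
    show "valid (fst i)" if "i \<in> marked_codes K discoveries \<union> marked_codes K mk1 \<union> marked_codes K mk2" for i
      using that K by (auto simp: marked_codes_def)
    fix n f :: nat assume "f \<ge> 1"
    then show "int (card {i \<in> marked_codes K discoveries. code_stat i = (n, f)}) =
      (\<Sum>(i, j)\<in>{(i, j). i + j = n}. \<Sum>(f1, f2)\<in>{(f1, f2). f1 + f2 = f \<and> f1 \<ge> 1 \<and> f2 \<ge> 1}.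
         int (card {x \<in> marked_codes K mk1. code_stat x = (i, f1)}) *
         int (card {x \<in> marked_codes K mk2. code_stat x = (j, f2)}))"
      unfolding F(2) F1(2) F2(2) by (rule count)
  qed (rule F(1) F1(1) F2(1))+
qed

lemma planar_bijection:
  "\<exists>\<Phi>. bij_betw \<Phi> planar_with_discovery (planar_with_vertex \<times> planar_with_leaf) \<and>
          preserves_edges_faces planar_with_discovery \<Phi>"
  unfolding planar_with_discovery_def planar_with_vertex_def planar_with_leaf_def
  by (rule marked_bijection[OF _ planar_rep_iff _ natural_vertices natural_leaves _ _ _ _ planar_count])
     (simp_all add: mark_counts)

lemma precubic_bijection:
  "\<exists>\<Psi>. bij_betw \<Psi> precubic_with_discovery (precubic_with_leaf \<times> precubic_with_leaf) \<and>
          preserves_edges_faces precubic_with_discovery \<Psi>"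
  unfolding precubic_with_discovery_def precubic_with_leaf_def
  by (rule marked_bijection[OF _ precubic_rep _ natural_leaves natural_leaves _ _ _ _ precubic_code_count])
     (simp_all add: mark_counts planar_precubic_map_def)

text \<open>The bijection distributes all n edges, the recurrence only \<open>n - 1\<close>: the
  leaf series is t times the corner series, so the edge of the marked leaf is split off.\<close>

lemma planar_recurrence:
  assumes "f \<ge> 1"
  shows "(int f - 1) * int (Q n f) =
        (\<Sum>(i, j)\<in>{(i, j). int i + int j = int n - 1}.
           \<Sum>(f1, f2)\<in>{(f1, f2). f1 + f2 = f \<and> f1 \<ge> 1 \<and> f2 \<ge> 1}.
             (2 + int i - int f1) * int (Q i f1) * (2 * int j + 1) * int (Q j f2))"
proof -
  let ?B = "{(f1, f2). f1 + f2 = f \<and> f1 \<ge> 1 \<and> f2 \<ge> 1} :: (nat \<times> nat) set"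
  let ?v = "code_sum planar_codes (\<lambda>c. 1 + int (nverts (\<lambda>_. True) c))"
  let ?l = "code_sum planar_codes (\<lambda>c. int (nverts (\<lambda>k. k = 1) c))"
  \<comment> \<open>By Euler's relation the number of vertices is constant on codes with given
    numbers of edges and faces.\<close>
  have v: "?v i f1 = (2 + int i - int f1) * int (Q i f1)" for i f1
    unfolding Q_codes code_sum_const[symmetric] by (rule code_sum_cong) (auto simp: nedges_eq)
  have l: "?l (Suc j) f2 = (2 * int j + 1) * int (Q j f2)" if "f2 \<ge> 1" for j f2
  proof -
    have "?l (Suc j) f2 = code_sum planar_codes (\<lambda>c. 2 * int (nedges c) + 1) j f2"
      using leaf_count(2)[of j "f2 - 1"] that by simp
    also have "\<dots> = (2 * int j + 1) * int (Q j f2)"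
      unfolding Q_codes code_sum_const[symmetric] by (rule code_sum_cong) auto
    finally show ?thesis .
  qed
  have l0: "?l 0 f2 = 0" if "f2 \<ge> 1" for f2
    using leaf_count(1)[of "f2 - 1"] that by simp
  have "(int f - 1) * int (Q n f) = (\<Sum>(i, j)\<in>{(i, j). i + j = n}. \<Sum>(f1, f2)\<in>?B. ?v i f1 * ?l j f2)"
    unfolding Q_codes code_sum_nloops[symmetric] using assms by (rule planar_count)
  \<comment> \<open>A map without edges has no leaf, so only positive j contribute; they are then
    shifted down by one.\<close>
  also have "\<dots> = (\<Sum>(i, j)\<in>{(i, j). i + j = n \<and> j \<noteq> 0}. \<Sum>(f1, f2)\<in>?B. ?v i f1 * ?l j f2)"
  proof (rule sum.mono_neutral_right)
    show "finite {(i, j). i + j = n}" by (rule finite_subset[of _ "{..n} \<times> {..n}"]) auto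
    show "\<forall>x\<in>{(i, j). i + j = n} - {(i, j). i + j = n \<and> j \<noteq> 0}.
        (case x of (i, j) \<Rightarrow> \<Sum>(f1, f2)\<in>?B. ?v i f1 * ?l j f2) = 0"
    proof
      fix x assume "x \<in> {(i, j). i + j = n} - {(i, j). i + j = n \<and> j \<noteq> 0}"
      then have "snd x = 0" by (auto simp: case_prod_unfold)
      then obtain i where x: "x = (i, 0)" by (metis prod.collapse)
      have "(\<Sum>(f1, f2)\<in>?B. ?v i f1 * ?l 0 f2) = 0"
        by (rule sum.neutral) (auto simp: l0 simp del: One_nat_def)
      then show "(case x of (i, j) \<Rightarrow> \<Sum>(f1, f2)\<in>?B. ?v i f1 * ?l j f2) = 0"
        by (simp only: x case_prod_conv)
    qed
  qed auto
  also have "\<dots> = (\<Sum>(i, j)\<in>{(i, j). int i + int j = int n - 1}. \<Sum>(f1, f2)\<in>?B. ?v i f1 * ?l (Suc j) f2)"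
    by (rule sum.reindex_bij_witness[of _ "\<lambda>(i, j). (i, Suc j)" "\<lambda>(i, j). (i, j - 1)"]) auto
  also have "\<dots> = (\<Sum>(i, j)\<in>{(i, j). int i + int j = int n - 1}. \<Sum>(f1, f2)\<in>?B.
             (2 + int i - int f1) * int (Q i f1) * (2 * int j + 1) * int (Q j f2))"
    by (intro sum.cong refl) (auto intro!: sum.cong simp: v l mult.assoc simp del: One_nat_def)
  finally show ?thesis .
qed

lemma precubic_recurrence:
  assumes "f \<ge> 1"
  shows "(int f - 1) * int (precubic_count n f) =
        (\<Sum>(i, j)\<in>{(i, j). i + j = n}.
           \<Sum>(f1, f2)\<in>{(f1, f2). f1 + f2 = f \<and> f1 \<ge> 1 \<and> f2 \<ge> 1}.
             int (precubic_leaf_count i f1) * int (precubic_leaf_count j f2))"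
  unfolding precubic_count_codes code_sum_nloops[symmetric] precubic_leaf_count_codes
  using assms by (rule precubic_code_count)

theorem theorem1:
  shows
    "(\<exists>\<Phi>. bij_betw \<Phi> planar_with_discovery (planar_with_vertex \<times> planar_with_leaf) \<and>
          preserves_edges_faces planar_with_discovery \<Phi>) \<and>
     (\<forall>M :: nat rmap. planar_map M \<longrightarrow>
        int (card (vertices M)) = 2 + int (card (edges M)) - int (card (faces M))) \<and>
     (\<forall>n f. f \<ge> 1 \<longrightarrow>
        (int f - 1) * int (Q n f) =
        (\<Sum>(i, j)\<in>{(i, j). int i + int j = int n - 1}.
           \<Sum>(f1, f2)\<in>{(f1, f2). f1 + f2 = f \<and> f1 \<ge> 1 \<and> f2 \<ge> 1}.
             (2 + int i - int f1) * int (Q i f1) * (2 * int j + 1) * int (Q j f2))) \<and>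
     (\<exists>\<Psi>. bij_betw \<Psi> precubic_with_discovery (precubic_with_leaf \<times> precubic_with_leaf) \<and>
          preserves_edges_faces precubic_with_discovery \<Psi>) \<and>
     (\<forall>n f. f \<ge> 1 \<longrightarrow>
        (int f - 1) * int (precubic_count n f) =
        (\<Sum>(i, j)\<in>{(i, j). i + j = n}.
           \<Sum>(f1, f2)\<in>{(f1, f2). f1 + f2 = f \<and> f1 \<ge> 1 \<and> f2 \<ge> 1}.
             int (precubic_leaf_count i f1) * int (precubic_leaf_count j f2)))"
proof (intro conjI allI impI)
  fix M :: "nat rmap" assume "planar_map M"
  then show "int (card (vertices M)) = 2 + int (card (edges M)) - int (card (faces M))"
    by (simp add: planar_map_def has_genus_def)
qed (rule planar_bijection precubic_bijection | erule planar_recurrence precubic_recurrence)+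

end
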